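(* Let $\frac14\le\alpha<1$ and let $u$ be a solution of $$\frac{\alpha}{2}\Delta u+e^{u}-1=0\quad\text{on } S^2.$$ If $e^u\le 6\alpha$ on $S^2$, then $u$ is axially symmetric. In particular, if $\alpha=\frac13$ and $e^u\le2$ on $S^2$, then $u\equiv0$.
   Context: $S^2\subset\mathbb{R}^3$ is the unit sphere with the metric $g_0$ induced from the flat metric of $\mathbb{R}^3$, and $\Delta$ is the Laplace–Beltrami operator of $(S^2,g_0)$ (nonpositive sign convention, so $\Delta x_i=-2x_i$ for the coordinate functions). A solution is a smooth real-valued function on $S^2$ satisfying the equation. A function on $S^2$ is axially symmetric if there is a line through the origin of $\mathbb{R}^3$ such that the function is invariant under all rotations about this line. *)

theory Defs
  imports "HOL-Analysis.Analysis"
begin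

abbreviation S2 :: "(real^3) set" where
  "S2 \<equiv> sphere 0 1"

primrec Ck_on :: "nat \<Rightarrow> ('a::euclidean_space \<Rightarrow> real) \<Rightarrow> 'a set \<Rightarrow> bool" where
  "Ck_on 0 f U \<longleftrightarrow> continuous_on U f"
| "Ck_on (Suc k) f U \<longleftrightarrow>
     (\<forall>x\<in>U. f differentiable (at x)) \<and>
     (\<forall>b\<in>Basis. Ck_on k (\<lambda>x. frechet_derivative f (at x) b) U)"

text \<open>A function on the sphere is given by the values on \<^term>\<open>S2\<close> of a function on the ambient
  space; nothing below depends on its values elsewhere. Smoothness is the usual notion for a
  subset of Euclidean space: local extendability to smooth functions on open sets.\<close>

definition smooth_on_S2 :: "(real^3 \<Rightarrow> real) \<Rightarrow> bool" where
  "smooth_on_S2 u \<longleftrightarrow>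
     (\<forall>p\<in>S2. \<exists>U F. open U \<and> p \<in> U \<and> (\<forall>k. Ck_on k F U) \<and> (\<forall>x\<in>U \<inter> S2. F x = u x))"

text \<open>The tangent plane of the sphere at \<open>p\<close> is the orthogonal complement of \<open>p\<close>, with the ambient
  inner product as metric. A derivative at \<open>p\<close> within \<^term>\<open>S2\<close> is determined exactly on that plane
  (see \<open>has_derivative_S2_unique\<close> below), so the gradient is the tangent vector representing it.\<close>

definition grad_S2 :: "(real^3 \<Rightarrow> real) \<Rightarrow> real^3 \<Rightarrow> real^3" where
  "grad_S2 u p = (THE v. v \<bullet> p = 0 \<and> (u has_derivative (\<lambda>h. v \<bullet> h)) (at p within S2))"

definition orthonormal_frame_S2 :: "real^3 \<Rightarrow> real^3 \<Rightarrow> real^3 \<Rightarrow> bool" where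
  "orthonormal_frame_S2 p e1 e2 \<longleftrightarrow>
     e1 \<bullet> p = 0 \<and> e2 \<bullet> p = 0 \<and> norm e1 = 1 \<and> norm e2 = 1 \<and> e1 \<bullet> e2 = 0"

text \<open>The Levi-Civita connection of the induced metric is the tangential part of the ambient
  directional derivative, and the divergence of a tangent field \<open>X\<close> is the trace of its covariant
  derivative. Pairing with tangent vectors makes the tangential projection superfluous.\<close>

definition div_S2 :: "(real^3 \<Rightarrow> real^3) \<Rightarrow> real^3 \<Rightarrow> real" where
  "div_S2 X p = (THE d. \<exists>D e1 e2. (X has_derivative D) (at p within S2) \<and>
     orthonormal_frame_S2 p e1 e2 \<and> d = D e1 \<bullet> e1 + D e2 \<bullet> e2)"

definition laplace_beltrami_S2 :: "(real^3 \<Rightarrow> real) \<Rightarrow> real^3 \<Rightarrow> real" where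
  "laplace_beltrami_S2 u = div_S2 (grad_S2 u)"

text \<open>The line is spanned by \<open>a\<close>, and the rotations about it are the elements of \<open>SO(3)\<close> fixing \<open>a\<close>.\<close>

definition axially_symmetric_S2 :: "(real^3 \<Rightarrow> real) \<Rightarrow> bool" where
  "axially_symmetric_S2 u \<longleftrightarrow>
     (\<exists>a. a \<noteq> 0 \<and> (\<forall>R :: real^3^3. rotation_matrix R \<and> R *v a = a \<longrightarrow>
        (\<forall>x\<in>S2. u (R *v x) = u x)))"

definition is_solution_S2 :: "real \<Rightarrow> (real^3 \<Rightarrow> real) \<Rightarrow> bool" where
  "is_solution_S2 \<alpha> u \<longleftrightarrow> smooth_on_S2 u \<and>
     (\<forall>x\<in>S2. \<alpha> / 2 * laplace_beltrami_S2 u x + exp (u x) - 1 = 0)"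

lemma has_derivative_S2_unique:
  fixes f :: "real^3 \<Rightarrow> 'b::real_normed_vector"
  assumes p: "p \<in> S2" and v: "v \<bullet> p = 0"
    and D: "(f has_derivative D) (at p within S2)"
    and D': "(f has_derivative D') (at p within S2)"
  shows "D v = D' v"
proof (cases "v = 0")
  case True
  then show ?thesis
    using has_derivative_bounded_linear[OF D] has_derivative_bounded_linear[OF D']
    by (simp add: linear_simps)
next
  case False
  define e where "e = v /\<^sub>R norm v"
  have e: "norm e = 1" "e \<bullet> p = 0" and ve: "v = norm v *\<^sub>R e"
    using False v by (auto simp: e_def)
  define \<gamma> where "\<gamma> = (\<lambda>t::real. cos t *\<^sub>R p + sin t *\<^sub>R e)"
  have pp: "p \<bullet> p = 1" and ee: "e \<bullet> e = 1"
    using p e by (auto simp: norm_eq_1)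
  have "\<gamma> t \<bullet> \<gamma> t = 1" for t
    using e(2) pp ee sin_cos_squared_add2[of t]
    by (simp add: \<gamma>_def inner_add_left inner_add_right inner_commute power2_eq_square)
  then have ran: "range \<gamma> \<subseteq> S2" by (auto simp: norm_eq_1)
  have \<gamma>0: "\<gamma> 0 = p" by (simp add: \<gamma>_def)
  have \<gamma>': "(\<gamma> has_derivative (\<lambda>t. t *\<^sub>R e)) (at 0)"
    unfolding \<gamma>_def by (auto intro!: derivative_eq_intros)
  have chain: "((f \<circ> \<gamma>) has_derivative (E \<circ> (\<lambda>t. t *\<^sub>R e))) (at 0)"
    if "(f has_derivative E) (at p within S2)" for E
    by (rule diff_chain_within[OF \<gamma>'])
      (use that ran \<gamma>0 in \<open>auto intro: has_derivative_subset\<close>)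
  have "(D \<circ> (\<lambda>t. t *\<^sub>R e)) = (D' \<circ> (\<lambda>t. t *\<^sub>R e))"
    using chain[OF D] chain[OF D'] by (rule has_derivative_unique)
  then have "D (norm v *\<^sub>R e) = D' (norm v *\<^sub>R e)"
    by (auto simp: fun_eq_iff)
  then show ?thesis using ve by simp
qed

lemma grad_S2_eqI:
  assumes p: "p \<in> S2" and "v \<bullet> p = 0"
    and "(u has_derivative (\<lambda>h. v \<bullet> h)) (at p within S2)"
  shows "grad_S2 u p = v"
  unfolding grad_S2_def
proof (rule the_equality)
  fix w assume w: "w \<bullet> p = 0 \<and> (u has_derivative (\<lambda>h. w \<bullet> h)) (at p within S2)"
  have "w \<bullet> (w - v) = v \<bullet> (w - v)"
    by (rule has_derivative_S2_unique[OF p _ _ assms(3)])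
      (use w assms in \<open>auto simp: inner_diff_left\<close>)
  then have "(w - v) \<bullet> (w - v) = 0" by (simp add: inner_diff_left)
  then show "w = v" by simp
qed (use assms in auto)

lemma orthonormal_frame_S2_exists:
  assumes "p \<in> S2"
  shows "\<exists>e1 e2. orthonormal_frame_S2 p e1 e2"
proof -
  obtain y :: "real^3" where y: "y \<noteq> 0" "orthogonal p y"
    using orthogonal_to_vector_exists[of p] by auto
  define e where "e = y /\<^sub>R norm y"
  have e: "norm e = 1" "e \<bullet> p = 0"
    using y by (auto simp: e_def orthogonal_def inner_commute)
  have "norm (cross3 p e) ^ 2 = 1"
    using norm_cross[of p e] e assms by (simp add: inner_commute)
  then have "norm (cross3 p e) = 1"
    using norm_ge_zero[of "cross3 p e"] by (auto simp: power2_eq_1_iff simp del: norm_ge_zero)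
  then have "orthonormal_frame_S2 p e (cross3 p e)"
    using e by (simp add: orthonormal_frame_S2_def dot_cross_self inner_commute)
  then show ?thesis by blast
qed

text \<open>The trace does not depend on the derivative or the frame.\<close>

lemma div_S2_eq:
  assumes p: "p \<in> S2" and D: "(X has_derivative D) (at p within S2)"
    and e: "orthonormal_frame_S2 p e1 e2"
  shows "div_S2 X p = D e1 \<bullet> e1 + D e2 \<bullet> e2"
  unfolding div_S2_def
proof (rule the_equality)
  show "\<exists>D' f1 f2. (X has_derivative D') (at p within S2) \<and> orthonormal_frame_S2 p f1 f2 \<and>
      D e1 \<bullet> e1 + D e2 \<bullet> e2 = D' f1 \<bullet> f1 + D' f2 \<bullet> f2"
    using D e by blast
next
  fix d assume "\<exists>D f1 f2. (X has_derivative D) (at p within S2) \<and> orthonormal_frame_S2 p f1 f2 \<and>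
      d = D f1 \<bullet> f1 + D f2 \<bullet> f2"
  then obtain D' f1 f2 where D': "(X has_derivative D') (at p within S2)"
    and f: "orthonormal_frame_S2 p f1 f2" and d: "d = D' f1 \<bullet> f1 + D' f2 \<bullet> f2" by blast
  have eqs: "D' f1 = D f1" "D' f2 = D f2"
    using has_derivative_S2_unique[OF p _ D' D] f by (auto simp: orthonormal_frame_S2_def)
  have lin: "linear D" using has_derivative_linear[OF D] .
  have pp: "p \<bullet> p = 1" using p by (simp add: norm_eq_1)
  have expand: "x = (x \<bullet> a1) *\<^sub>R a1 + (x \<bullet> a2) *\<^sub>R a2"
    if fr: "orthonormal_frame_S2 p a1 a2" and x: "x \<bullet> p = 0" for x a1 a2
  proof -
    let ?B = "{p, a1, a2}"
    have ip: "a1 \<bullet> a1 = 1" "a2 \<bullet> a2 = 1" "a1 \<bullet> p = 0" "a2 \<bullet> p = 0" "a1 \<bullet> a2 = 0"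
      "p \<bullet> a1 = 0" "p \<bullet> a2 = 0" "a2 \<bullet> a1 = 0"
      using fr by (auto simp: orthonormal_frame_S2_def norm_eq_1 inner_commute)
    have ne: "p \<noteq> a1" "p \<noteq> a2" "a1 \<noteq> a2" using ip pp by auto
    have "independent ?B"
      by (rule pairwise_orthogonal_independent)
        (use ip pp in \<open>auto simp: pairwise_def orthogonal_def\<close>)
    then have "UNIV \<subseteq> span ?B"
      by (intro card_ge_dim_independent) (use ne in auto)
    then have sp: "y \<in> span ?B" for y by auto
    define z where "z = x - ((x \<bullet> a1) *\<^sub>R a1 + (x \<bullet> a2) *\<^sub>R a2)"
    have "orthogonal z y" if "y \<in> ?B" for y
      using that ip x by (auto simp: z_def orthogonal_def inner_diff_left inner_add_left)
    then have "orthogonal z z"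
      using sp[of z] orthogonal_to_span by blast
    then show ?thesis by (simp add: z_def orthogonal_def)
  qed
  define a b c g where "a = f1 \<bullet> e1" and "b = f1 \<bullet> e2" and "c = f2 \<bullet> e1" and "g = f2 \<bullet> e2"
  have f1: "f1 = a *\<^sub>R e1 + b *\<^sub>R e2" and f2: "f2 = c *\<^sub>R e1 + g *\<^sub>R e2"
    using expand[OF e] f by (auto simp: orthonormal_frame_S2_def a_def b_def c_def g_def)
  have e1: "e1 = a *\<^sub>R f1 + c *\<^sub>R f2" and e2: "e2 = b *\<^sub>R f1 + g *\<^sub>R f2"
    using expand[OF f, of e1] expand[OF f, of e2] e
    by (auto simp: orthonormal_frame_S2_def a_def b_def c_def g_def inner_commute)
  have "D e1 \<bullet> e1 + D e2 \<bullet> e2 = D e1 \<bullet> (a *\<^sub>R f1 + c *\<^sub>R f2) + D e2 \<bullet> (b *\<^sub>R f1 + g *\<^sub>R f2)"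
    using e1 e2 by simp
  also have "\<dots> = (a *\<^sub>R D e1 + b *\<^sub>R D e2) \<bullet> f1 + (c *\<^sub>R D e1 + g *\<^sub>R D e2) \<bullet> f2"
    by (simp add: inner_add_left inner_add_right)
  also have "\<dots> = D f1 \<bullet> f1 + D f2 \<bullet> f2"
    using arg_cong[OF f1, of D] arg_cong[OF f2, of D]
    by (simp add: linear_add[OF lin] linear_scale[OF lin])
  finally show "d = D e1 \<bullet> e1 + D e2 \<bullet> e2" using d eqs by simp
qed

text \<open>Sign and normalisation: the coordinate functions are eigenfunctions with eigenvalue \<open>-2\<close>.\<close>

lemma laplace_beltrami_S2_coordinate:
  assumes p: "p \<in> S2"
  shows "laplace_beltrami_S2 (\<lambda>x. x $ i) p = - 2 * p $ i"
proof -
  have grad: "grad_S2 (\<lambda>x. x $ i) q = axis i 1 - (q $ i) *\<^sub>R q" if q: "q \<in> S2" for q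
  proof (rule grad_S2_eqI[OF q])
    have qq: "q \<bullet> q = 1" using q by (simp add: norm_eq_1)
    show "(axis i 1 - (q $ i) *\<^sub>R q) \<bullet> q = 0"
      by (simp add: inner_diff_left qq inner_axis')
    have "((\<lambda>x. x $ i - (q $ i) * (x \<bullet> x - 1) / 2) has_derivative
        (\<lambda>h. (axis i 1 - (q $ i) *\<^sub>R q) \<bullet> h)) (at q within S2)"
      by (auto intro!: derivative_eq_intros bounded_linear_imp_has_derivative
          simp: inner_diff_left inner_diff_right inner_axis inner_axis' inner_commute algebra_simps bounded_linear_vec_nth)
    then show "((\<lambda>x. x $ i) has_derivative (\<lambda>h. (axis i 1 - (q $ i) *\<^sub>R q) \<bullet> h)) (at q within S2)"
      by (rule has_derivative_transform[OF q, rotated]) (auto simp: norm_eq_1)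
  qed
  have "((\<lambda>x. axis i 1 - (x $ i) *\<^sub>R x) has_derivative
      (\<lambda>h. - ((h $ i) *\<^sub>R p + (p $ i) *\<^sub>R h))) (at p within S2)"
    by (auto intro!: derivative_eq_intros bounded_linear_imp_has_derivative bounded_linear_vec_nth)
  then have D: "(grad_S2 (\<lambda>x. x $ i) has_derivative
      (\<lambda>h. - ((h $ i) *\<^sub>R p + (p $ i) *\<^sub>R h))) (at p within S2)"
    by (rule has_derivative_transform[OF p, rotated]) (rule grad)
  obtain e1 e2 where e: "orthonormal_frame_S2 p e1 e2"
    using orthonormal_frame_S2_exists[OF p] by blast
  show ?thesis
    unfolding laplace_beltrami_S2_def div_S2_eq[OF p D e]
    using e by (simp add: orthonormal_frame_S2_def norm_eq_1 inner_diff_left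
        inner_commute[of p e1] inner_commute[of p e2])
qed

end

theory Submission
  imports Defs
begin

text \<open>
  Put \<open>\<lambda> = 2/\<alpha>\<close> and \<open>V = \<lambda> e\<^sup>u \<le> 12\<close>; here \<open>12\<close> is the eigenvalue of \<open>-\<Delta>\<close> on spherical harmonics of degree
  three, so a function \<open>w\<close> orthogonal to the polynomials of degree at most two satisfies
  \<open>\<integral>|\<nabla>w|\<^sup>2 \<ge> 12 \<integral>w\<^sup>2 \<ge> \<integral>V w\<^sup>2\<close>. By Kazdan--Warner \<open>\<integral>u x\<^sub>i = 0\<close>. In an eigenframe \<open>(a, b, c)\<close> of the
  quadratic form \<open>v \<mapsto> \<integral>u (v \<bullet> x)\<^sup>2\<close> the difference of \<open>u\<close> and its reflection in one of the three
  coordinate planes is orthogonal to these polynomials, and the inequality shows that \<open>u\<close> is invariant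
  under the three reflections.

  The derivatives \<open>\<phi>\<^sub>a, \<phi>\<^sub>b, \<phi>\<^sub>c\<close> of \<open>u\<close> along the rotations about the axes of the frame satisfy
  \<open>\<Delta>\<phi> + V \<phi> = 0\<close>. Applied to pieces \<open>s \<phi>\<close> of \<open>\<phi>\<close>, where \<open>s\<close> is constant on nodal domains, the inequality
  shows first that \<open>\<phi>\<^sub>a\<close> has the sign of \<open>\<plusminus> (b \<bullet> x) (c \<bullet> x)\<close>, and cyclically. Since
  \<open>(\<Delta> + V) (X\<^sub>a X\<^sub>c u) = - V \<phi>\<^sub>a \<phi>\<^sub>c\<close>, pairing with \<open>\<phi>\<^sub>b\<close> gives \<open>\<integral>V \<phi>\<^sub>a \<phi>\<^sub>b \<phi>\<^sub>c = 0\<close>, whose integrand has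
  a sign; so the product vanishes. Two of the three signs agree, say those of \<open>\<phi>\<^sub>a\<close> and \<open>\<phi>\<^sub>c\<close>, and then
  \<open>(a \<bullet> x) \<phi>\<^sub>a + (b \<bullet> x) \<phi>\<^sub>b + (c \<bullet> x) \<phi>\<^sub>c = 0\<close> forces \<open>\<phi>\<^sub>a \<phi>\<^sub>c = 0\<close>. Applied to a combination of pieces of
  \<open>\<phi>\<^sub>a\<close> and \<open>\<phi>\<^sub>c\<close> that is odd in \<open>b\<close> only, the inequality shows that one of the two vanishes.

  For \<open>\<lambda> = 6\<close> an integral identity for axially symmetric solutions leaves only \<open>u = 0\<close>.
\<close>

section \<open>Calculus of \<open>C\<^sup>k\<close> functions\<close>

text \<open>All analysis on the sphere runs through the rotation fields. Their flows preserve the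
  integral, so integration by parts is the derivative of an invariance; the Laplacian is the sum of
  the squares of three of them and therefore commutes with each one.

  The pieces \<open>s \<phi>\<close> are only continuous and weakly differentiable, and nothing is
  known about the shape of the nodal set. Hence the spectral gap is proved for weak derivatives.
  Unique continuation is avoided: a vanishing product of two rotation derivatives has a vanishing
  factor only after one more application of the inequality.

  The polynomials of degree at most two are spanned by ten products of frame coordinates. Parity
  under the reflections makes a piece orthogonal to all but one of them, and a combination of two
  pieces has just enough freedom to meet the one remaining linear condition. This is why pieces
  always occur in pairs.

  The assumption \<alpha> < 1, that is 2 < \<lambda>, matters in Kazdan--Warner: the first moments
  of \<open>ex u\<close> satisfy a linear relation with factor \<lambda> - 2, where 2 is the
  eigenvalue of the coordinate functions.\<close>

lemma Ck_on_cong: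
  assumes "open U" "\<And>x. x \<in> U \<Longrightarrow> f x = g x" "Ck_on k f U"
  shows "Ck_on k g U"
  using assms(2,3)
proof (induction k arbitrary: f g)
  case 0
  then show ?case by (simp cong: continuous_on_cong_simp)
next
  case (Suc k)
  have D: "(g has_derivative frechet_derivative f (at x)) (at x)" if "x \<in> U" for x
  proof (rule has_derivative_transform_within_open[OF _ \<open>open U\<close> that])
    show "(f has_derivative frechet_derivative f (at x)) (at x)"
      using Suc.prems(2) that by (simp add: frechet_derivative_works)
  qed (use Suc.prems in auto)
  have "frechet_derivative f (at x) = frechet_derivative g (at x)" if "x \<in> U" for x
    using frechet_derivative_at[OF D[OF that]] .
  then have "Ck_on k (\<lambda>x. frechet_derivative g (at x) b) U" if "b \<in> Basis" for b
    using Suc.prems that by (rule_tac Suc.IH[of "\<lambda>x. frechet_derivative f (at x) b"]) auto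
  then show ?case using D by (auto intro: differentiableI)
qed

lemma Ck_on_SucI:
  assumes "open U" "\<And>x. x \<in> U \<Longrightarrow> (f has_derivative D x) (at x)"
    and "\<And>b. b \<in> Basis \<Longrightarrow> Ck_on k (\<lambda>x. D x b) U"
  shows "Ck_on (Suc k) f U"
proof -
  have "Ck_on k (\<lambda>x. frechet_derivative f (at x) b) U" if "b \<in> Basis" for b
    using assms(3)[OF that] frechet_derivative_at[OF assms(2)]
    by (rule_tac Ck_on_cong[OF assms(1), of "\<lambda>x. D x b"]) auto
  then show ?thesis using assms(2) by (auto intro: differentiableI)
qed

lemma Ck_on_SucD:
  assumes "Ck_on (Suc k) f U" "x \<in> U"
  shows "(f has_derivative frechet_derivative f (at x)) (at x)"
  using assms by (simp add: frechet_derivative_works)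

lemma Ck_on_Suc_imp:
  "Ck_on (Suc k) f U \<Longrightarrow> Ck_on k f U"
proof (induction k arbitrary: f)
  case 0
  then show ?case
    by (auto intro!: continuous_at_imp_continuous_on differentiable_imp_continuous_within)
qed auto

lemma Ck_on_subset: "Ck_on k f U \<Longrightarrow> V \<subseteq> U \<Longrightarrow> Ck_on k f V"
  by (induction k arbitrary: f) (auto intro: continuous_on_subset)

lemma Ck_on_local:
  assumes "\<And>p. p \<in> U \<Longrightarrow> \<exists>W. open W \<and> p \<in> W \<and> Ck_on k f W"
  shows "Ck_on k f U"
  using assms
proof (induction k arbitrary: f)
  case 0
  have "isCont f p" if "p \<in> U" for p
    using 0[OF that] by (auto simp: continuous_on_eq_continuous_at)
  then show ?case by (simp add: continuous_at_imp_continuous_on)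
next
  case (Suc k)
  have "f differentiable (at p)" if "p \<in> U" for p using Suc.prems[OF that] by auto
  moreover have "Ck_on k (\<lambda>x. frechet_derivative f (at x) b) U" if "b \<in> Basis" for b
    by (rule Suc.IH) (use Suc.prems that in fastforce)
  ultimately show ?case by auto
qed

lemma Ck_on_const: "open U \<Longrightarrow> Ck_on k (\<lambda>x. c) U"
proof (induction k arbitrary: c)
  case (Suc k)
  then show ?case by (intro Ck_on_SucI[where D = "\<lambda>x h. 0"]) auto
qed simp

lemma Ck_on_linear: "open U \<Longrightarrow> bounded_linear f \<Longrightarrow> Ck_on k f U"
proof (cases k)
  case 0
  assume "bounded_linear f"
  then show ?thesis using 0 by (simp add: linear_continuous_on)
next
  case (Suc n)
  assume *: "open U" "bounded_linear f"
  then show ?thesis unfolding Suc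
    by (intro Ck_on_SucI[where D = "\<lambda>x. f"]) (auto intro: Ck_on_const bounded_linear_imp_has_derivative)
qed

lemma Ck_on_add:
  "open U \<Longrightarrow> Ck_on k f U \<Longrightarrow> Ck_on k g U \<Longrightarrow> Ck_on k (\<lambda>x. f x + g x) U"
proof (induction k arbitrary: f g)
  case (Suc k)
  show ?case
    by (rule Ck_on_SucI[OF Suc.prems(1) has_derivative_add[OF Ck_on_SucD[OF Suc.prems(2)] Ck_on_SucD[OF Suc.prems(3)]]])
      (use Suc in auto)
qed (auto intro: continuous_on_add)

lemma Ck_on_mult:
  fixes f g :: "'a::euclidean_space \<Rightarrow> real"
  shows "open U \<Longrightarrow> Ck_on k f U \<Longrightarrow> Ck_on k g U \<Longrightarrow> Ck_on k (\<lambda>x. f x * g x) U"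
proof (induction k arbitrary: f g)
  case (Suc k)
  show ?case
  proof (rule Ck_on_SucI[OF Suc.prems(1) has_derivative_mult[OF Ck_on_SucD[OF Suc.prems(2)] Ck_on_SucD[OF Suc.prems(3)]]])
    fix b :: 'a assume "b \<in> Basis"
    then show "Ck_on k (\<lambda>x. f x * frechet_derivative g (at x) b + frechet_derivative f (at x) b * g x) U"
      using Suc.prems Ck_on_Suc_imp[OF Suc.prems(2)] Ck_on_Suc_imp[OF Suc.prems(3)]
      by (intro Ck_on_add Suc.IH) auto
  qed
qed (auto intro: continuous_on_mult)

lemma Ck_on_sum:
  "open U \<Longrightarrow> (\<And>i. i \<in> A \<Longrightarrow> Ck_on k (f i) U) \<Longrightarrow> Ck_on k (\<lambda>x. \<Sum>i\<in>A. f i x) U"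
  by (induction A rule: infinite_finite_induct) (auto intro: Ck_on_const Ck_on_add)

text \<open>By the chain rule the partial derivatives are sums of products in which the derivatives
  of \<open>F\<close> are composed with the same \<open>N\<close>. So the induction varies only
  \<open>F\<close>, and the regularity of \<open>N\<close> is lowered along with k.\<close>

lemma Ck_on_compose:
  fixes F :: "'b::euclidean_space \<Rightarrow> real" and N :: "'a::euclidean_space \<Rightarrow> 'b"
  assumes "open U" "open V" "N ` U \<subseteq> V"
  shows "Ck_on k F V \<Longrightarrow> (\<And>b. b \<in> Basis \<Longrightarrow> Ck_on k (\<lambda>x. N x \<bullet> b) U) \<Longrightarrow> Ck_on k (\<lambda>x. F (N x)) U"
proof (induction k arbitrary: F)
  case 0
  have "continuous_on U N"
    using 0(2) by (subst continuous_on_componentwise) simp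
  then show ?case using 0 assms by (auto intro: continuous_on_compose2)
next
  case (Suc k)
  define N' where "N' x h = (\<Sum>b\<in>Basis. frechet_derivative (\<lambda>y. N y \<bullet> b) (at x) h *\<^sub>R b)" for x h
  have N': "(N has_derivative N' x) (at x)" if "x \<in> U" for x
  proof (subst has_derivative_componentwise_within, intro ballI)
    fix b :: 'b assume b: "b \<in> Basis"
    have "(\<lambda>h. N' x h \<bullet> b) = frechet_derivative (\<lambda>y. N y \<bullet> b) (at x)"
      using b by (simp add: N'_def fun_eq_iff inner_sum_left inner_Basis if_distrib cong: if_cong)
    then show "((\<lambda>x. N x \<bullet> b) has_derivative (\<lambda>h. N' x h \<bullet> b)) (at x)"
      using Ck_on_SucD[OF Suc.prems(2)[OF b] that] by simp
  qed
  show ?case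
  proof (rule Ck_on_SucI[OF assms(1)])
    fix x assume x: "x \<in> U"
    then have "N x \<in> V" using assms by auto
    then show "((\<lambda>x. F (N x)) has_derivative (\<lambda>h. frechet_derivative F (at (N x)) (N' x h))) (at x)"
      using has_derivative_compose[OF N'[OF x] Ck_on_SucD[OF Suc.prems(1)]] by simp
  next
    fix c :: 'a assume c: "c \<in> Basis"
    have N: "Ck_on k (\<lambda>x. N x \<bullet> b) U" if "b \<in> Basis" for b
      using Ck_on_Suc_imp[OF Suc.prems(2)[OF that]] .
    have "Ck_on k (\<lambda>x. \<Sum>b\<in>Basis. frechet_derivative (\<lambda>y. N y \<bullet> b) (at x) c * frechet_derivative F (at (N x)) b) U"
    proof (intro Ck_on_sum Ck_on_mult assms(1))
      fix b :: 'b assume b: "b \<in> Basis"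
      show "Ck_on k (\<lambda>x. frechet_derivative (\<lambda>y. N y \<bullet> b) (at x) c) U"
        using Suc.prems(2)[OF b] c by simp
      show "Ck_on k (\<lambda>x. frechet_derivative F (at (N x)) b) U"
        by (rule Suc.IH) (use Suc.prems(1) b N in auto)
    qed
    moreover have "(\<Sum>b\<in>Basis. frechet_derivative (\<lambda>y. N y \<bullet> b) (at x) c * frechet_derivative F (at (N x)) b)
        = frechet_derivative F (at (N x)) (N' x c)" if "x \<in> U" for x
    proof -
      have "N x \<in> V" using that assms(3) by auto
      then have "linear (frechet_derivative F (at (N x)))"
        by (rule has_derivative_linear[OF Ck_on_SucD[OF Suc.prems(1)]])
      then show ?thesis by (simp add: N'_def linear_sum[of "frechet_derivative F (at (N x))"] linear_scale[of "frechet_derivative F (at (N x))"])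
    qed
    ultimately show "Ck_on k (\<lambda>x. frechet_derivative F (at (N x)) (N' x c)) U"
      by (rule Ck_on_cong[OF assms(1), rotated]) auto
  qed
qed

lemma Ck_on_exp: "Ck_on k (exp :: real \<Rightarrow> real) UNIV"
proof (induction k)
  case (Suc k)
  then show ?case
    by (rule_tac Ck_on_SucI[where D = "\<lambda>x h. exp x * h"]) (auto intro!: derivative_eq_intros)
qed (auto intro: continuous_intros)

text \<open>The derivative of h(t) = t^(-1/2) is - h^3 / 2, a polynomial in h itself, so the
  induction closes.\<close>

lemma Ck_on_inverse_sqrt: "Ck_on k (\<lambda>t::real. inverse (sqrt t)) {0<..}"
proof (induction k)
  case 0
  then show ?case by (auto intro!: continuous_intros)
next
  case (Suc k)
  let ?h = "\<lambda>t::real. inverse (sqrt t)"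
  show ?case
  proof (rule Ck_on_SucI)
    fix t :: real assume t: "t \<in> {0<..}"
    have "(?h has_derivative (\<lambda>h. - (?h t * (inverse (sqrt t) / 2 * h) * ?h t))) (at t)"
      using t by (auto intro!: derivative_eq_intros)
    moreover have "(\<lambda>h. - (?h t * (inverse (sqrt t) / 2 * h) * ?h t)) = (\<lambda>h. (?h t * (?h t * ?h t)) * (- h / 2))"
      by (simp add: fun_eq_iff)
    ultimately show "(?h has_derivative (\<lambda>h. (?h t * (?h t * ?h t)) * (- h / 2))) (at t)" by simp
  next
    fix b :: real
    show "Ck_on k (\<lambda>t. (?h t * (?h t * ?h t)) * (- b / 2)) {0<..}"
      by (intro Ck_on_mult Ck_on_const Suc) auto
  qed auto
qed

text \<open>The second difference is symmetric in its two arguments while the right-hand side is one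
  of the two mixed derivatives; evaluating it in both orders compares them. The mean value theorem
  is applied in s to f s d - f s 0, and then in t.\<close>

lemma second_difference_mvt:
  fixes f :: "real \<Rightarrow> real \<Rightarrow> real"
  assumes d: "0 < d"
    and f1: "\<And>s t. \<bar>s\<bar> \<le> d \<Longrightarrow> \<bar>t\<bar> \<le> d \<Longrightarrow> ((\<lambda>s. f s t) has_real_derivative f1 s t) (at s)"
    and f12: "\<And>s t. \<bar>s\<bar> \<le> d \<Longrightarrow> \<bar>t\<bar> \<le> d \<Longrightarrow> ((\<lambda>t. f1 s t) has_real_derivative f12 s t) (at t)"
  shows "\<exists>s t. 0 < s \<and> s < d \<and> 0 < t \<and> t < d \<and> f d d - f d 0 - f 0 d + f 0 0 = d * d * f12 s t"
proof -
  have "\<exists>s>0. s < d \<and> (f d d - f d 0) - (f 0 d - f 0 0) = (d - 0) * (f1 s d - f1 s 0)"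
    by (rule MVT2[OF d]) (use d in \<open>auto intro!: derivative_eq_intros f1\<close>)
  then obtain s where s: "0 < s" "s < d" "f d d - f d 0 - f 0 d + f 0 0 = d * (f1 s d - f1 s 0)" by force
  have "\<exists>t>0. t < d \<and> f1 s d - f1 s 0 = (d - 0) * f12 s t"
    by (rule MVT2[OF d]) (use d s in \<open>auto intro!: f12\<close>)
  then show ?thesis using s by force
qed

lemma frechet_derivative_commute:
  fixes f :: "'a::euclidean_space \<Rightarrow> real"
  assumes U: "open U" "x \<in> U" and h: "\<And>y. y \<in> U \<Longrightarrow> f differentiable (at y)"
    and hk: "\<And>y. y \<in> U \<Longrightarrow> (\<lambda>y. frechet_derivative f (at y) h) differentiable (at y)"
    and kh: "\<And>y. y \<in> U \<Longrightarrow> (\<lambda>y. frechet_derivative f (at y) k) differentiable (at y)"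
    and c1: "continuous_on U (\<lambda>y. frechet_derivative (\<lambda>y. frechet_derivative f (at y) h) (at y) k)"
    and c2: "continuous_on U (\<lambda>y. frechet_derivative (\<lambda>y. frechet_derivative f (at y) k) (at y) h)"
  shows "frechet_derivative (\<lambda>y. frechet_derivative f (at y) h) (at x) k
       = frechet_derivative (\<lambda>y. frechet_derivative f (at y) k) (at x) h"
proof -
  have der: "((\<lambda>s. g (a + s *\<^sub>R v)) has_real_derivative frechet_derivative g (at (a + s *\<^sub>R v)) v) (at s)"
    if "g differentiable (at (a + s *\<^sub>R v))" for g :: "'a \<Rightarrow> real" and a v s
  proof -
    have 1: "((\<lambda>s. a + s *\<^sub>R v) has_derivative (\<lambda>t. t *\<^sub>R v)) (at s)"
      by (auto intro!: derivative_eq_intros)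
    have 2: "(g has_derivative frechet_derivative g (at (a + s *\<^sub>R v))) (at (a + s *\<^sub>R v))"
      using that by (simp add: frechet_derivative_works)
    show ?thesis
      using has_derivative_compose[OF 1 2] linear_scale[OF has_derivative_linear[OF 2]]
      by (simp add: has_field_derivative_def mult.commute[of _ "frechet_derivative g _ _"])
  qed
  define A where "A = (\<lambda>y. frechet_derivative (\<lambda>y. frechet_derivative f (at y) h) (at y) k)"
  define B where "B = (\<lambda>y. frechet_derivative (\<lambda>y. frechet_derivative f (at y) k) (at y) h)"
  have "\<bar>A x - B x\<bar> < e" if e: "0 < e" for e
  proof -
    have "isCont A x" "isCont B x"
      using c1 c2 U by (auto simp: A_def B_def continuous_on_eq_continuous_at)
    then obtain r1 r2 where r: "0 < r1" "\<And>y. dist y x < r1 \<Longrightarrow> dist (A y) (A x) < e / 2"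
        "0 < r2" "\<And>y. dist y x < r2 \<Longrightarrow> dist (B y) (B x) < e / 2"
      using e unfolding continuous_at_eps_delta by (metis half_gt_zero)
    obtain r3 where r3: "0 < r3" "ball x r3 \<subseteq> U" using U openE by blast
    define r where "r = Min {r1, r2, r3}"
    have rpos: "0 < r" using r r3 by (simp add: r_def)
    define M where "M = norm h + norm k + 1"
    have M: "0 < M" by (simp add: M_def add_nonneg_pos)
    \<comment> \<open>The whole parallelogram with sides d h and d k then lies within d M = r / 2 of
      \<open>x\<close>.\<close>
    define d where "d = r / (2 * M)"
    have d: "0 < d" using rpos M by (simp add: d_def)
    have near: "dist (x + s *\<^sub>R h + t *\<^sub>R k) x < r" if "\<bar>s\<bar> \<le> d" "\<bar>t\<bar> \<le> d" for s t
    proof -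
      have "norm (s *\<^sub>R h + t *\<^sub>R k) \<le> \<bar>s\<bar> * norm h + \<bar>t\<bar> * norm k"
        by (rule norm_triangle_le) simp
      also have "\<dots> \<le> d * norm h + d * norm k"
        using that by (intro add_mono mult_right_mono) auto
      also have "\<dots> \<le> d * M" using d by (simp add: M_def algebra_simps)
      also have "\<dots> < r" using M rpos by (simp add: d_def)
      finally show ?thesis by (simp add: dist_norm algebra_simps)
    qed
    have inU: "x + s *\<^sub>R h + t *\<^sub>R k \<in> U" if "\<bar>s\<bar> \<le> d" "\<bar>t\<bar> \<le> d" for s t
      using near[OF that] r3 by (auto simp: r_def dist_commute)
    let ?f = "\<lambda>s t. f (x + s *\<^sub>R h + t *\<^sub>R k)"
    have comm: "x + s *\<^sub>R h + t *\<^sub>R k = (x + t *\<^sub>R k) + s *\<^sub>R h" for s t by (simp add: algebra_simps)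
    have "\<exists>s t. 0 < s \<and> s < d \<and> 0 < t \<and> t < d \<and>
        ?f d d - ?f d 0 - ?f 0 d + ?f 0 0 = d * d * A (x + s *\<^sub>R h + t *\<^sub>R k)"
    proof (rule second_difference_mvt[OF d, where ?f1.0 = "\<lambda>s t. frechet_derivative f (at (x + s *\<^sub>R h + t *\<^sub>R k)) h"])
      fix s t assume st: "\<bar>s\<bar> \<le> d" "\<bar>t\<bar> \<le> d"
      show "((\<lambda>s. ?f s t) has_real_derivative frechet_derivative f (at (x + s *\<^sub>R h + t *\<^sub>R k)) h) (at s)"
        unfolding comm by (rule der) (use h inU[OF st] comm in metis)
      show "((\<lambda>t. frechet_derivative f (at (x + s *\<^sub>R h + t *\<^sub>R k)) h) has_real_derivative
          A (x + s *\<^sub>R h + t *\<^sub>R k)) (at t)"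
        unfolding A_def by (rule der) (use hk inU[OF st] in auto)
    qed
    then obtain s t where 1: "0 < s" "s < d" "0 < t" "t < d"
      "?f d d - ?f d 0 - ?f 0 d + ?f 0 0 = d * d * A (x + s *\<^sub>R h + t *\<^sub>R k)" by blast
    let ?g = "\<lambda>t s. f (x + s *\<^sub>R h + t *\<^sub>R k)"
    have "\<exists>t s. 0 < t \<and> t < d \<and> 0 < s \<and> s < d \<and>
        ?g d d - ?g d 0 - ?g 0 d + ?g 0 0 = d * d * B (x + s *\<^sub>R h + t *\<^sub>R k)"
    proof (rule second_difference_mvt[OF d, where ?f1.0 = "\<lambda>t s. frechet_derivative f (at (x + s *\<^sub>R h + t *\<^sub>R k)) k"])
      fix s t assume st: "\<bar>t\<bar> \<le> d" "\<bar>s\<bar> \<le> d"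
      show "((\<lambda>t. ?g t s) has_real_derivative frechet_derivative f (at (x + s *\<^sub>R h + t *\<^sub>R k)) k) (at t)"
        by (rule der) (use h inU st in auto)
      show "((\<lambda>s. frechet_derivative f (at (x + s *\<^sub>R h + t *\<^sub>R k)) k) has_real_derivative
          B (x + s *\<^sub>R h + t *\<^sub>R k)) (at s)"
        unfolding B_def comm by (rule der) (use kh inU st comm in metis)
    qed
    then obtain s' t' where 2: "0 < s'" "s' < d" "0 < t'" "t' < d"
      "?g d d - ?g d 0 - ?g 0 d + ?g 0 0 = d * d * B (x + s' *\<^sub>R h + t' *\<^sub>R k)" by blast
    have "d * d * A (x + s *\<^sub>R h + t *\<^sub>R k) = d * d * B (x + s' *\<^sub>R h + t' *\<^sub>R k)"
      using 1(5) 2(5) by linarith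
    then have eq: "A (x + s *\<^sub>R h + t *\<^sub>R k) = B (x + s' *\<^sub>R h + t' *\<^sub>R k)" using d by simp
    have "dist (A (x + s *\<^sub>R h + t *\<^sub>R k)) (A x) < e / 2"
      by (rule r) (use near[of s t] 1 in \<open>auto simp: r_def\<close>)
    moreover have "dist (B (x + s' *\<^sub>R h + t' *\<^sub>R k)) (B x) < e / 2"
      by (rule r) (use near[of s' t'] 2 in \<open>auto simp: r_def\<close>)
    ultimately show ?thesis using eq unfolding dist_real_def by (simp only: abs_diff_less_iff) linarith
  qed
  from this[of "\<bar>A x - B x\<bar>"] have "A x = B x" by auto
  then show ?thesis by (simp add: A_def B_def)
qed

lemma Ck_on_punctured:
  "Ck_on k f (-{0}) \<Longrightarrow> Ck_on k (\<lambda>x. if x = 0 then c else f x) (-{0})"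
  by (rule Ck_on_cong[of _ f]) auto

lemma Ck_on_cmult:
  fixes f :: "'a::euclidean_space \<Rightarrow> real"
  shows "open U \<Longrightarrow> Ck_on k f U \<Longrightarrow> Ck_on k (\<lambda>x. c * f x) U"
  by (rule Ck_on_mult) (auto intro: Ck_on_const)

section \<open>Smooth functions on the sphere\<close>

text \<open>A smooth function on the sphere is represented by its extension to the punctured space that is
  homogeneous of degree 0, with value 0 at the origin: equality in this type is equality on the sphere.\<close>

typedef sph = "{f :: real^3 \<Rightarrow> real. (\<forall>k. Ck_on k f (-{0})) \<and> f 0 = 0 \<and> (\<forall>t x. 0 < t \<longrightarrow> f (t *\<^sub>R x) = f x)}"
  morphisms ev Abs_sph
  by (rule exI[of _ "\<lambda>x. 0"]) (auto intro: Ck_on_const)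

setup_lifting type_definition_sph

lemma ev_Ck: "Ck_on k (ev f) (-{0})"
  using ev[of f] by auto

lemma ev_0 [simp]: "ev f 0 = 0"
  using ev[of f] by auto

lemma ev_scale: "t > 0 \<Longrightarrow> ev f (t *\<^sub>R x) = ev f x"
  using ev[of f] by auto

lemma sph_eqI:
  assumes "\<And>x. x \<in> S2 \<Longrightarrow> ev f x = ev g x"
  shows "f = g"
proof -
  have "ev f x = ev g x" for x
  proof (cases "x = 0")
    case False
    then show ?thesis
      using assms[of "x /\<^sub>R norm x"] ev_scale[of "inverse (norm x)" _ x] by simp
  qed simp
  then show ?thesis by (simp add: ev_inject[symmetric] fun_eq_iff)
qed

instantiation sph :: comm_ring_1
begin
lift_definition zero_sph :: sph is "\<lambda>x. 0" by (auto intro: Ck_on_const)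
lift_definition one_sph :: sph is "\<lambda>x. if x = 0 then 0 else 1"
  by (auto intro!: Ck_on_punctured Ck_on_const)
lift_definition plus_sph :: "sph \<Rightarrow> sph \<Rightarrow> sph" is "\<lambda>f g x. f x + g x"
  by (auto intro: Ck_on_add)
lift_definition times_sph :: "sph \<Rightarrow> sph \<Rightarrow> sph" is "\<lambda>f g x. f x * g x"
  by (auto intro: Ck_on_mult)
lift_definition uminus_sph :: "sph \<Rightarrow> sph" is "\<lambda>f x. (-1) * f x"
  using Ck_on_cmult[of "-{0::real^3}" _ _ "-1"] by (auto simp del: mult_minus1)
definition minus_sph :: "sph \<Rightarrow> sph \<Rightarrow> sph" where "minus_sph f g = f + - g"
instance
proof
  have "ev 0 (axis 1 1) \<noteq> ev 1 (axis 1 1)" by (simp add: zero_sph.rep_eq one_sph.rep_eq axis_eq_0_iff)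
  then show "(0::sph) \<noteq> 1" by metis
qed (rule sph_eqI, simp add: minus_sph_def plus_sph.rep_eq times_sph.rep_eq uminus_sph.rep_eq
      zero_sph.rep_eq one_sph.rep_eq algebra_simps)+
end

instantiation sph :: real_algebra_1
begin
lift_definition scaleR_sph :: "real \<Rightarrow> sph \<Rightarrow> sph" is "\<lambda>c f x. c * f x"
  by (auto intro: Ck_on_cmult)
instance
proof
 fix a b :: real and f g :: sph
 note e = scaleR_sph.rep_eq plus_sph.rep_eq times_sph.rep_eq
  show "a *\<^sub>R (f + g) = a *\<^sub>R f + a *\<^sub>R g" by (rule sph_eqI) (simp add: e distrib_left)
  show "(a + b) *\<^sub>R f = a *\<^sub>R f + b *\<^sub>R f" by (rule sph_eqI) (simp add: e distrib_right)
  show "a *\<^sub>R b *\<^sub>R f = (a * b) *\<^sub>R f" by (rule sph_eqI) (simp add: e mult.assoc)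
  show "1 *\<^sub>R f = f" by (rule sph_eqI) (simp add: e)
  show "a *\<^sub>R f * g = a *\<^sub>R (f * g)" by (rule sph_eqI) (simp add: e mult.assoc)
  show "f * a *\<^sub>R g = a *\<^sub>R (f * g)" by (rule sph_eqI) (simp add: e mult.left_commute)
qed
end

lemma ev_simps [simp]:
  "ev (f + g) x = ev f x + ev g x" "ev (f * g) x = ev f x * ev g x" "ev (- f) x = - ev f x"
  "ev (f - g) x = ev f x - ev g x" "ev (c *\<^sub>R f) x = c * ev f x" "ev 0 x = 0"
  by (simp_all add: plus_sph.rep_eq times_sph.rep_eq uminus_sph.rep_eq minus_sph_def
      scaleR_sph.rep_eq zero_sph.rep_eq del: add_uminus_conv_diff)

lemma ev_one: "x \<noteq> 0 \<Longrightarrow> ev 1 x = 1"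
  by (simp add: one_sph.rep_eq)

lemma ev_of_real: "x \<noteq> 0 \<Longrightarrow> ev (of_real c) x = c"
  by (simp add: of_real_def ev_one)

lemma ev_sum: "ev (\<Sum>i\<in>A. f i) x = (\<Sum>i\<in>A. ev (f i) x)"
  by (induction A rule: infinite_finite_induct) auto

text \<open>The Euclidean gradient of the homogeneous extension. It is tangential because the
  extension is constant along rays (\<open>grad_radial\<close>), so on the unit sphere it is the
  intrinsic gradient.\<close>

definition grad :: "sph \<Rightarrow> real^3 \<Rightarrow> real^3" where
  "grad f x = (\<Sum>k\<in>Basis. frechet_derivative (ev f) (at x) k *\<^sub>R k)"

lemma ev_has_derivative: "x \<noteq> 0 \<Longrightarrow> (ev f has_derivative (\<lambda>h. grad f x \<bullet> h)) (at x)"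
proof -
  assume x: "x \<noteq> 0"
  have D: "(ev f has_derivative frechet_derivative (ev f) (at x)) (at x)"
    using Ck_on_SucD[OF ev_Ck[of "Suc 0" f], of x] x by auto
  have lin: "linear (frechet_derivative (ev f) (at x))" using has_derivative_linear[OF D] .
  have "frechet_derivative (ev f) (at x) h = grad f x \<bullet> h" for h
  proof -
    have "frechet_derivative (ev f) (at x) h = frechet_derivative (ev f) (at x) (\<Sum>k\<in>Basis. (h \<bullet> k) *\<^sub>R k)"
      by (simp add: euclidean_representation)
    also have "\<dots> = (\<Sum>k\<in>Basis. (h \<bullet> k) * frechet_derivative (ev f) (at x) k)"
      by (simp add: linear_sum[OF lin] linear_scale[OF lin])
    also have "\<dots> = grad f x \<bullet> h"
      by (simp add: grad_def inner_sum_left inner_commute[of h] mult.commute)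
    finally show ?thesis .
  qed
  then have "frechet_derivative (ev f) (at x) = (\<lambda>h. grad f x \<bullet> h)" ..
  then show ?thesis using D by simp
qed

lemma grad_eqI:
  assumes "x \<noteq> 0" "(ev f has_derivative (\<lambda>h. v \<bullet> h)) (at x)"
  shows "grad f x = v"
proof -
  have "(\<lambda>h. grad f x \<bullet> h) = (\<lambda>h. v \<bullet> h)"
    using has_derivative_unique[OF ev_has_derivative[OF assms(1)] assms(2)] .
  then have "\<forall>h. grad f x \<bullet> h = v \<bullet> h" by (simp add: fun_eq_iff)
  then show ?thesis by (simp add: vector_eq_rdot)
qed

text \<open>The symmetry of the Hessian is what removes the second-order terms from the commutator
  of two rotation fields.\<close>

lemma grad_has_derivative:
  assumes x: "x \<noteq> 0"
  obtains G where "(grad f has_derivative G) (at x)" "\<And>h k. G h \<bullet> k = G k \<bullet> h"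
proof -
  let ?d = "\<lambda>k y. frechet_derivative (ev f) (at y) k"
  have d1: "(?d k has_derivative frechet_derivative (?d k) (at y)) (at y)" if "k \<in> Basis" "y \<noteq> 0" for k y
    using Ck_on_SucD[of 0 "?d k" "-{0}" y] ev_Ck[of "Suc (Suc 0)" f] that by auto
  define G where "G h = (\<Sum>k\<in>Basis. frechet_derivative (?d k) (at x) h *\<^sub>R k)" for h
  have G: "(grad f has_derivative G) (at x)"
    unfolding grad_def[abs_def] G_def[abs_def]
    by (intro has_derivative_sum has_derivative_scaleR_left d1 x)
  have sym: "frechet_derivative (?d h) (at x) k = frechet_derivative (?d k) (at x) h"
    if hk: "h \<in> Basis" "k \<in> Basis" for h k
  proof (rule frechet_derivative_commute[of "-{0}"])
    have "Ck_on (Suc (Suc 0)) (ev f) (-{0})" by (rule ev_Ck)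
    then show "continuous_on (- {0}) (\<lambda>y. frechet_derivative (?d h) (at y) k)"
      "continuous_on (- {0}) (\<lambda>y. frechet_derivative (?d k) (at y) h)"
      "\<And>y. y \<in> -{0} \<Longrightarrow> ev f differentiable at y"
      "\<And>y. y \<in> -{0} \<Longrightarrow> ?d h differentiable at y"
      "\<And>y. y \<in> -{0} \<Longrightarrow> ?d k differentiable at y"
      using hk by simp_all
  qed (use x in auto)
  have GB: "G h \<bullet> k = frechet_derivative (?d k) (at x) h" if "k \<in> Basis" for h k
    using that by (simp add: G_def inner_sum_left inner_Basis if_distrib cong: if_cong)
  have lin: "linear G" using G by (rule has_derivative_linear)
  have "G h \<bullet> k = G k \<bullet> h" for h k
  proof -
    have v: "v \<bullet> k = (\<Sum>j\<in>Basis. (k \<bullet> j) * (v \<bullet> j))" for v k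
      by (subst euclidean_inner) (simp add: mult.commute)
    have Gh: "G h = (\<Sum>i\<in>Basis. (h \<bullet> i) *\<^sub>R G i)" for h
      using linear_sum[OF lin, of "\<lambda>i. (h \<bullet> i) *\<^sub>R i" Basis]
      by (simp add: linear_scale[OF lin] euclidean_representation)
    have expand: "G h \<bullet> k = (\<Sum>j\<in>Basis. \<Sum>i\<in>Basis. (k \<bullet> j) * ((h \<bullet> i) * (G i \<bullet> j)))" for h k
    proof -
      have "G h \<bullet> j = (\<Sum>i\<in>Basis. (h \<bullet> i) * (G i \<bullet> j))" for j
        by (subst Gh[of h]) (simp add: inner_sum_left)
      then show ?thesis by (subst v) (simp add: sum_distrib_left)
    qed
    have "(k \<bullet> j) * ((h \<bullet> i) * (G i \<bullet> j)) = (h \<bullet> i) * ((k \<bullet> j) * (G j \<bullet> i))"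
      if "i \<in> Basis" "j \<in> Basis" for i j
      using that by (simp add: GB sym[of i j])
    then show ?thesis
      unfolding expand[of h k] expand[of k h]
      by (subst sum.swap) (auto intro!: sum.cong)
  qed
  with G that show thesis by blast
qed

lemma grad_radial: "x \<noteq> 0 \<Longrightarrow> grad f x \<bullet> x = 0"
proof -
  assume x: "x \<noteq> 0"
  have 1: "((\<lambda>t. t *\<^sub>R x) has_derivative (\<lambda>s. s *\<^sub>R x)) (at 1)"
    by (auto intro!: derivative_eq_intros)
  have 2: "(ev f has_derivative (\<lambda>h. grad f x \<bullet> h)) (at (1 *\<^sub>R x))"
    using ev_has_derivative[OF x] by simp
  have 3: "((\<lambda>t. ev f (t *\<^sub>R x)) has_derivative (\<lambda>s. grad f x \<bullet> (s *\<^sub>R x))) (at 1)"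
    using has_derivative_compose[OF 1 2] .
  have "((\<lambda>t. ev f x) has_derivative (\<lambda>s. grad f x \<bullet> (s *\<^sub>R x))) (at 1)"
    by (rule has_derivative_transform_within_open[OF 3, of "{0<..}"]) (auto simp: ev_scale)
  moreover have "((\<lambda>t::real. ev f x) has_derivative (\<lambda>s. 0)) (at 1)" by simp
  ultimately have "(\<lambda>s. grad f x \<bullet> (s *\<^sub>R x)) = (\<lambda>s. 0)" by (rule has_derivative_unique)
  then have "grad f x \<bullet> (1 *\<^sub>R x) = 0" by metis
  then show ?thesis by simp
qed

text \<open>\<open>X a\<close> is the derivative along the infinitesimal rotation about \<open>a\<close>.\<close>

lift_definition X :: "real^3 \<Rightarrow> sph \<Rightarrow> sph" is
  "\<lambda>a f x. if x = 0 then 0 else frechet_derivative f (at x) (cross3 a x)"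
proof (intro conjI allI impI)
  fix a :: "real^3" and f :: "real^3 \<Rightarrow> real"
  assume "(\<forall>k. Ck_on k f (- {0})) \<and> f 0 = 0 \<and> (\<forall>t x. 0 < t \<longrightarrow> f (t *\<^sub>R x) = f x)"
  then have f: "\<And>k. Ck_on k f (- {0})" and hom: "\<And>t x. t > 0 \<Longrightarrow> f (t *\<^sub>R x) = f x" by auto
  have D: "(f has_derivative frechet_derivative f (at x)) (at x)" if "x \<noteq> 0" for x
    using Ck_on_SucD[OF f[of "Suc 0"], of x] that by auto
  {
    fix k
    have "Ck_on k (\<lambda>x. \<Sum>b\<in>Basis. (cross3 a x \<bullet> b) * frechet_derivative f (at x) b) (-{0})"
    proof (intro Ck_on_sum Ck_on_mult)
      fix b :: "real^3" assume "b \<in> Basis"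
      then show "Ck_on k (\<lambda>x. frechet_derivative f (at x) b) (- {0})"
        using f[of "Suc k"] by simp
      have "bounded_linear (\<lambda>x. cross3 a x \<bullet> b)"
        by (rule linear_conv_bounded_linear[THEN iffD1], rule linearI)
          (simp_all add: cross_add_right cross_mult_right inner_add_left)
      then show "Ck_on k (\<lambda>x. cross3 a x \<bullet> b) (- {0})"
        by (intro Ck_on_linear) auto
    qed auto
    moreover have "(\<Sum>b\<in>Basis. (cross3 a x \<bullet> b) * frechet_derivative f (at x) b) = frechet_derivative f (at x) (cross3 a x)"
      if "x \<noteq> 0" for x
    proof -
      have lin: "linear (frechet_derivative f (at x))" using D[OF that] by (rule has_derivative_linear)
      show ?thesis
        using linear_sum[OF lin, of "\<lambda>b. (cross3 a x \<bullet> b) *\<^sub>R b" Basis]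
        by (simp add: linear_scale[OF lin] euclidean_representation)
    qed
    ultimately show "Ck_on k (\<lambda>x. if x = 0 then 0 else frechet_derivative f (at x) (cross3 a x)) (- {0})"
      by (intro Ck_on_punctured, rule_tac Ck_on_cong[of _ "\<lambda>x. \<Sum>b\<in>Basis. (cross3 a x \<bullet> b) * frechet_derivative f (at x) b"]) auto
  next
    fix t :: real and x :: "real^3" assume t: "t > 0"
    \<comment> \<open>The derivative of \<open>f\<close> is homogeneous of degree -1 and the
      rotation field of degree 1, so their pairing has degree 0 again.\<close>
    have "frechet_derivative f (at (t *\<^sub>R x)) (cross3 a (t *\<^sub>R x)) = frechet_derivative f (at x) (cross3 a x)"
      if x: "x \<noteq> 0"
    proof -
      have 1: "((\<lambda>y. t *\<^sub>R y) has_derivative (\<lambda>y. t *\<^sub>R y)) (at x)" by (auto intro!: derivative_eq_intros)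
      have 2: "(f has_derivative frechet_derivative f (at (t *\<^sub>R x))) (at (t *\<^sub>R x))" using D x t by simp
      have "((\<lambda>y. f y) has_derivative (\<lambda>h. frechet_derivative f (at (t *\<^sub>R x)) (t *\<^sub>R h))) (at x)"
        using has_derivative_compose[OF 1 2] hom[OF t] by simp
      from has_derivative_unique[OF this D[OF x]] show ?thesis
        by (metis cross_mult_right)
    qed
    then show "(if t *\<^sub>R x = 0 then 0 else frechet_derivative f (at (t *\<^sub>R x)) (cross3 a (t *\<^sub>R x))) =
       (if x = 0 then 0 else frechet_derivative f (at x) (cross3 a x))" using t by simp
  }
qed simp

lemma ev_X: "x \<noteq> 0 \<Longrightarrow> ev (X a f) x = grad f x \<bullet> cross3 a x"
  using frechet_derivative_at[OF ev_has_derivative, of x f] by (simp add: X.rep_eq fun_eq_iff)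

lift_definition lin :: "real^3 \<Rightarrow> sph" is "\<lambda>v x. (v \<bullet> x) * inverse (sqrt (x \<bullet> x))"
proof (intro conjI allI impI)
  fix v :: "real^3" and k
  have "Ck_on k (\<lambda>x. (x \<bullet> b) * (x \<bullet> b)) (-{0})" for b :: "real^3"
    by (intro Ck_on_mult Ck_on_linear) (auto intro: bounded_linear_intros)
  then have "Ck_on k (\<lambda>x. \<Sum>b\<in>Basis. (x \<bullet> b) * (x \<bullet> b)) (- {0::real^3})"
    by (intro Ck_on_sum) auto
  then have q: "Ck_on k (\<lambda>x. x \<bullet> x) (- {0::real^3})"
    by (simp add: euclidean_inner[symmetric])
  have "Ck_on k (\<lambda>x. inverse (sqrt (x \<bullet> x))) (- {0::real^3})"
    by (rule Ck_on_compose[of "-{0}" "{0<..}" "\<lambda>x. x \<bullet> x" k "\<lambda>t. inverse (sqrt t)"])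
      (auto simp: q Ck_on_inverse_sqrt)
  moreover have "Ck_on k (\<lambda>x. v \<bullet> x) (- {0})"
    by (rule Ck_on_linear) (auto intro: bounded_linear_intros)
  ultimately show "Ck_on k (\<lambda>x. (v \<bullet> x) * inverse (sqrt (x \<bullet> x))) (- {0})"
    by (intro Ck_on_mult) auto
  fix t :: real and x :: "real^3" assume "t > 0"
  moreover from this have "sqrt ((t *\<^sub>R x) \<bullet> (t *\<^sub>R x)) = t * sqrt (x \<bullet> x)"
    by (simp add: real_sqrt_mult)
  ultimately show "(v \<bullet> (t *\<^sub>R x)) * inverse (sqrt ((t *\<^sub>R x) \<bullet> (t *\<^sub>R x))) = (v \<bullet> x) * inverse (sqrt (x \<bullet> x))"
    by (simp only: inner_scaleR_right) simp
qed simp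

lemma ev_lin: "ev (lin v) x = (v \<bullet> x) / norm x"
  by (simp add: lin.rep_eq norm_eq_sqrt_inner divide_inverse)

lift_definition ex :: "sph \<Rightarrow> sph" is "\<lambda>f x. if x = 0 then 0 else exp (f x)"
proof (intro conjI allI impI)
  fix f :: "real^3 \<Rightarrow> real" and k
  assume "(\<forall>k. Ck_on k f (- {0})) \<and> f 0 = 0 \<and> (\<forall>t x. 0 < t \<longrightarrow> f (t *\<^sub>R x) = f x)"
  then have "Ck_on k f (- {0})" by auto
  then have "Ck_on k (\<lambda>x. exp (f x)) (- {0})"
    by (intro Ck_on_compose[of "-{0}" UNIV f k exp]) (auto simp: Ck_on_exp)
  then show "Ck_on k (\<lambda>x. if x = 0 then 0 else exp (f x)) (- {0})"
    by (rule Ck_on_punctured)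
qed auto

lemma ev_ex: "x \<noteq> 0 \<Longrightarrow> ev (ex f) x = exp (ev f x)"
  by (simp add: ex.rep_eq)

text \<open>The case distinction makes the operation total: composition with an orthogonal map
  preserves the representing type, and every other map is made to act as the identity.\<close>

lift_definition pull :: "(real^3 \<Rightarrow> real^3) \<Rightarrow> sph \<Rightarrow> sph" is
  "\<lambda>R f x. if orthogonal_transformation R then f (R x) else f x"
proof (intro conjI allI impI)
  fix R :: "real^3 \<Rightarrow> real^3" and f :: "real^3 \<Rightarrow> real" and k
  assume "(\<forall>k. Ck_on k f (- {0})) \<and> f 0 = 0 \<and> (\<forall>t x. 0 < t \<longrightarrow> f (t *\<^sub>R x) = f x)"
  then have f: "\<And>k. Ck_on k f (- {0})" "f 0 = 0" "\<And>t x. t > 0 \<Longrightarrow> f (t *\<^sub>R x) = f x" by auto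
  show "Ck_on k (\<lambda>x. if orthogonal_transformation R then f (R x) else f x) (- {0})"
  proof (cases "orthogonal_transformation R")
    case True
    have lin: "bounded_linear R"
      using orthogonal_transformation_linear[OF True] by (rule linear_conv_bounded_linear[THEN iffD1])
    have "R ` (-{0}) \<subseteq> -{0}"
    proof (rule image_subsetI)
      fix x :: "real^3" assume "x \<in> -{0}"
      then show "R x \<in> -{0}" using orthogonal_transformation_norm[OF True, of x] by (metis ComplD ComplI norm_eq_zero singletonI singletonD)
    qed
    moreover have "Ck_on k (\<lambda>x. R x \<bullet> b) (- {0})" for b
      by (rule Ck_on_linear[OF _ bounded_linear_compose[OF bounded_linear_inner_left lin]]) auto
    ultimately have "Ck_on k (\<lambda>x. f (R x)) (- {0})"
      using f(1)[of k] by (rule_tac Ck_on_compose[of "-{0}" "-{0}" R k f]) auto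
    then show ?thesis using True by simp
  qed (use f in simp)
  show "(if orthogonal_transformation R then f (R 0) else f 0) = 0"
    using f(2) linear_0[OF orthogonal_transformation_linear[of R]] by auto
  fix t :: real and x :: "real^3" assume "t > 0"
  then show "(if orthogonal_transformation R then f (R (t *\<^sub>R x)) else f (t *\<^sub>R x)) =
      (if orthogonal_transformation R then f (R x) else f x)"
    using f(3) linear_scale[OF orthogonal_transformation_linear[of R]] by auto
qed

lemma ev_pull: "orthogonal_transformation R \<Longrightarrow> ev (pull R f) x = ev f (R x)"
  by (simp add: pull.rep_eq)

lemma S2_nonzero: "x \<in> S2 \<Longrightarrow> x \<noteq> 0" by auto

lemma grad_add: "x \<noteq> 0 \<Longrightarrow> grad (f + g) x = grad f x + grad g x"
  using has_derivative_add[OF ev_has_derivative ev_has_derivative, of x f g]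
  by (rule_tac grad_eqI) (simp_all add: inner_add_left plus_sph.rep_eq)

lemma grad_mult: "x \<noteq> 0 \<Longrightarrow> grad (f * g) x = ev g x *\<^sub>R grad f x + ev f x *\<^sub>R grad g x"
  using has_derivative_mult[OF ev_has_derivative ev_has_derivative, of x f g]
  by (rule_tac grad_eqI) (simp_all add: inner_add_left times_sph.rep_eq algebra_simps)

lemma grad_scaleR: "x \<noteq> 0 \<Longrightarrow> grad (c *\<^sub>R f) x = c *\<^sub>R grad f x"
  using has_derivative_mult_right[OF ev_has_derivative, of x c f]
  by (rule_tac grad_eqI) (simp_all add: scaleR_sph.rep_eq)

lemma grad_ex: "x \<noteq> 0 \<Longrightarrow> grad (ex f) x = exp (ev f x) *\<^sub>R grad f x"
proof (rule grad_eqI)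
  assume x: "x \<noteq> 0"
  have "((\<lambda>y. exp (ev f y)) has_derivative (\<lambda>h. (exp (ev f x) *\<^sub>R grad f x) \<bullet> h)) (at x)"
    using has_derivative_exp[OF ev_has_derivative[OF x, of f]] by (simp add: mult.commute)
  then show "(ev (ex f) has_derivative (\<lambda>h. (exp (ev f x) *\<^sub>R grad f x) \<bullet> h)) (at x)"
    by (rule has_derivative_transform_within_open[of _ _ _ _ "-{0}"]) (auto simp: x ev_ex)
qed

lemma grad_lin: "norm x = 1 \<Longrightarrow> grad (lin v) x = v - (v \<bullet> x) *\<^sub>R x"
proof (rule grad_eqI)
  assume x: "norm x = 1"
  then show x0: "x \<noteq> 0" by auto
  have "((\<lambda>y. (v \<bullet> y) / norm y) has_derivative (\<lambda>h. (v - (v \<bullet> x) *\<^sub>R x) \<bullet> h)) (at x)"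
    using x x0 by (auto intro!: derivative_eq_intros has_derivative_norm
        simp: inner_diff_left inner_diff_right inner_commute sgn_div_norm)
  then show "(ev (lin v) has_derivative (\<lambda>h. (v - (v \<bullet> x) *\<^sub>R x) \<bullet> h)) (at x)"
    by (simp add: ev_lin[abs_def])
qed

lemma X_simps [simp]:
  "X a (f + g) = X a f + X a g"
  "X a (f * g) = X a f * g + f * X a g"
  "X a (c *\<^sub>R f) = c *\<^sub>R X a f"
  "X a (- f) = - X a f"
  "X a 0 = 0" "X a 1 = 0" "X a (of_real c) = 0"
  "X a (lin v) = lin (cross3 v a)"
  "X a (ex f) = ex f * X a f"
proof -
  show "X a (f + g) = X a f + X a g"
    by (rule sph_eqI, drule S2_nonzero) (simp add: ev_X grad_add inner_add_left)
  show mult: "X a (f * g) = X a f * g + f * X a g" for f g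
    by (rule sph_eqI, drule S2_nonzero) (simp add: ev_X grad_mult inner_add_left)
  show sc: "X a (c *\<^sub>R f) = c *\<^sub>R X a f" for c f
    by (rule sph_eqI, drule S2_nonzero) (simp add: ev_X grad_scaleR)
  show "X a (- f) = - X a f" using sc[of "-1" f] by simp
  show "X a 0 = 0" using sc[of 0 0] by simp
  show one: "X a 1 = 0" using mult[of 1 1] by simp
  show "X a (of_real c) = 0" by (simp add: of_real_def sc one)
  show "X a (lin v) = lin (cross3 v a)"
  proof (rule sph_eqI)
    fix x assume x: "x \<in> S2"
    then have "norm x = 1" "x \<noteq> 0" by auto
    then show "ev (X a (lin v)) x = ev (lin (cross3 v a)) x"
      by (simp add: ev_X ev_lin grad_lin inner_diff_left dot_cross_self)
        (simp add: cross3_simps)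
  qed
  show "X a (ex f) = ex f * X a f"
    by (rule sph_eqI, drule S2_nonzero) (simp add: ev_X grad_ex ev_ex)
qed

lemma X_diff [simp]: "X a (f - g) = X a f - X a g"
  by (simp add: diff_conv_add_uminus del: add_uminus_conv_diff)

lemma X_numeral [simp]: "X a (numeral n) = 0"
  using X_simps(7)[of a "numeral n"] by simp

lemma X_vec:
  "X (a + b) f = X a f + X b f" "X (c *\<^sub>R a) f = c *\<^sub>R X a f" "X (- a) f = - X a f" "X 0 f = 0"
  by (rule sph_eqI, use S2_nonzero in \<open>auto simp: ev_X cross_add_left cross_mult_left inner_add_right\<close>)+

lemma lin_vec:
  "lin (a + b) = lin a + lin b" "lin (c *\<^sub>R a) = c *\<^sub>R lin a" "lin (- a) = - lin a" "lin 0 = 0"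
  by (rule sph_eqI, simp add: ev_lin inner_add_left add_divide_distrib)+

text \<open>The bracket of so(3). Second-order terms cancel by symmetry of the Hessian, and the
  first-order terms combine by the Jacobi identity.\<close>

lemma X_commute: "X a (X b f) - X b (X a f) = - X (cross3 a b) f"
proof (rule sph_eqI)
  fix x assume "x \<in> S2"
  then have x: "x \<noteq> 0" by auto
  obtain G where G: "(grad f has_derivative G) (at x)" "\<And>h k. G h \<bullet> k = G k \<bullet> h"
    using grad_has_derivative[OF x, of f] by metis
  have main: "ev (X a (X b f)) x = G (cross3 a x) \<bullet> cross3 b x + grad f x \<bullet> cross3 b (cross3 a x)" for a b
  proof -
    have c: "bounded_linear (cross3 b)"
      by (rule linear_conv_bounded_linear[THEN iffD1], rule linearI)
          (simp_all add: cross_add_right cross_mult_right)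
    have "((\<lambda>y. grad f y \<bullet> cross3 b y) has_derivative (\<lambda>h. grad f x \<bullet> cross3 b h + G h \<bullet> cross3 b x)) (at x)"
      by (intro has_derivative_inner G bounded_linear_imp_has_derivative c)
    then have "(ev (X b f) has_derivative (\<lambda>h. grad f x \<bullet> cross3 b h + G h \<bullet> cross3 b x)) (at x)"
      by (rule has_derivative_transform_within_open[of _ _ _ _ "-{0}"]) (auto simp: x ev_X)
    from has_derivative_unique[OF ev_has_derivative[OF x] this]
    show ?thesis using x by (simp add: ev_X fun_eq_iff)
  qed
  have "cross3 b (cross3 a x) - cross3 a (cross3 b x) = - cross3 (cross3 a b) x"
    using Jacobi[of a b x] cross_skew[of x a] cross_skew[of x "cross3 a b"]
    by (simp add: algebra_simps add_eq_0_iff)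
  then have "grad f x \<bullet> cross3 b (cross3 a x) - grad f x \<bullet> cross3 a (cross3 b x) = - (grad f x \<bullet> cross3 (cross3 a b) x)"
    by (metis inner_diff_right inner_minus_right)
  then show "ev (X a (X b f) - X b (X a f)) x = ev (- X (cross3 a b) f) x"
    using x G(2)[of "cross3 a x" "cross3 b x"] by (simp add: main) (simp add: ev_X)
qed

text \<open>A positively oriented orthonormal basis. Listing all three cross products makes the
  notion visibly invariant under cyclic permutation, which is used constantly to transfer statements
  between the axes.\<close>

definition frame :: "real^3 \<Rightarrow> real^3 \<Rightarrow> real^3 \<Rightarrow> bool" where
  "frame a b c \<longleftrightarrow> a \<bullet> a = 1 \<and> b \<bullet> b = 1 \<and> c \<bullet> c = 1 \<and> a \<bullet> b = 0 \<and> b \<bullet> c = 0 \<and> c \<bullet> a = 0 \<and>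
     cross3 a b = c \<and> cross3 b c = a \<and> cross3 c a = b"

lemma frame_cycle: "frame a b c \<Longrightarrow> frame b c a"
  by (auto simp: frame_def)

lemma frameI:
  assumes "norm a = 1" "norm b = 1" "a \<bullet> b = 0"
  shows "frame a b (cross3 a b)"
proof -
  have ip: "a \<bullet> a = 1" "b \<bullet> b = 1" using assms by (auto simp: norm_eq_1)
  have "cross3 a b \<bullet> cross3 a b = 1"
    using norm_cross_dot[of a b] assms by (simp add: power2_norm_eq_inner)
  moreover have "cross3 b (cross3 a b) = a"
    using Lagrange[of b a b] ip assms(3) by (simp add: inner_commute)
  moreover have "cross3 (cross3 a b) a = b"
    using Lagrange[of a a b] ip assms(3) cross_skew[of "cross3 a b" a] by (simp add: inner_commute)
  ultimately show ?thesis
    using ip assms(3) by (simp add: frame_def dot_cross_self)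
qed

lemma frame_exists: "norm a = 1 \<Longrightarrow> \<exists>b c. frame a b c"
  using orthonormal_frame_S2_exists[of a] frameI[of a]
  by (auto simp: orthonormal_frame_S2_def inner_commute)

lemma frame_expand:
  assumes "frame a b c"
  shows "x = (a \<bullet> x) *\<^sub>R a + (b \<bullet> x) *\<^sub>R b + (c \<bullet> x) *\<^sub>R c"
proof -
  define z where "z = x - ((a \<bullet> x) *\<^sub>R a + (b \<bullet> x) *\<^sub>R b + (c \<bullet> x) *\<^sub>R c)"
  have z: "a \<bullet> z = 0" "b \<bullet> z = 0" "c \<bullet> z = 0"
    using assms by (auto simp: z_def frame_def inner_diff_right inner_add_right inner_commute)
  \<comment> \<open>The remainder \<open>z\<close> is thus parallel to \<open>c\<close> and also
    orthogonal to it, hence zero.\<close>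
  have "cross3 z (cross3 a b) = 0"
    using Lagrange[of z a b] z by (simp add: inner_commute)
  then have "z \<bullet> c = 0 \<and> cross3 z c = 0"
    using assms z by (simp add: frame_def inner_commute)
  then have "z = 0"
    using norm_and_cross_eq_0[of z c] assms by (auto simp: frame_def)
  then show ?thesis by (simp add: z_def)
qed

lemma frame_norm_sq:
  assumes "frame a b c"
  shows "(norm x)\<^sup>2 = (a \<bullet> x)\<^sup>2 + (b \<bullet> x)\<^sup>2 + (c \<bullet> x)\<^sup>2"
proof -
  have "x \<bullet> x = x \<bullet> ((a \<bullet> x) *\<^sub>R a + (b \<bullet> x) *\<^sub>R b + (c \<bullet> x) *\<^sub>R c)"
    using frame_expand[OF assms, of x] by simp
  then show ?thesis
    by (simp add: inner_add_right inner_commute power2_norm_eq_inner) (simp add: power2_eq_square)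
qed

text \<open>The Casimir operator of so(3). \<open>lap_frame\<close> frees it from the coordinate
  axes, and \<open>laplace_beltrami_eq_lap\<close> identifies it with the Laplace--Beltrami
  operator.\<close>

definition lap :: "sph \<Rightarrow> sph" where
  "lap f = (\<Sum>i\<in>UNIV. X (axis i 1) (X (axis i 1) f))"

lemma lap_frame:
  assumes "frame a b c"
  shows "lap f = X a (X a f) + X b (X b f) + X c (X c f)"
proof -
  have Xi: "X (axis i 1) g = (a $ i) *\<^sub>R X a g + (b $ i) *\<^sub>R X b g + (c $ i) *\<^sub>R X c g" for i g
    by (subst frame_expand[OF assms, of "axis i 1"]) (simp add: X_vec inner_axis)
  have ip: "(\<Sum>i\<in>UNIV. v $ i * w $ i) = v \<bullet> w" for v w :: "real^3"
    by (simp add: inner_vec_def)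
  have "lap f = (\<Sum>i\<in>UNIV. (a $ i * a $ i) *\<^sub>R X a (X a f) + (a $ i * b $ i) *\<^sub>R X b (X a f) + (a $ i * c $ i) *\<^sub>R X c (X a f)
     + ((b $ i * a $ i) *\<^sub>R X a (X b f) + (b $ i * b $ i) *\<^sub>R X b (X b f) + (b $ i * c $ i) *\<^sub>R X c (X b f))
     + ((c $ i * a $ i) *\<^sub>R X a (X c f) + (c $ i * b $ i) *\<^sub>R X b (X c f) + (c $ i * c $ i) *\<^sub>R X c (X c f)))"
    unfolding lap_def by (rule sum.cong) (simp_all add: Xi scaleR_add_right)
  also have "\<dots> = X a (X a f) + X b (X b f) + X c (X c f)"
    unfolding sum.distrib scaleR_sum_left[symmetric] ip
    using assms by (simp add: frame_def inner_commute)
  finally show ?thesis .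
qed

lemma lin_frame:
  assumes "frame a b c"
  shows "lin a * lin a + lin b * lin b + lin c * lin c = 1"
proof (rule sph_eqI)
  fix x assume x: "x \<in> S2"
  then show "ev (lin a * lin a + lin b * lin b + lin c * lin c) x = ev 1 x"
    using frame_norm_sq[OF assms, of x] S2_nonzero[OF x] by (simp add: ev_lin ev_one power2_eq_square)
qed

text \<open>At \<open>x\<close> the left-hand side is, up to the norm of \<open>x\<close>, the
  derivative along the rotation about \<open>x\<close> itself, which fixes \<open>x\<close>.\<close>

lemma X_radial:
  assumes "frame a b c"
  shows "lin a * X a f + lin b * X b f + lin c * X c f = 0"
proof (rule sph_eqI)
  fix x assume x: "x \<in> S2"
  have "(a \<bullet> x) * (grad f x \<bullet> cross3 a x) + (b \<bullet> x) * (grad f x \<bullet> cross3 b x) + (c \<bullet> x) * (grad f x \<bullet> cross3 c x)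
    = grad f x \<bullet> cross3 ((a \<bullet> x) *\<^sub>R a + (b \<bullet> x) *\<^sub>R b + (c \<bullet> x) *\<^sub>R c) x"
    by (simp add: cross_add_left cross_mult_left inner_add_right)
  also have "\<dots> = 0"
    using frame_expand[OF assms, of x] by simp
  finally show "ev (lin a * X a f + lin b * X b f + lin c * X c f) x = ev 0 x"
    using x S2_nonzero[OF x] by (simp add: ev_lin ev_X)
qed

lemma grad_pull:
  assumes R: "orthogonal_transformation R" and x: "x \<noteq> 0"
  shows "grad (pull R f) x \<bullet> h = grad f (R x) \<bullet> R h"
proof -
  have lin: "bounded_linear R"
    using orthogonal_transformation_linear[OF R] by (rule linear_conv_bounded_linear[THEN iffD1])
  have Rx: "R x \<noteq> 0" using orthogonal_transformation_norm[OF R, of x] x by (metis norm_eq_zero)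
  have "((\<lambda>y. ev f (R y)) has_derivative (\<lambda>h. grad f (R x) \<bullet> R h)) (at x)"
    using has_derivative_compose[OF bounded_linear_imp_has_derivative[OF lin] ev_has_derivative[OF Rx]] .
  then have "(ev (pull R f) has_derivative (\<lambda>h. grad f (R x) \<bullet> R h)) (at x)"
    by (simp add: ev_pull[OF R, abs_def])
  from has_derivative_unique[OF ev_has_derivative[OF x] this] show ?thesis by meson
qed

section \<open>Reflections in planes through the origin\<close>

definition mirror :: "real^3 \<Rightarrow> real^3 \<Rightarrow> real^3" where
  "mirror v x = x - (2 * (v \<bullet> x)) *\<^sub>R v"

lemma mirror_orthogonal: "v \<bullet> v = 1 \<Longrightarrow> orthogonal_transformation (mirror v)"
  unfolding orthogonal_transformation_def
proof (intro conjI allI)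
  show "linear (mirror v)"
    by (rule linearI) (simp_all add: mirror_def inner_add_right algebra_simps)
  fix x y assume "v \<bullet> v = 1"
  then show "mirror v x \<bullet> mirror v y = x \<bullet> y"
    by (simp add: mirror_def inner_diff_left inner_diff_right inner_commute[of x v] inner_commute[of y v])
qed

lemma ev_pull_mirror: "v \<bullet> v = 1 \<Longrightarrow> ev (pull (mirror v) f) x = ev f (mirror v x)"
  by (simp add: ev_pull mirror_orthogonal)

text \<open>A reflection commutes with the rotations about its normal and reverses those about an
  axis lying in the mirror plane.\<close>

lemma X_pull_mirror:
  assumes v: "v \<bullet> v = 1"
  shows "X v (pull (mirror v) f) = pull (mirror v) (X v f)"
    and "w \<bullet> v = 0 \<Longrightarrow> X w (pull (mirror v) f) = - pull (mirror v) (X w f)"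
proof -
  note R = mirror_orthogonal[OF v]
  have R0: "mirror v x \<noteq> 0" if "x \<noteq> 0" for x
    using orthogonal_transformation_norm[OF R, of x] that by (metis norm_eq_zero)
  have c1: "mirror v (cross3 v x) = cross3 v (mirror v x)" for x
    by (simp add: mirror_def dot_cross_self Cross3.right_diff_distrib cross_mult_right)
  show "X v (pull (mirror v) f) = pull (mirror v) (X v f)"
    by (rule sph_eqI, drule S2_nonzero) (simp add: ev_X ev_pull[OF R] grad_pull[OF R] R0 c1)
  assume w: "w \<bullet> v = 0"
  have c2: "mirror v (cross3 w x) = - cross3 w (mirror v x)" for x
  proof -
    have "cross3 v (cross3 v (cross3 w x)) = (v \<bullet> cross3 w x) *\<^sub>R v - cross3 w x"
      using Lagrange[of v v "cross3 w x"] v by simp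
    moreover have "cross3 v (cross3 w x) = (v \<bullet> x) *\<^sub>R w"
      using Lagrange[of v w x] w by (simp add: inner_commute)
    ultimately have "(v \<bullet> cross3 w x) *\<^sub>R v = cross3 w x + (v \<bullet> x) *\<^sub>R cross3 v w"
      by (simp add: cross_mult_right)
    then have "(2 * (v \<bullet> cross3 w x)) *\<^sub>R v = 2 *\<^sub>R cross3 w x + (2 * (v \<bullet> x)) *\<^sub>R cross3 v w"
      by (metis scaleR_add_right scaleR_scaleR)
    then show ?thesis
      using cross_skew[of w v]
      by (simp add: mirror_def Cross3.right_diff_distrib cross_mult_right scaleR_2)
  qed
  show "X w (pull (mirror v) f) = - pull (mirror v) (X w f)"
    by (rule sph_eqI, drule S2_nonzero) (simp add: ev_X ev_pull[OF R] grad_pull[OF R] R0 c2)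
qed

lemma pull_diff: "pull R (f - g) = pull R f - pull R g"
  and pull_uminus: "pull R (- f) = - pull R f"
  and pull_add: "pull R (f + g) = pull R f + pull R g"
  and pull_mult: "pull R (f * g) = pull R f * pull R g"
  and pull_ex: "orthogonal_transformation R \<Longrightarrow> pull R (ex f) = ex (pull R f)"
proof -
  have [simp]: "R 0 = 0" if "orthogonal_transformation R"
    using linear_0[OF orthogonal_transformation_linear[OF that]] .
  have R0: "R x \<noteq> 0" if "orthogonal_transformation R" "x \<noteq> 0" for x
    using orthogonal_transformation_norm[OF that(1), of x] that by (metis norm_eq_zero)
  show "pull R (f - g) = pull R f - pull R g" "pull R (- f) = - pull R f"
    "pull R (f + g) = pull R f + pull R g" "pull R (f * g) = pull R f * pull R g"
    by (rule sph_eqI, simp add: pull.rep_eq)+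
  assume "orthogonal_transformation R"
  then show "pull R (ex f) = ex (pull R f)"
    by (intro sph_eqI) (use S2_nonzero R0 in \<open>auto simp: ev_pull ev_ex\<close>)
qed

text \<open>The extension is x -> u (x / |x|). Near a point it equals a local smooth extension
  composed with the normalisation map, whose coordinates are the functions
  \<open>lin b\<close>.\<close>

lemma smooth_on_S2_sph:
  assumes "smooth_on_S2 u"
  shows "\<exists>f. \<forall>x\<in>S2. ev f x = u x"
proof -
  define n :: "real^3 \<Rightarrow> real^3" where "n x = x /\<^sub>R norm x" for x
  have nS: "n x \<in> S2" if "x \<noteq> 0" for x using that by (simp add: n_def)
  have nC: "Ck_on k (\<lambda>x. n x \<bullet> b) (-{0})" for k b
  proof -
    have "(\<lambda>x. n x \<bullet> b) = ev (lin b)"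
      by (simp add: fun_eq_iff n_def ev_lin inner_commute divide_inverse mult.commute)
    then show ?thesis by (simp add: ev_Ck)
  qed
  have contn: "continuous_on (-{0}) n"
    unfolding n_def by (intro continuous_intros) auto
  define f where "f x = (if x = 0 then 0 else u (n x))" for x
  have "Ck_on k f (-{0})" for k
  proof (rule Ck_on_local)
    fix p :: "real^3" assume p: "p \<in> -{0}"
    then have "n p \<in> S2" using nS by simp
    then have "\<exists>U F. open U \<and> n p \<in> U \<and> (\<forall>k. Ck_on k F U) \<and> (\<forall>x\<in>U \<inter> S2. F x = u x)"
      using assms unfolding smooth_on_S2_def by (rule_tac bspec)
    then obtain U F where UF: "open U" "n p \<in> U" "\<forall>k. Ck_on k F U" "\<forall>x\<in>U \<inter> S2. F x = u x"
      by blast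
    define W where "W = (-{0}) \<inter> n -` U"
    have W: "open W" unfolding W_def by (rule continuous_open_preimage[OF contn _ UF(1)]) auto
    have "Ck_on k (\<lambda>x. F (n x)) W"
      by (rule Ck_on_compose[OF W UF(1) _ UF(3)[rule_format]])
        (auto simp: W_def intro: Ck_on_subset[OF nC])
    then have "Ck_on k f W"
      by (rule Ck_on_cong[OF W, rotated]) (use UF(4) nS in \<open>auto simp: W_def f_def\<close>)
    then show "\<exists>W. open W \<and> p \<in> W \<and> Ck_on k f W"
      using W p UF(2) by (auto simp: W_def)
  qed
  moreover have "f (t *\<^sub>R x) = f x" if "0 < t" for t x
  proof -
    have "(t *\<^sub>R x) /\<^sub>R norm (t *\<^sub>R x) = x /\<^sub>R norm x"
      using that by (simp add: field_simps)
    then have "n (t *\<^sub>R x) = n x" by (simp only: n_def)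
    then show ?thesis using that by (simp add: f_def)
  qed
  ultimately have "f \<in> {f. (\<forall>k. Ck_on k f (-{0})) \<and> f 0 = 0 \<and> (\<forall>t x. 0 < t \<longrightarrow> f (t *\<^sub>R x) = f x)}"
    by (simp add: f_def)
  then have "ev (Abs_sph f) = f" by (rule Abs_sph_inverse)
  moreover have "f x = u x" if "x \<in> S2" for x
    using that S2_nonzero[OF that] by (simp add: f_def n_def)
  ultimately show ?thesis by metis
qed

text \<open>In a frame whose first vector is \<open>p\<close>, the rotation about \<open>p\<close>
  contributes nothing at \<open>p\<close>, the other two give the diagonal of the Hessian on the
  tangent plane, and their first-order terms are radial derivatives, hence zero.\<close>

lemma laplace_beltrami_eq_lap:
  assumes f: "\<forall>x\<in>S2. ev f x = u x" and p: "p \<in> S2"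
  shows "laplace_beltrami_S2 u p = ev (lap f) p"
proof -
  have p0: "p \<noteq> 0" using p by auto
  have g: "grad_S2 u q = grad f q" if q: "q \<in> S2" for q
  proof (rule grad_S2_eqI[OF q])
    have q0: "q \<noteq> 0" using q by auto
    show "grad f q \<bullet> q = 0" using grad_radial[OF q0] .
    have "(ev f has_derivative (\<lambda>h. grad f q \<bullet> h)) (at q within S2)"
      using ev_has_derivative[OF q0] by (rule has_derivative_at_withinI)
    then show "(u has_derivative (\<lambda>h. grad f q \<bullet> h)) (at q within S2)"
      by (rule has_derivative_transform[OF q, rotated]) (use f in auto)
  qed
  obtain G where G: "(grad f has_derivative G) (at p)" "\<And>h k. G h \<bullet> k = G k \<bullet> h"
    using grad_has_derivative[OF p0, of f] by metis
  have "(grad_S2 u has_derivative G) (at p within S2)"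
    using has_derivative_at_withinI[OF G(1)] by (rule has_derivative_transform[OF p, rotated]) (rule g)
  moreover obtain b c where fr: "frame p b c" using frame_exists[of p] p by auto
  moreover from fr have "orthonormal_frame_S2 p b c"
    by (auto simp: frame_def orthonormal_frame_S2_def norm_eq_1 inner_commute)
  ultimately have L: "laplace_beltrami_S2 u p = G b \<bullet> b + G c \<bullet> c"
    unfolding laplace_beltrami_S2_def using div_S2_eq[OF p] by blast
  have XX: "ev (X v (X v f)) p = G (cross3 v p) \<bullet> cross3 v p + grad f p \<bullet> cross3 v (cross3 v p)" for v
  proof -
    have c: "bounded_linear (cross3 v)"
      by (rule linear_conv_bounded_linear[THEN iffD1], rule linearI)
          (simp_all add: cross_add_right cross_mult_right)
    have "((\<lambda>y. grad f y \<bullet> cross3 v y) has_derivative (\<lambda>h. grad f p \<bullet> cross3 v h + G h \<bullet> cross3 v p)) (at p)"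
      by (intro has_derivative_inner G bounded_linear_imp_has_derivative c)
    then have "(ev (X v f) has_derivative (\<lambda>h. grad f p \<bullet> cross3 v h + G h \<bullet> cross3 v p)) (at p)"
      by (rule has_derivative_transform_within_open[of _ _ _ _ "-{0}"]) (auto simp: p0 ev_X)
    from has_derivative_unique[OF ev_has_derivative[OF p0] this]
    show ?thesis using p0 by (simp add: ev_X fun_eq_iff)
  qed
  have cr: "cross3 b p = - c" "cross3 c p = b" "cross3 b c = p" "cross3 c b = - p"
    using fr cross_skew[of b p] cross_skew[of c b] by (auto simp: frame_def)
  have lin: "linear G" using G(1) by (rule has_derivative_linear)
  have "ev (lap f) p = G c \<bullet> c + G b \<bullet> b"
    using linear_0[OF lin] linear_neg[OF lin] grad_radial[OF p0, of f]
    by (simp add: lap_frame[OF fr] XX cr)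
  then show ?thesis using L by simp
qed

section \<open>Rotation-invariant integration\<close>

text \<open>For functions that are homogeneous of degree 0, integration over the punctured unit ball is
  integration over the sphere up to the factor 3.\<close>

abbreviation ballM :: "(real^3) measure" where
  "ballM \<equiv> lebesgue_on (ball 0 1 - {0})"

text \<open>Bounded Borel functions form a class closed under products and orthogonal maps that
  contains the discontinuous cut-off factors used later.\<close>

definition adm :: "(real^3 \<Rightarrow> real) \<Rightarrow> bool" where
  "adm F \<longleftrightarrow> F \<in> borel_measurable borel \<and> (\<exists>C. \<forall>x. \<bar>F x\<bar> \<le> C)"

definition sint :: "(real^3 \<Rightarrow> real) \<Rightarrow> real" where
  "sint F = integral\<^sup>L ballM F"

lemma finite_ballM: "finite_measure ballM"
  by (rule finite_measure_lebesgue_on) (auto intro!: bounded_set_imp_lmeasurable bounded_diff)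

lemma borel_measurable_ballM:
  "F \<in> borel_measurable borel \<Longrightarrow> F \<in> borel_measurable ballM"
  by (intro measurable_restrict_space1 measurable_completion) simp

lemma adm_integrable: "adm F \<Longrightarrow> integrable ballM F"
  unfolding adm_def
proof (elim conjE exE)
  fix C assume "F \<in> borel_measurable borel" "\<forall>x. \<bar>F x\<bar> \<le> C"
  then show "integrable ballM F"
    by (intro finite_measure.integrable_const_bound[OF finite_ballM, of _ C] borel_measurable_ballM) auto
qed

lemma adm_const [simp]: "adm (\<lambda>x. c)"
  by (auto simp: adm_def)

lemma adm_add: "adm F \<Longrightarrow> adm G \<Longrightarrow> adm (\<lambda>x. F x + G x)"
  unfolding adm_def by (auto intro!: borel_measurable_add) (meson abs_triangle_ineq add_mono order_trans)

lemma adm_mult: "adm F \<Longrightarrow> adm G \<Longrightarrow> adm (\<lambda>x. F x * G x)"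
  unfolding adm_def
proof (elim conjE exE, intro conjI borel_measurable_times)
  fix C D assume "\<forall>x. \<bar>F x\<bar> \<le> C" "\<forall>x. \<bar>G x\<bar> \<le> D"
  then have "\<bar>F x * G x\<bar> \<le> C * D" for x
    unfolding abs_mult by (intro mult_mono) (auto intro: order_trans[OF abs_ge_zero])
  then show "\<exists>C. \<forall>x. \<bar>F x * G x\<bar> \<le> C" by blast
qed

lemma adm_minus: "adm F \<Longrightarrow> adm (\<lambda>x. - F x)"
  using adm_mult[OF adm_const[of "-1"]] by simp

lemma adm_diff: "adm F \<Longrightarrow> adm G \<Longrightarrow> adm (\<lambda>x. F x - G x)"
  using adm_add[OF _ adm_minus] by simp

lemma adm_sum: "(\<And>i. i \<in> A \<Longrightarrow> adm (F i)) \<Longrightarrow> adm (\<lambda>x. \<Sum>i\<in>A. F i x)"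
  by (induction A rule: infinite_finite_induct) (auto intro: adm_add)

lemma adm_power2: "adm F \<Longrightarrow> adm (\<lambda>x. (F x)\<^sup>2)"
  unfolding power2_eq_square by (rule adm_mult)

lemma ev_continuous: "continuous_on (-{0}) (ev f)"
  using ev_Ck[of 0 f] by simp

lemma adm_punctured:
  assumes c: "continuous_on (-{0}) F" and h: "\<And>t x. 0 < t \<Longrightarrow> F (t *\<^sub>R x) = F x"
  shows "adm F"
  unfolding adm_def
proof
  show "F \<in> borel_measurable borel"
    by (rule borel_measurable_continuous_countable_exceptions[of "{0}"]) (use c in auto)
  have "compact (F ` S2)"
    by (rule compact_continuous_image[OF continuous_on_subset[OF c]]) auto
  then obtain C where C: "\<And>x. x \<in> S2 \<Longrightarrow> \<bar>F x\<bar> \<le> C"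
    using compact_imp_bounded by (fastforce simp: bounded_iff)
  have "\<bar>F x\<bar> \<le> max C \<bar>F 0\<bar>" for x
  proof (cases "x = 0")
    case False
    then show ?thesis using C[of "x /\<^sub>R norm x"] h[of "inverse (norm x)" x] by auto
  qed simp
  then show "\<exists>C. \<forall>x. \<bar>F x\<bar> \<le> C" by blast
qed

lemma adm_ev [simp]: "adm (ev f)"
  by (rule adm_punctured[OF ev_continuous ev_scale])

lemma orth_measurable:
  fixes R :: "real^3 \<Rightarrow> real^3"
  shows "orthogonal_transformation R \<Longrightarrow> R \<in> borel_measurable borel"
  by (intro borel_measurable_continuous_onI linear_continuous_on)
    (simp add: orthogonal_transformation_linear linear_linear)

lemma adm_orth: "adm F \<Longrightarrow> orthogonal_transformation R \<Longrightarrow> adm (\<lambda>x. F (R x))"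
  unfolding adm_def using measurable_compose[OF orth_measurable] by blast

lemma sint_add: "adm F \<Longrightarrow> adm G \<Longrightarrow> sint (\<lambda>x. F x + G x) = sint F + sint G"
  unfolding sint_def by (intro Bochner_Integration.integral_add adm_integrable)

lemma sint_diff: "adm F \<Longrightarrow> adm G \<Longrightarrow> sint (\<lambda>x. F x - G x) = sint F - sint G"
  unfolding sint_def by (intro Bochner_Integration.integral_diff adm_integrable)

lemma sint_cmult: "sint (\<lambda>x. c * F x) = c * sint F"
  unfolding sint_def by simp

lemma sint_minus: "sint (\<lambda>x. - F x) = - sint F"
  using sint_cmult[of "-1" F] by simp

lemma sint_sum: "(\<And>i. i \<in> A \<Longrightarrow> adm (F i)) \<Longrightarrow> sint (\<lambda>x. \<Sum>i\<in>A. F i x) = (\<Sum>i\<in>A. sint (F i))"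
  unfolding sint_def by (intro Bochner_Integration.integral_sum adm_integrable)

lemma sint_cong: "(\<And>x. x \<noteq> 0 \<Longrightarrow> F x = G x) \<Longrightarrow> sint F = sint G"
  unfolding sint_def by (rule Bochner_Integration.integral_cong) auto

lemma sint_nonneg: "(\<And>x. x \<noteq> 0 \<Longrightarrow> 0 \<le> F x) \<Longrightarrow> 0 \<le> sint F"
  unfolding sint_def by (rule integral_nonneg_AE) auto

lemma sint_mono:
  assumes "adm F" "adm G" "\<And>x. x \<noteq> 0 \<Longrightarrow> F x \<le> G x"
  shows "sint F \<le> sint G"
  using sint_nonneg[of "\<lambda>x. G x - F x"] sint_diff[OF assms(2,1)] assms(3) by simp

lemma sint_dominated_convergence:
  assumes "\<And>n. adm (F n)" "adm H" "\<And>n x. x \<noteq> 0 \<Longrightarrow> \<bar>F n x\<bar> \<le> C"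
    and "\<And>x. x \<noteq> 0 \<Longrightarrow> (\<lambda>n. F n x) \<longlonglongrightarrow> H x"
  shows "(\<lambda>n. sint (F n)) \<longlonglongrightarrow> sint H"
  unfolding sint_def
proof (rule integral_dominated_convergence)
  show "integrable ballM (\<lambda>x. C)" by (rule adm_integrable) simp
  show "AE x in ballM. (\<lambda>n. F n x) \<longlonglongrightarrow> H x" by (rule AE_I2) (use assms(4) in auto)
  show "AE x in ballM. norm (F n x) \<le> C" for n by (rule AE_I2) (use assms(3) in auto)
qed (use assms(1,2) in \<open>auto simp: adm_def borel_measurable_ballM\<close>)

text \<open>A nonnegative function with zero integral vanishes almost everywhere; by continuity the
  exceptional set is open, and an open null set is empty. Homogeneity brings an arbitrary nonzero
  point into the ball.\<close>

lemma sint_zero_imp: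
  assumes "adm F" "\<And>x. x \<noteq> 0 \<Longrightarrow> 0 \<le> F x" "sint F = 0" "continuous_on (-{0}) F"
    and h: "\<And>t x. 0 < t \<Longrightarrow> F (t *\<^sub>R x) = F x" and x: "x \<noteq> 0"
  shows "F x = 0"
proof -
  let ?P = "ball 0 1 - {0 :: real^3}"
  have "AE x in ballM. 0 \<le> F x" by (rule AE_I2) (use assms(2) in auto)
  then have "AE x in ballM. F x = 0"
    using assms(3) integral_nonneg_eq_0_iff_AE[OF adm_integrable[OF assms(1)]]
    by (simp add: sint_def)
  then have ae: "AE x in lebesgue. x \<in> ?P \<longrightarrow> F x = 0"
    by (subst (asm) AE_restrict_space_iff) auto
  have P: "open ?P" by auto
  have "continuous_on ?P F" using assms(4) by (rule continuous_on_subset) auto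
  then have "open (?P \<inter> F -` (-{0}))"
    by (rule continuous_open_preimage) auto
  moreover from this have "?P \<inter> F -` (-{0}) \<in> null_sets lebesgue"
    by (subst AE_iff_null_sets) (use ae in auto)
  ultimately have e: "?P \<inter> F -` (-{0}) = {}"
    using open_not_negligible negligible_iff_null_sets by blast
  define y where "y = (1 / (2 * norm x)) *\<^sub>R x"
  have "y \<in> ?P" using x by (simp add: y_def)
  then have "F y = 0" using e by auto
  moreover have "F y = F x" unfolding y_def by (rule h) (use x in simp)
  ultimately show ?thesis by simp
qed

lemma distr_ballM:
  assumes R: "orthogonal_transformation R"
  shows "R \<in> measurable ballM ballM" and "distr ballM ballM R = ballM"
proof -
  let ?P = "ball 0 1 - {0 :: real^3}"
  define S where "S = inv R"
  have S: "orthogonal_transformation S" unfolding S_def by (rule orthogonal_transformation_inv[OF R])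
  have bij: "bij R" by (rule orthogonal_transformation_bij[OF R])
  have SR: "S (R x) = x" "R (S x) = x" for x
    using bij by (simp_all add: S_def bij_is_inj bij_is_surj surj_f_inv_f)
  have nR: "norm (R x) = norm x" for x by (rule orthogonal_transformation_norm[OF R])
  have RP: "R x \<in> ?P \<longleftrightarrow> x \<in> ?P" for x
  proof -
    have "R x = 0 \<longleftrightarrow> x = 0" using nR[of x] by (metis norm_eq_zero)
    then show ?thesis using nR[of x] by simp
  qed
  have pre: "R -` A \<inter> space ballM = S ` A" "S ` A \<in> sets ballM" "A \<in> lmeasurable" if "A \<in> sets ballM" for A
  proof -
    have AP: "A \<subseteq> ?P" "A \<in> sets lebesgue" using that by (auto simp: sets_restrict_space_iff sets_restrict_space)
    show "R -` A \<inter> space ballM = S ` A"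
    proof (intro equalityI subsetI)
      fix x assume "x \<in> R -` A \<inter> space ballM"
      then show "x \<in> S ` A" using SR(1)[of x] by (metis IntD1 imageI vimageD)
    next
      fix x assume "x \<in> S ` A"
      then obtain y where y: "y \<in> A" "x = S y" by auto
      then have "R x \<in> A" "x \<in> ?P" using SR(2)[of y] AP(1) RP[of x] by auto
      then show "x \<in> R -` A \<inter> space ballM" by simp
    qed
    show m: "A \<in> lmeasurable"
      using AP by (intro bounded_set_imp_lmeasurable) (auto intro: bounded_subset[of "ball 0 1"])
    have "S ` A \<in> lmeasurable" by (rule measurable_orthogonal_image[OF S m])
    moreover have "S ` A \<subseteq> ?P"
    proof (rule image_subsetI)
      fix y assume "y \<in> A"
      then have "y \<in> ?P" using AP(1) by blast
      then show "S y \<in> ?P" using RP[of "S y"] unfolding SR(2) by blast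
    qed
    ultimately show "S ` A \<in> sets ballM" by (auto simp: sets_restrict_space_iff)
  qed
  show m: "R \<in> measurable ballM ballM"
    by (rule measurableI) (use pre RP in \<open>auto\<close>)
  show "distr ballM ballM R = ballM"
  proof (rule measure_eqI)
    fix A assume "A \<in> sets (distr ballM ballM R)"
    then have A: "A \<in> sets ballM" by simp
    have AP: "A \<subseteq> ?P" using A by (auto simp: sets_restrict_space_iff sets_restrict_space)
    have SP: "S ` A \<subseteq> ?P" using pre(2)[OF A] by (auto simp: sets_restrict_space)
    have Sm: "S ` A \<in> lmeasurable" by (rule measurable_orthogonal_image[OF S pre(3)[OF A]])
    have "emeasure (distr ballM ballM R) A = emeasure ballM (S ` A)"
      using emeasure_distr[OF m A] pre(1)[OF A] by simp
    also have "\<dots> = emeasure lebesgue (S ` A)"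
      using SP by (intro emeasure_restrict_space) auto
    also have "\<dots> = emeasure lebesgue A"
      using measure_orthogonal_image[OF S pre(3)[OF A]] Sm pre(3)[OF A]
      by (simp add: emeasure_eq_measure2)
    also have "\<dots> = emeasure ballM A"
      using AP by (intro emeasure_restrict_space[symmetric]) auto
    finally show "emeasure (distr ballM ballM R) A = emeasure ballM A" .
  qed simp
qed

lemma sint_orth:
  assumes F: "adm F" and R: "orthogonal_transformation R"
  shows "sint (\<lambda>x. F (R x)) = sint F"
proof -
  have "F \<in> borel_measurable ballM" using F by (auto simp: adm_def borel_measurable_ballM)
  from integral_distr[OF distr_ballM(1)[OF R] this] show ?thesis
    unfolding distr_ballM(2)[OF R] sint_def by (rule sym)
qed

text \<open>Rodrigues' formula for the rotation by the angle t about a unit vector.\<close>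

definition rotate_about :: "real^3 \<Rightarrow> real \<Rightarrow> real^3 \<Rightarrow> real^3" where
  "rotate_about a t x = (a \<bullet> x) *\<^sub>R a + cos t *\<^sub>R (x - (a \<bullet> x) *\<^sub>R a) + sin t *\<^sub>R cross3 a x"

lemma rotate_about_0 [simp]: "rotate_about a 0 x = x"
  by (simp add: rotate_about_def)

lemma cross_cross_self: "a \<bullet> a = 1 \<Longrightarrow> cross3 a (cross3 a x) = (a \<bullet> x) *\<^sub>R a - x"
  using Lagrange[of a a x] by simp

lemma rotate_about_orthogonal:
  assumes a: "norm a = 1"
  shows "orthogonal_transformation (rotate_about a t)"
  unfolding orthogonal_transformation
proof (intro conjI allI)
  show "linear (rotate_about a t)"
    by (rule linearI)
      (simp_all add: rotate_about_def inner_add_right cross_add_right cross_mult_right algebra_simps)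
  fix x
  have aa: "a \<bullet> a = 1" using a by (simp add: norm_eq_1)
  define w where "w = x - (a \<bullet> x) *\<^sub>R a"
  have w: "a \<bullet> w = 0" "w \<bullet> a = 0" "cross3 a x = cross3 a w" "x = (a \<bullet> x) *\<^sub>R a + w"
    using aa by (simp_all add: w_def inner_diff_right inner_diff_left inner_commute Cross3.right_diff_distrib cross_mult_right)
  have c: "cross3 a w \<bullet> cross3 a w = w \<bullet> w"
    using norm_cross_dot[of a w] w a by (simp add: power2_norm_eq_inner)
  have cs: "cos t * (cos t * y) + sin t * (sin t * y) = y" for y
    using sin_cos_squared_add3[of t] by (metis distrib_right mult.assoc mult_1)
  have "rotate_about a t x \<bullet> rotate_about a t x = (a \<bullet> x)\<^sup>2 + ((cos t)\<^sup>2 + (sin t)\<^sup>2) * (w \<bullet> w)"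
    unfolding rotate_about_def w_def[symmetric] w(3)
    by (simp add: inner_add_left inner_add_right aa w(1,2) c dot_cross_self power2_eq_square algebra_simps cs)
  also have "\<dots> = ((a \<bullet> x) *\<^sub>R a + w) \<bullet> ((a \<bullet> x) *\<^sub>R a + w)"
    by (simp add: inner_add_left inner_add_right aa w(1,2) power2_eq_square)
  also have "\<dots> = x \<bullet> x" using w(4) by simp
  finally show "norm (rotate_about a t x) = norm x" by (simp add: norm_eq)
qed

lemma rotate_about_add:
  assumes a: "norm a = 1"
  shows "rotate_about a s (rotate_about a t x) = rotate_about a (s + t) x"
proof -
  have aa: "a \<bullet> a = 1" using a by (simp add: norm_eq_1)
  define w where "w = x - (a \<bullet> x) *\<^sub>R a"
  have cw: "cross3 a w = cross3 a x"
    by (simp add: w_def Cross3.right_diff_distrib cross_mult_right)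
  have aw: "a \<bullet> w = 0" using aa by (simp add: w_def inner_diff_right)
  have ccw: "cross3 a (cross3 a x) = - w" using cross_cross_self[OF aa, of x] by (simp add: w_def)
  have r: "rotate_about a t x = (a \<bullet> x) *\<^sub>R a + cos t *\<^sub>R w + sin t *\<^sub>R cross3 a x" for t
    by (simp add: rotate_about_def w_def)
  have 1: "a \<bullet> rotate_about a t x = a \<bullet> x"
    by (simp add: r inner_add_right aa aw dot_cross_self)
  have 2: "cross3 a (rotate_about a t x) = cos t *\<^sub>R cross3 a x - sin t *\<^sub>R w"
    by (simp add: r cross_add_right cross_mult_right cw ccw)
  have "rotate_about a s (rotate_about a t x) =
      (a \<bullet> x) *\<^sub>R a + cos s *\<^sub>R (cos t *\<^sub>R w + sin t *\<^sub>R cross3 a x) + sin s *\<^sub>R (cos t *\<^sub>R cross3 a x - sin t *\<^sub>R w)"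
    unfolding rotate_about_def[of a s] 1 2 by (simp add: r)
  also have "\<dots> = rotate_about a (s + t) x"
    unfolding r cos_add sin_add by (simp add: algebra_simps)
  finally show ?thesis .
qed

lemma rotate_about_derivative:
  "((\<lambda>t. rotate_about a t x) has_derivative (\<lambda>h. h *\<^sub>R cross3 a x)) (at 0)"
  unfolding rotate_about_def by (auto intro!: derivative_eq_intros)

lemma ev_rotate_derivative:
  assumes "x \<noteq> 0"
  shows "((\<lambda>t. ev f (rotate_about a t x)) has_real_derivative ev (X a f) x) (at 0)"
proof -
  have "(ev f has_derivative (\<lambda>h. grad f x \<bullet> h)) (at (rotate_about a 0 x))"
    using ev_has_derivative[OF assms] by simp
  from has_derivative_compose[OF rotate_about_derivative this] show ?thesis
    using assms by (simp add: has_field_derivative_def ev_X mult_commute_abs)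
qed

text \<open>The one-parameter group law moves the base time t to 0 at the rotated point.\<close>

lemma rotate_derivative_everywhere:
  assumes a: "norm a = 1" and x: "x \<noteq> 0"
    and D: "\<And>x. x \<noteq> 0 \<Longrightarrow> ((\<lambda>t. F (rotate_about a t x)) has_real_derivative F' x) (at 0)"
  shows "((\<lambda>t. F (rotate_about a t x)) has_real_derivative F' (rotate_about a t x)) (at t)"
proof -
  let ?y = "rotate_about a t x"
  have "?y \<noteq> 0" using orthogonal_transformation_norm[OF rotate_about_orthogonal[OF a], of t x] x
    by (metis norm_eq_zero)
  from D[OF this] have "((\<lambda>s. F (rotate_about a s ?y)) has_real_derivative F' ?y) (at (t + - t))"
    by simp
  then have "((\<lambda>s. F (rotate_about a (s + - t) ?y)) has_real_derivative F' ?y) (at t)"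
    by (subst (asm) DERIV_shift)
  then show ?thesis by (simp add: rotate_about_add[OF a])
qed

text \<open>Rotation invariance makes every difference quotient integrate to zero; the mean value
  theorem bounds the quotients by a bound of \<open>F'\<close>, and dominated convergence applies.
  Differentiability is required only along the orbits, so the lemma also serves for cut-off
  functions.\<close>

lemma sint_rotate_derivative:
  assumes a: "norm a = 1" and F: "adm F" and F': "adm F'"
    and D: "\<And>x. x \<noteq> 0 \<Longrightarrow> ((\<lambda>t. F (rotate_about a t x)) has_real_derivative F' x) (at 0)"
  shows "sint F' = 0"
proof -
  define h :: "nat \<Rightarrow> real" where "h n = inverse (real (Suc n))" for n
  have h: "h n > 0" for n by (simp add: h_def)
  define q where "q n x = (F (rotate_about a (h n) x) - F x) / h n" for n x
  have R: "orthogonal_transformation (rotate_about a t)" for t by (rule rotate_about_orthogonal[OF a])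
  have admq: "adm (q n)" for n
    unfolding q_def divide_inverse by (intro adm_mult[OF adm_diff[OF adm_orth[OF F R] F] adm_const])
  have q0: "sint (q n) = 0" for n
  proof -
    have "sint (q n) = inverse (h n) * sint (\<lambda>x. F (rotate_about a (h n) x) - F x)"
      unfolding q_def divide_inverse by (subst mult.commute) (rule sint_cmult)
    then show ?thesis using sint_diff[OF adm_orth[OF F R] F] sint_orth[OF F R] by simp
  qed
  obtain C where C: "\<And>x. \<bar>F' x\<bar> \<le> C" using F' by (auto simp: adm_def)
  have "(\<lambda>n. sint (q n)) \<longlonglongrightarrow> sint F'"
  proof (rule sint_dominated_convergence[OF admq F'])
    fix x :: "real^3" assume x: "x \<noteq> 0"
    have "((\<lambda>t. (F (rotate_about a t x) - F x) / t) \<longlongrightarrow> F' x) (at 0)"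
      using D[OF x] by (simp add: has_field_derivative_iff)
    moreover have "filterlim h (at 0) sequentially"
      unfolding h_def filterlim_at using LIMSEQ_inverse_real_of_nat by auto
    ultimately show "(\<lambda>n. q n x) \<longlonglongrightarrow> F' x"
      unfolding q_def by (rule filterlim_compose)
    show "\<bar>q n x\<bar> \<le> C" for n
    proof -
      have "\<exists>z>0. z < h n \<and> F (rotate_about a (h n) x) - F (rotate_about a 0 x) = (h n - 0) * F' (rotate_about a z x)"
        by (rule MVT2[OF h]) (rule rotate_derivative_everywhere[OF a x D])
      then show ?thesis using h[of n] C by (auto simp: q_def abs_mult)
    qed
  qed
  then have "(\<lambda>n. 0) \<longlonglongrightarrow> sint F'" using q0 by simp
  then show ?thesis by (simp add: LIMSEQ_const_iff)
qed

definition I :: "sph \<Rightarrow> real" where "I f = sint (ev f)"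

lemma I_X [simp]: "I (X a f) = 0"
proof (cases "a = 0")
  case False
  have "I (X (a /\<^sub>R norm a) f) = 0"
    unfolding I_def
    by (rule sint_rotate_derivative[of "a /\<^sub>R norm a" "ev f"]) (use False in \<open>auto intro: ev_rotate_derivative\<close>)
  then have "sint (\<lambda>x. inverse (norm a) * ev (X a f) x) = 0"
    by (simp add: I_def X_vec scaleR_sph.rep_eq)
  then show ?thesis using False by (simp add: sint_cmult I_def)
qed (simp add: X_vec I_def zero_sph.rep_eq sint_def)

lemma I_simps [simp]:
  "I (f + g) = I f + I g" "I (f - g) = I f - I g" "I (c *\<^sub>R f) = c * I f" "I (- f) = - I f" "I 0 = 0"
proof -
  have "ev (f + g) = (\<lambda>x. ev f x + ev g x)" "ev (f - g) = (\<lambda>x. ev f x - ev g x)"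
    "ev (c *\<^sub>R f) = (\<lambda>x. c * ev f x)" "ev (- f) = (\<lambda>x. - ev f x)" "ev 0 = (\<lambda>x. 0)"
    by auto
  then show "I (f + g) = I f + I g" "I (f - g) = I f - I g" "I (c *\<^sub>R f) = c * I f" "I (- f) = - I f" "I 0 = 0"
    using sint_cmult[of 0 "\<lambda>x. 0"] by (simp_all add: I_def sint_add sint_diff sint_cmult sint_minus)
qed

lemma I_sum: "I (\<Sum>i\<in>A. f i) = (\<Sum>i\<in>A. I (f i))"
  by (induction A rule: infinite_finite_induct) auto

lemma I_nonneg: "(\<And>x. x \<noteq> 0 \<Longrightarrow> 0 \<le> ev f x) \<Longrightarrow> 0 \<le> I f"
  unfolding I_def by (rule sint_nonneg)

lemma I_eq_0_imp: "(\<And>x. x \<noteq> 0 \<Longrightarrow> 0 \<le> ev f x) \<Longrightarrow> I f = 0 \<Longrightarrow> f = 0"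
  by (rule sph_eqI, simp, rule sint_zero_imp[of "ev f"]) (auto simp: I_def ev_continuous ev_scale)

lemma I_square_0: "I (f * f) = 0 \<Longrightarrow> f = 0"
proof -
  assume "I (f * f) = 0"
  then have "f * f = 0" by (intro I_eq_0_imp) auto
  then have "ev f x * ev f x = 0" for x by (metis ev_simps(2,6))
  then show "f = 0" by (intro sph_eqI) auto
qed

lemma I_by_parts: "I (f * X a g) = - I (X a f * g)"
  using I_X[of a "f * g"] unfolding X_simps I_simps by simp

lemma I_pull:
  assumes "orthogonal_transformation R"
  shows "I (pull R f) = I f"
proof -
  have "ev (pull R f) = (\<lambda>x. ev f (R x))" using ev_pull[OF assms] by auto
  then show ?thesis using sint_orth[OF adm_ev assms] by (simp add: I_def)
qed

section \<open>Polynomials and the spectral gap\<close>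

text \<open>\<open>Gam f g\<close> is the pointwise inner product of the tangential gradients.\<close>

definition Gam :: "sph \<Rightarrow> sph \<Rightarrow> sph" where
  "Gam f g = (\<Sum>i\<in>UNIV. X (axis i 1) f * X (axis i 1) g)"

lemma lap_simps [simp]:
  "lap (f + g) = lap f + lap g" "lap (c *\<^sub>R f) = c *\<^sub>R lap f" "lap 0 = 0" "lap 1 = 0"
  "lap (f - g) = lap f - lap g"
  by (simp_all add: lap_def sum.distrib scaleR_sum_right sum_subtractf)

lemma lap_sum: "lap (\<Sum>i\<in>A. f i) = (\<Sum>i\<in>A. lap (f i))"
  by (induction A rule: infinite_finite_induct) auto

lemma Gam_simps [simp]:
  "Gam f (g + h) = Gam f g + Gam f h" "Gam f (c *\<^sub>R g) = c *\<^sub>R Gam f g" "Gam f 0 = 0" "Gam f 1 = 0"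
  "Gam f (g * h) = Gam f g * h + g * Gam f h"
  by (simp_all add: Gam_def sum.distrib scaleR_sum_right sum_distrib_left sum_distrib_right algebra_simps)

lemma lap_mult: "lap (f * g) = lap f * g + f * lap g + 2 *\<^sub>R Gam f g"
  by (simp add: lap_def Gam_def sum.distrib scaleR_2 sum_distrib_left sum_distrib_right algebra_simps)

lemma frame_axis: "frame (axis 1 1) (axis 2 1) (axis 3 1)"
  using frameI[of "axis 1 1" "axis 2 1"] cross_basis(1) by (simp add: inner_axis_axis)

lemma lap_lin [simp]: "lap (lin v) = - 2 *\<^sub>R lin v"
proof -
  have d: "cross3 (cross3 v a) a = (a \<bullet> v) *\<^sub>R a - v" if "a \<bullet> a = 1" for a
    using Lagrange[of a v a] cross_skew[of "cross3 v a" a] that by simp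
  have "lap (lin v) = (lin ((axis 1 1 \<bullet> v) *\<^sub>R axis 1 1 - v) + lin ((axis 2 1 \<bullet> v) *\<^sub>R axis 2 1 - v))
      + lin ((axis 3 1 \<bullet> v) *\<^sub>R axis 3 1 - v)"
    unfolding lap_frame[OF frame_axis] by (simp add: d inner_axis_axis)
  also have "\<dots> = lin (((axis 1 1 \<bullet> v) *\<^sub>R axis 1 1 + (axis 2 1 \<bullet> v) *\<^sub>R axis 2 1 + (axis 3 1 \<bullet> v) *\<^sub>R axis 3 1) - 3 *\<^sub>R v)"
    unfolding lin_vec(1)[symmetric] by (rule arg_cong[of _ _ lin]) (simp add: vec_eq_iff)
  also have "\<dots> = lin (v - 3 *\<^sub>R v)"
    unfolding frame_expand[OF frame_axis, of v, symmetric] ..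
  also have "v - 3 *\<^sub>R v = - 2 *\<^sub>R v" by (simp add: algebra_simps flip: scaleR_left_diff_distrib)
  finally show ?thesis by (simp add: lin_vec)
qed

lemma Gam_lin: "Gam (lin v) (lin w) = (v \<bullet> w) *\<^sub>R 1 - lin v * lin w"
proof (rule sph_eqI)
  fix x assume x: "x \<in> S2"
  have x1: "norm x = 1" "x \<noteq> 0" "x \<bullet> x = 1" using x by (auto simp: norm_eq_1)
  have c: "ev (lin (cross3 u (axis i 1))) x = cross3 x u $ i" for u i
    using x1 by (simp add: ev_lin) (metis cross_triple inner_axis inner_commute inner_real_def mult_1)
  have "ev (Gam (lin v) (lin w)) x = cross3 x v \<bullet> cross3 x w"
    by (simp add: Gam_def ev_sum c inner_vec_def)
  also have "\<dots> = v \<bullet> w - (x \<bullet> v) * (x \<bullet> w)"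
    using dot_cross[of x v x w] x1 by (simp add: inner_commute)
  finally show "ev (Gam (lin v) (lin w)) x = ev ((v \<bullet> w) *\<^sub>R 1 - lin v * lin w) x"
    using x1 by (simp add: ev_lin ev_one inner_commute)
qed

lemma I_lap: "I (f * lap g) = - I (Gam f g)"
  by (simp add: lap_def Gam_def sum_distrib_left I_sum sum_negf I_by_parts)

lemma Gam_commute: "Gam f g = Gam g f"
  by (simp add: Gam_def mult.commute)

lemma I_lap_symmetric: "I (f * lap g) = I (lap f * g)"
  using I_lap[of f g] I_lap[of g f] Gam_commute[of f g] by (simp add: mult.commute)

text \<open>\<open>spoly n f\<close>: the function \<open>f\<close> is a polynomial of degree less than \<open>n\<close>.\<close>

inductive spoly :: "nat \<Rightarrow> sph \<Rightarrow> bool" where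
  zero: "spoly n 0"
| one: "spoly (Suc n) 1"
| add: "spoly n f \<Longrightarrow> spoly n g \<Longrightarrow> spoly n (f + g)"
| scale: "spoly n f \<Longrightarrow> spoly n (c *\<^sub>R f)"
| lin: "spoly n f \<Longrightarrow> spoly (Suc n) (lin v * f)"
| Suc: "spoly n f \<Longrightarrow> spoly (Suc n) f"

lemma spoly_diff: "spoly n f \<Longrightarrow> spoly n g \<Longrightarrow> spoly n (f - g)"
  using spoly.add[OF _ spoly.scale[of n g "-1"]] by fastforce

lemma spoly_sum: "(\<And>i. i \<in> A \<Longrightarrow> spoly n (f i)) \<Longrightarrow> spoly n (\<Sum>i\<in>A. f i)"
  by (induction A rule: infinite_finite_induct) (auto intro: spoly.zero spoly.add)

lemma spoly_mono: "spoly m f \<Longrightarrow> m \<le> n \<Longrightarrow> spoly n f"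
  by (induction n) (auto simp: le_Suc_eq intro: spoly.Suc)

lemma spoly_0: "spoly n f \<Longrightarrow> n = 0 \<Longrightarrow> f = 0"
  by (induction rule: spoly.induct) auto

lemma spoly_mult: "spoly n f \<Longrightarrow> spoly m g \<Longrightarrow> spoly (n + m) (f * g)"
proof (induction rule: spoly.induct)
  case (one n)
  then show ?case by (auto intro: spoly_mono)
qed (auto simp: distrib_right mult.assoc intro: spoly.intros)

text \<open>The top-degree part of a polynomial behaves like a homogeneous harmonic polynomial.\<close>

lemma spoly_lap:
  "spoly n f \<Longrightarrow> (\<forall>v. spoly n (Gam (lin v) f + (real n - 1) *\<^sub>R (lin v * f))) \<and>
     spoly (n - 1) (lap f + (real n * (real n - 1)) *\<^sub>R f)"
proof (induction rule: spoly.induct)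
  case (zero n)
  then show ?case by (simp add: spoly.zero)
next
  case (one n)
  then show ?case
    using spoly.lin[OF spoly.one] by (cases n) (auto simp: spoly.zero intro!: spoly.scale spoly.one)
next
  case (add n f g)
  have "Gam (lin v) (f + g) + (real n - 1) *\<^sub>R (lin v * (f + g)) =
      (Gam (lin v) f + (real n - 1) *\<^sub>R (lin v * f)) + (Gam (lin v) g + (real n - 1) *\<^sub>R (lin v * g))" for v
    by (simp add: distrib_left scaleR_add_right)
  moreover have "lap (f + g) + (real n * (real n - 1)) *\<^sub>R (f + g) =
      (lap f + (real n * (real n - 1)) *\<^sub>R f) + (lap g + (real n * (real n - 1)) *\<^sub>R g)"
    by (simp add: scaleR_add_right)
  ultimately show ?case using add.IH by (simp only: spoly.add simp_thms)
next
  case (scale n f c)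
  have "Gam (lin v) (c *\<^sub>R f) + (real n - 1) *\<^sub>R (lin v * (c *\<^sub>R f)) =
      c *\<^sub>R (Gam (lin v) f + (real n - 1) *\<^sub>R (lin v * f))" for v
    by (simp add: scaleR_add_right mult.commute)
  moreover have "lap (c *\<^sub>R f) + (real n * (real n - 1)) *\<^sub>R (c *\<^sub>R f) =
      c *\<^sub>R (lap f + (real n * (real n - 1)) *\<^sub>R f)"
    by (simp add: scaleR_add_right mult.commute)
  ultimately show ?case using scale.IH by (simp only: spoly.scale simp_thms)
next
  case (lin n f w)
  have "Gam (lin v) (lin w * f) + (real (Suc n) - 1) *\<^sub>R (lin v * (lin w * f)) =
      (v \<bullet> w) *\<^sub>R f + lin w * (Gam (lin v) f + (real n - 1) *\<^sub>R (lin v * f))" for v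
    by (simp add: Gam_lin algebra_simps)
  moreover have "spoly (Suc n) ((v \<bullet> w) *\<^sub>R f + lin w * (Gam (lin v) f + (real n - 1) *\<^sub>R (lin v * f)))" for v
    using lin by (auto intro: spoly.intros)
  moreover have "lap (lin w * f) + (real (Suc n) * (real (Suc n) - 1)) *\<^sub>R (lin w * f) =
      lin w * (lap f + (real n * (real n - 1)) *\<^sub>R f) + 2 *\<^sub>R (Gam (lin w) f + (real n - 1) *\<^sub>R (lin w * f))"
  proof -
    \<comment> \<open>The three summands come from the three terms of the product rule: 2 is the
      eigenvalue of \<open>lin w\<close>, n (n - 1) belongs to \<open>f\<close>, and 2 (n - 1) to
      the mixed term 2 \<open>Gam (lin w) f\<close>.\<close>
    have c: "real (Suc n) * (real (Suc n) - 1) = 2 + real n * (real n - 1) + 2 * (real n - 1)"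
      by (simp add: algebra_simps)
    show ?thesis
      unfolding lap_mult lap_lin c scaleR_add_left by (simp add: distrib_left scaleR_add_right)
  qed
  moreover have "spoly n (lin w * (lap f + (real n * (real n - 1)) *\<^sub>R f))"
  \<comment> \<open>Truncated subtraction: Suc (n - 1) is n only for positive n, and for n = 0 the
    function \<open>f\<close> is zero.\<close>
  proof (cases n)
    case 0
    then show ?thesis using spoly_0[OF lin.hyps] by (simp add: spoly.zero)
  next
    case (Suc m)
    then show ?thesis using lin.IH by (auto intro: spoly.lin)
  qed
  ultimately show ?case using lin.IH by (simp only: spoly.add spoly.scale diff_Suc_1 simp_thms)
next
  case (Suc n f)
  have "Gam (lin v) f + (real (Suc n) - 1) *\<^sub>R (lin v * f) =
      (Gam (lin v) f + (real n - 1) *\<^sub>R (lin v * f)) + lin v * f" for v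
    by (simp add: algebra_simps)
  moreover have "spoly (Suc n) ((Gam (lin v) f + (real n - 1) *\<^sub>R (lin v * f)) + lin v * f)" for v
    using Suc by (auto intro: spoly.intros)
  moreover have "lap f + (real (Suc n) * (real (Suc n) - 1)) *\<^sub>R f =
      (lap f + (real n * (real n - 1)) *\<^sub>R f) + (2 * real n) *\<^sub>R f"
    by (simp add: algebra_simps flip: scaleR_add_left)
  moreover have "spoly n ((lap f + (real n * (real n - 1)) *\<^sub>R f) + (2 * real n) *\<^sub>R f)"
    using Suc spoly_mono[of "n - 1" _ n] by (auto intro: spoly.intros)
  ultimately show ?case by (simp only: diff_Suc_1 simp_thms)
qed

text \<open>The operator \<open>lap\<close> + \<mu> n lowers the degree by \<open>spoly_lap\<close>.
  Its output is decomposed by induction, and dividing the component k by \<mu> n - \<mu> k inverts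
  the operator there; what remains of \<open>f\<close> is annihilated by it.\<close>

lemma spoly_eigen_decomposition:
  "spoly n f \<Longrightarrow> \<exists>h. f = (\<Sum>k<n. h k) \<and>
     (\<forall>k<n. spoly (Suc k) (h k) \<and> lap (h k) = (- (real k * (real k + 1))) *\<^sub>R h k)"
proof (induction n arbitrary: f)
  case 0
  then show ?case using spoly_0 by auto
next
  case (Suc n)
  define \<mu> where "\<mu> k = real k * (real k + 1)" for k :: nat
  have "spoly n (lap f + \<mu> n *\<^sub>R f)"
    using spoly_lap[OF Suc.prems] by (simp add: \<mu>_def add.commute mult.commute)
  from Suc.IH[OF this] obtain g where g: "lap f + \<mu> n *\<^sub>R f = (\<Sum>k<n. g k)"
    "\<And>k. k < n \<Longrightarrow> spoly (Suc k) (g k)" "\<And>k. k < n \<Longrightarrow> lap (g k) = (- \<mu> k) *\<^sub>R g k"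
    by (auto simp: \<mu>_def)
  have ne: "\<mu> n - \<mu> k \<noteq> 0" if "k < n" for k
  proof -
    have "\<mu> k < \<mu> n" unfolding \<mu>_def using that by (intro mult_strict_mono) auto
    then show ?thesis by simp
  qed
  define h' where "h' k = (1 / (\<mu> n - \<mu> k)) *\<^sub>R g k" for k
  define h where "h k = (if k < n then h' k else f - (\<Sum>k<n. h' k))" for k
  have lh': "lap (h' k) + \<mu> n *\<^sub>R h' k = g k" if "k < n" for k
  proof -
    let ?d = "1 / (\<mu> n - \<mu> k)"
    have "lap (h' k) + \<mu> n *\<^sub>R h' k = (?d * (- \<mu> k) + \<mu> n * ?d) *\<^sub>R g k"
      unfolding scaleR_add_left by (simp add: h'_def g(3)[OF that])
    also have "?d * (- \<mu> k) + \<mu> n * ?d = (\<mu> n - \<mu> k) * ?d"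
      unfolding left_diff_distrib by (simp only: mult_minus_right mult.commute[of ?d])
    also have "\<dots> = 1" using ne[OF that] by simp
    finally show ?thesis by simp
  qed
  have "lap (h n) + \<mu> n *\<^sub>R h n = (lap f + \<mu> n *\<^sub>R f) - (\<Sum>k<n. lap (h' k) + \<mu> n *\<^sub>R h' k)"
    by (simp add: h_def lap_sum scaleR_diff_right scaleR_sum_right sum.distrib)
  also have "\<dots> = 0" using lh' g(1) by simp
  finally have hn: "lap (h n) = (- \<mu> n) *\<^sub>R h n" by (simp add: eq_neg_iff_add_eq_0)
  have sh': "spoly (Suc k) (h' k)" if "k < n" for k
    using g(2)[OF that] by (simp add: h'_def spoly.scale)
  have "spoly (Suc n) (\<Sum>k<n. h' k)"
    by (intro spoly_sum spoly_mono[OF sh']) auto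
  then have "spoly (Suc n) (h n)" using Suc.prems by (simp add: h_def spoly_diff)
  moreover have "lap (h k) = (- \<mu> k) *\<^sub>R h k" "spoly (Suc k) (h k)" if "k < n" for k
    using g(3)[OF that] sh'[OF that] that by (simp_all add: h_def h'_def)
  ultimately have "spoly (Suc k) (h k) \<and> lap (h k) = (- \<mu> k) *\<^sub>R h k" if "k < Suc n" for k
    using hn that by (cases "k = n") simp_all
  moreover have "f = (\<Sum>k<Suc n. h k)" by (simp add: h_def)
  ultimately show ?case unfolding \<mu>_def by blast
qed

lemma eigen_orthogonal:
  assumes "lap f = a *\<^sub>R f" "lap g = b *\<^sub>R g" "a \<noteq> b"
  shows "I (f * g) = 0"
  using I_lap_symmetric[of f g] assms by simp

section \<open>Polynomial approximation and the gap at the eigenvalue 12\<close>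

lemma real_polynomial_function_spoly:
  assumes "real_polynomial_function p"
  shows "\<exists>n f. spoly n f \<and> (\<forall>x\<in>S2. ev f x = p x)"
  using assms
proof (induction rule: real_polynomial_function.induct)
  case (linear p)
  define v where "v = (\<Sum>b\<in>Basis. p b *\<^sub>R b)"
  have "p x = v \<bullet> x" for x
  proof -
    have "p x = p (\<Sum>b\<in>Basis. (x \<bullet> b) *\<^sub>R b)" by (simp add: euclidean_representation)
    also have "\<dots> = (\<Sum>b\<in>Basis. (x \<bullet> b) * p b)"
      using bounded_linear.linear[OF linear] by (simp add: linear_sum linear_scale)
    also have "\<dots> = (\<Sum>b\<in>Basis. p b * (b \<bullet> x))" by (simp add: inner_commute mult.commute)
    finally show ?thesis by (simp add: v_def inner_sum_left)
  qed
  moreover have "spoly 2 (lin v)"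
    using spoly.lin[OF spoly.one[of 0], of v] by (simp add: numeral_2_eq_2)
  ultimately show ?case by (intro exI[of _ 2] exI[of _ "lin v"]) (auto simp: ev_lin)
next
  case (const c)
  then show ?case
    by (intro exI[of _ 1] exI[of _ "c *\<^sub>R 1"]) (use S2_nonzero in \<open>auto simp: ev_one intro: spoly.intros\<close>)
next
  case (add p q)
  then obtain n f m g where "spoly n f" "\<forall>x\<in>S2. ev f x = p x" "spoly m g" "\<forall>x\<in>S2. ev g x = q x" by blast
  then show ?case
    by (intro exI[of _ "max n m"] exI[of _ "f + g"]) (auto intro!: spoly.add intro: spoly_mono[of n] spoly_mono[of m])
next
  case (mult p q)
  then obtain n f m g where "spoly n f" "\<forall>x\<in>S2. ev f x = p x" "spoly m g" "\<forall>x\<in>S2. ev g x = q x" by blast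
  then show ?case
    by (intro exI[of _ "n + m"] exI[of _ "f * g"]) (auto intro: spoly_mult)
qed

lemma spoly_dense:
  assumes w: "continuous_on (-{0}) w" and h: "\<And>t x. 0 < t \<Longrightarrow> w (t *\<^sub>R x) = w x" and e: "0 < e"
  shows "\<exists>n f. spoly n f \<and> (\<forall>x. x \<noteq> 0 \<longrightarrow> \<bar>w x - ev f x\<bar> < e)"
proof -
  have "continuous_on S2 w" using w by (rule continuous_on_subset) auto
  then obtain p where p: "real_polynomial_function p" "\<And>x. x \<in> S2 \<Longrightarrow> \<bar>w x - p x\<bar> < e"
    using Stone_Weierstrass_real_polynomial_function[OF compact_sphere _ e] by metis
  obtain n f where f: "spoly n f" "\<forall>x\<in>S2. ev f x = p x"
    using real_polynomial_function_spoly[OF p(1)] by blast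
  have "\<bar>w x - ev f x\<bar> < e" if "x \<noteq> 0" for x
    using p(2)[of "x /\<^sub>R norm x"] f(2) that h[of "inverse (norm x)" x] ev_scale[of "inverse (norm x)" f x] by simp
  then show ?thesis using f(1) by blast
qed

text \<open>A uniform polynomial approximation of \<open>w\<close> supplies finitely many
  eigenfunctions \<open>h k\<close>; F is the projection of \<open>w\<close> to their span. Bessel's
  inequality bounds the energy of F by that of \<open>w\<close>, while the mass of \<open>w\<close>
  exceeds that of F by at most the approximation error. Thus no infinite eigenfunction expansion is
  involved.\<close>

lemma spectral_gap:
  assumes w: "continuous_on (-{0}) w" and h: "\<And>t x. 0 < t \<Longrightarrow> w (t *\<^sub>R x) = w x"
    and wd: "\<And>i. adm (wd i)"
    and weak: "\<And>i f. sint (\<lambda>x. wd i x * ev f x) = - sint (\<lambda>x. w x * ev (X (axis i 1) f) x)"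
    and orth: "\<And>f. spoly 3 f \<Longrightarrow> sint (\<lambda>x. w x * ev f x) = 0"
  shows "12 * sint (\<lambda>x. (w x)\<^sup>2) \<le> sint (\<lambda>x. \<Sum>i\<in>UNIV. (wd i x)\<^sup>2)"
proof -
  have aw: "adm w" by (rule adm_punctured[OF w h])
  define W where "W = sint (\<lambda>x. \<Sum>i\<in>UNIV. (wd i x)\<^sup>2)"
  define N where "N = sint (\<lambda>x. (w x)\<^sup>2)"
  define vol where "vol = sint (\<lambda>x. 1)"
  have vol: "0 \<le> vol" unfolding vol_def by (rule sint_nonneg) simp
  define \<mu> where "\<mu> k = real k * (real k + 1)" for k :: nat
  have less: "\<mu> j < \<mu> k" if "j < k" for j k
    unfolding \<mu>_def using that by (intro mult_strict_mono) auto
  have main: "12 * N \<le> W + 12 * \<delta>\<^sup>2 * vol" if \<delta>: "0 < \<delta>" for \<delta>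
  proof -
    obtain n f where f: "spoly n f" "\<And>x. x \<noteq> 0 \<Longrightarrow> \<bar>w x - ev f x\<bar> < \<delta>"
      using spoly_dense[OF w h \<delta>] by blast
    obtain h where hf: "f = (\<Sum>k<n. h k)" "\<And>k. k < n \<Longrightarrow> spoly (Suc k) (h k)"
      "\<And>k. k < n \<Longrightarrow> lap (h k) = (- \<mu> k) *\<^sub>R h k"
      using spoly_eigen_decomposition[OF f(1)] unfolding \<mu>_def by blast
    define c where "c k = sint (\<lambda>x. w x * ev (h k) x)" for k
    define M where "M k = I (h k * h k)" for k
    \<comment> \<open>If \<open>M k\<close> = 0, division gives 0; then \<open>h k\<close> = 0 and
      \<open>c k\<close> = 0, so \<open>t k * M k = c k\<close> holds in this case too.\<close>
    define t where "t k = c k / M k" for k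
    have M0: "0 \<le> M k" for k unfolding M_def by (rule I_nonneg) simp
    have tM: "t k * M k = c k" for k
    proof (cases "M k = 0")
      case True
      then have "h k = 0" unfolding M_def by (rule I_square_0)
      then show ?thesis using True sint_cmult[of 0 "\<lambda>x. 0"] by (simp add: c_def)
    qed (simp add: t_def)
    have oh: "I (h j * h k) = (if j = k then M k else 0)" if "j < n" "k < n" for j k
    proof (cases "j = k")
      case False
      then have "\<mu> j \<noteq> \<mu> k"
        using less[of j k] less[of k j] by (cases j k rule: linorder_cases) auto
      then have "- \<mu> j \<noteq> - \<mu> k" by simp
      from eigen_orthogonal[OF hf(3)[OF that(1)] hf(3)[OF that(2)] this] show ?thesis using False by simp
    qed (simp add: M_def)
    define F where "F = (\<Sum>k<n. t k *\<^sub>R h k)"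
    have lapF: "lap F = (\<Sum>k<n. (- \<mu> k * t k) *\<^sub>R h k)"
      unfolding F_def lap_sum by (rule sum.cong) (simp_all add: hf(3))
    have evsum: "sint (\<lambda>x. w x * ev (\<Sum>k<n. s k *\<^sub>R h k) x) = (\<Sum>k<n. s k * c k)" for s
    proof -
      have "sint (\<lambda>x. w x * ev (\<Sum>k<n. s k *\<^sub>R h k) x) = sint (\<lambda>x. \<Sum>k<n. s k * (w x * ev (h k) x))"
        by (simp add: ev_sum sum_distrib_left mult_ac)
      also have "\<dots> = (\<Sum>k<n. sint (\<lambda>x. s k * (w x * ev (h k) x)))"
        by (rule sint_sum) (intro adm_mult adm_const aw adm_ev)
      finally show ?thesis by (simp add: sint_cmult c_def)
    qed
    have Isum: "I ((\<Sum>k<n. s k *\<^sub>R h k) * (\<Sum>k<n. r k *\<^sub>R h k)) = (\<Sum>k<n. s k * r k * M k)" for s r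
    proof -
      have "I ((\<Sum>k<n. s k *\<^sub>R h k) * (\<Sum>k<n. r k *\<^sub>R h k)) = (\<Sum>j<n. \<Sum>k<n. s j * r k * I (h j * h k))"
        by (simp add: sum_product I_sum mult.assoc mult.left_commute)
      also have "\<dots> = (\<Sum>j<n. \<Sum>k<n. if j = k then s k * r k * M k else 0)"
        by (intro sum.cong refl) (simp add: oh)
      finally show ?thesis by simp
    qed
    \<comment> \<open>Expand the integral of the squared distance between the weak gradient of
      \<open>w\<close> and the gradient of F: the cross term and the energy of F are the same sum,
      which appears with the factors -2 and 1.\<close>
    have 1: "(\<Sum>k<n. \<mu> k * (t k)\<^sup>2 * M k) \<le> W"
    proof -
      let ?X = "\<lambda>i. ev (X (axis i 1) F)"
      have "0 \<le> sint (\<lambda>x. \<Sum>i\<in>UNIV. (wd i x - ?X i x)\<^sup>2)"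
        by (rule sint_nonneg) (simp add: sum_nonneg)
      also have "\<dots> = (\<Sum>i\<in>UNIV. sint (\<lambda>x. (wd i x - ?X i x)\<^sup>2))"
        by (rule sint_sum) (intro adm_power2 adm_diff wd adm_ev)
      also have "\<dots> = (\<Sum>i\<in>UNIV. sint (\<lambda>x. (wd i x)\<^sup>2) - 2 * sint (\<lambda>x. wd i x * ?X i x) + I (X (axis i 1) F * X (axis i 1) F))"
      proof (rule sum.cong)
        fix i :: 3
        have "(\<lambda>x. (wd i x - ?X i x)\<^sup>2) = (\<lambda>x. ((wd i x)\<^sup>2 - 2 * (wd i x * ?X i x)) + ev (X (axis i 1) F * X (axis i 1) F) x)"
          by (simp add: fun_eq_iff power2_eq_square algebra_simps)
        moreover have "sint \<dots> = sint (\<lambda>x. (wd i x)\<^sup>2 - 2 * (wd i x * ?X i x)) + sint (ev (X (axis i 1) F * X (axis i 1) F))"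
          by (rule sint_add) (intro adm_diff adm_power2 adm_mult adm_const wd adm_ev)+
        moreover have "sint (\<lambda>x. (wd i x)\<^sup>2 - 2 * (wd i x * ?X i x)) = sint (\<lambda>x. (wd i x)\<^sup>2) - sint (\<lambda>x. 2 * (wd i x * ?X i x))"
          by (rule sint_diff) (intro adm_diff adm_power2 adm_mult adm_const wd adm_ev)+
        ultimately show "sint (\<lambda>x. (wd i x - ?X i x)\<^sup>2) = sint (\<lambda>x. (wd i x)\<^sup>2) - 2 * sint (\<lambda>x. wd i x * ?X i x) + I (X (axis i 1) F * X (axis i 1) F)"
          by (simp only: sint_cmult I_def)
      qed simp
      also have "\<dots> = W - 2 * (\<Sum>i\<in>UNIV. sint (\<lambda>x. wd i x * ?X i x)) + I (Gam F F)"
        unfolding W_def by (subst sint_sum) (auto intro: adm_power2 wd simp: sum.distrib sum_subtractf sum_distrib_left Gam_def I_sum)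
      also have "(\<Sum>i\<in>UNIV. sint (\<lambda>x. wd i x * ?X i x)) = - sint (\<lambda>x. w x * ev (lap F) x)"
      proof -
        have "sint (\<lambda>x. w x * ev (lap F) x) = sint (\<lambda>x. \<Sum>i\<in>UNIV. w x * ev (X (axis i 1) (X (axis i 1) F)) x)"
          by (simp add: lap_def ev_sum sum_distrib_left)
        also have "\<dots> = (\<Sum>i\<in>UNIV. sint (\<lambda>x. w x * ev (X (axis i 1) (X (axis i 1) F)) x))"
          by (rule sint_sum) (intro adm_mult aw adm_ev)
        finally show ?thesis by (simp add: weak sum_negf)
      qed
      also have "sint (\<lambda>x. w x * ev (lap F) x) = - (\<Sum>k<n. \<mu> k * (t k)\<^sup>2 * M k)"
        unfolding lapF evsum by (simp add: tM[symmetric] power2_eq_square sum_negf mult_ac)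
      also have "I (Gam F F) = (\<Sum>k<n. \<mu> k * (t k)\<^sup>2 * M k)"
      proof -
        have "I (F * lap F) = - (\<Sum>k<n. \<mu> k * (t k)\<^sup>2 * M k)"
          unfolding lapF unfolding F_def Isum by (simp add: power2_eq_square sum_negf mult_ac)
        then show ?thesis using I_lap[of F F] by simp
      qed
      finally show ?thesis by simp
    qed
    \<comment> \<open>The approximant \<open>f\<close> has coefficients 1 where F has the optimal
      \<open>t k\<close>; the difference between them is the nonnegative sum of
      \<open>(t k - 1)\<^sup>2 * M k\<close>.\<close>
    have 2: "N \<le> \<delta>\<^sup>2 * vol + (\<Sum>k<n. (t k)\<^sup>2 * M k)"
    proof -
      have f1: "f = (\<Sum>k<n. 1 *\<^sub>R h k)" using hf(1) by simp
      have "sint (\<lambda>x. (w x - ev f x)\<^sup>2) \<le> sint (\<lambda>x. \<delta>\<^sup>2 * 1)"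
      proof (rule sint_mono)
        show "adm (\<lambda>x. (w x - ev f x)\<^sup>2)" by (intro adm_power2 adm_diff aw adm_ev)
        fix x :: "real^3" assume "x \<noteq> 0"
        then have "\<bar>w x - ev f x\<bar>\<^sup>2 \<le> \<delta>\<^sup>2" using f(2) by (intro power_mono) (auto intro: less_imp_le)
        then show "(w x - ev f x)\<^sup>2 \<le> \<delta>\<^sup>2 * 1" by simp
      qed simp
      also have "\<dots> = \<delta>\<^sup>2 * vol" unfolding sint_cmult vol_def ..
      also have "sint (\<lambda>x. (w x - ev f x)\<^sup>2) = N - 2 * sint (\<lambda>x. w x * ev f x) + I (f * f)"
      proof -
        have "(\<lambda>x. (w x - ev f x)\<^sup>2) = (\<lambda>x. ((w x)\<^sup>2 - 2 * (w x * ev f x)) + ev (f * f) x)"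
          by (simp add: fun_eq_iff power2_eq_square algebra_simps)
        moreover have "sint \<dots> = sint (\<lambda>x. (w x)\<^sup>2 - 2 * (w x * ev f x)) + sint (ev (f * f))"
          by (rule sint_add) (intro adm_diff adm_power2 adm_mult adm_const aw adm_ev)+
        moreover have "sint (\<lambda>x. (w x)\<^sup>2 - 2 * (w x * ev f x)) = N - sint (\<lambda>x. 2 * (w x * ev f x))"
          unfolding N_def by (rule sint_diff) (intro adm_diff adm_power2 adm_mult adm_const aw adm_ev)+
        ultimately show ?thesis by (simp only: sint_cmult I_def)
      qed
      also have "sint (\<lambda>x. w x * ev f x) = (\<Sum>k<n. 1 * c k)" unfolding f1 by (rule evsum)
      also have "I (f * f) = (\<Sum>k<n. 1 * 1 * M k)" unfolding f1 by (rule Isum)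
      finally have "N \<le> \<delta>\<^sup>2 * vol + (\<Sum>k<n. 2 * (t k * M k) - M k)"
        by (simp add: tM sum_subtractf sum_distrib_left)
      also have "\<dots> \<le> \<delta>\<^sup>2 * vol + (\<Sum>k<n. (t k)\<^sup>2 * M k)"
      proof (intro add_left_mono sum_mono)
        fix k
        have "0 \<le> (t k - 1)\<^sup>2 * M k" using M0 by simp
        then show "2 * (t k * M k) - M k \<le> (t k)\<^sup>2 * M k" by (simp add: power2_eq_square algebra_simps)
      qed
      finally show ?thesis .
    qed
    have 3: "12 * (\<Sum>k<n. (t k)\<^sup>2 * M k) \<le> (\<Sum>k<n. \<mu> k * (t k)\<^sup>2 * M k)"
      unfolding sum_distrib_left
    proof (rule sum_mono)
      fix k assume "k \<in> {..<n}"
      then have k: "k < n" by simp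
      show "12 * ((t k)\<^sup>2 * M k) \<le> \<mu> k * (t k)\<^sup>2 * M k"
      proof (cases "k < 3")
        case True
        then have "c k = 0" unfolding c_def by (intro orth spoly_mono[OF hf(2)[OF k]]) simp
        then have "(t k)\<^sup>2 * M k = 0" using tM[of k] by (auto simp: power2_eq_square)
        then show ?thesis by (metis mult.assoc mult_zero_right order_refl)
      next
        case False
        then have "3 * (3 + 1) \<le> \<mu> k" unfolding \<mu>_def by (intro mult_mono) auto
        then have "12 * ((t k)\<^sup>2 * M k) \<le> \<mu> k * ((t k)\<^sup>2 * M k)" using M0 by (intro mult_right_mono) auto
        then show ?thesis by (simp only: mult.assoc)
      qed
    qed
    show ?thesis using 1 2 3 by (simp add: algebra_simps)
  qed
  have "12 * N \<le> W + e" if e: "0 < e" for e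
  proof -
    \<comment> \<open>Chosen so that the error 12 \<delta>^2 vol is at most e; the summand 1 guards
      the division, since only 0 <= vol is at hand.\<close>
    define \<delta> where "\<delta> = sqrt (e / (12 * (vol + 1)))"
    have "0 < \<delta>" "\<delta>\<^sup>2 = e / (12 * (vol + 1))" using e vol by (auto simp: \<delta>_def)
    then have "12 * N \<le> W + 12 * (e / (12 * (vol + 1))) * vol" using main by metis
    also have "12 * (e / (12 * (vol + 1))) * vol \<le> e" using e vol by (simp add: field_simps)
    finally show ?thesis by simp
  qed
  then have "12 * N \<le> W" by (rule field_le_epsilon)
  then show ?thesis by (simp add: N_def W_def)
qed

section \<open>Kazdan--Warner identity and reflections\<close>

lemma Gam_frame:
  assumes "frame a b c"
  shows "Gam f g = X a f * X a g + X b f * X b g + X c f * X c g"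
proof -
  have "2 *\<^sub>R Gam f g = lap (f * g) - lap f * g - f * lap g" by (simp add: lap_mult)
  also have "\<dots> = 2 *\<^sub>R (X a f * X a g + X b f * X b g + X c f * X c g)"
    unfolding lap_frame[OF assms] by (simp add: scaleR_2 algebra_simps)
  finally show ?thesis by simp
qed

lemma frame_X_commute:
  assumes "frame a b c"
  shows "X b (X a f) = X a (X b f) + X c f" "X c (X b f) = X b (X c f) + X a f" "X a (X c f) = X c (X a f) + X b f"
  using X_commute[of a b f] X_commute[of b c f] X_commute[of c a f] assms
  by (auto simp: frame_def algebra_simps)

lemma frame_cross:
  assumes "frame a b c"
  shows "cross3 a b = c" "cross3 b c = a" "cross3 c a = b" "cross3 b a = - c" "cross3 c b = - a" "cross3 a c = - b"
  using assms cross_skew[of b a] cross_skew[of c b] cross_skew[of a c] by (auto simp: frame_def)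

text \<open>The Casimir operator is central: the mixed terms produced by the commutation rules
  cancel in pairs.\<close>

lemma lap_X: "lap (X v f) = X v (lap f)"
proof (cases "v = 0")
  case False
  define a where "a = v /\<^sub>R norm v"
  have v: "v = norm v *\<^sub>R a" using False by (simp add: a_def)
  have "norm a = 1" using False by (simp add: a_def)
  then obtain b c where fr: "frame a b c" using frame_exists by blast
  note co = frame_X_commute[OF fr]
  have co': "X c (X a g) = X a (X c g) - X b g" for g using co(3)[of g] by simp
  have "lap (X a f) = X a (lap f)"
    unfolding lap_frame[OF fr]
    by (simp add: co(1) co')
  then show ?thesis by (subst (1 2) v) (simp add: X_vec)
qed (simp add: X_vec)

lemma I_lin: "I (lin c) = 0"
proof -
  have "I (lap (lin c)) = 0" using I_lap[of 1 "lin c"] Gam_commute[of 1] by simp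
  then show ?thesis by simp
qed

lemma I_lap_0: "I (lap f) = 0"
  using I_lap[of 1 f] Gam_commute[of 1] by simp

lemma lap_lin_square: "norm v = 1 \<Longrightarrow> lap (lin v * lin v) = 2 *\<^sub>R 1 - 6 *\<^sub>R (lin v * lin v)"
proof -
  assume "norm v = 1"
  moreover have "6 *\<^sub>R L = 2 *\<^sub>R L + 2 *\<^sub>R L + 2 *\<^sub>R L" for L :: sph
    by (simp flip: scaleR_add_left)
  ultimately show ?thesis
    by (simp add: lap_mult Gam_lin norm_eq_1 scaleR_diff_right)
qed

text \<open>The reason is that the flow of the conformal field \<open>\<nabla>(c \<bullet> x)\<close> preserves the Dirichlet energy.\<close>

lemma I_lap_Gam_lin:
  assumes "norm c = 1"
  shows "I (lap f * Gam (lin c) f) = 0"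
proof -
  obtain a b where "frame c a b" using frame_exists[OF assms] by blast
  then have fr: "frame a b c" by (rule frame_cycle)
  note co = frame_X_commute[OF fr]
  define A B C p q r where d: "A = lin a" "B = lin b" "C = lin c" "p = X a f" "q = X b f" "r = X c f"
  have XA: "X a A = 0" "X b A = C" "X c A = - B" "X a B = - C" "X b B = 0" "X c B = A" "X a C = B" "X b C = - A" "X c C = 0"
    unfolding d X_simps frame_cross[OF fr] cross_refl lin_vec by simp_all
  have rad: "A * p + B * q = - (C * r)"
    using X_radial[OF fr, of f] by (simp add: d eq_neg_iff_add_eq_0)
  define Y where "Y = B * p - A * q"
  have Y: "Gam (lin c) f = Y"
    unfolding Gam_frame[OF fr] d(3)[symmetric] XA Y_def d(4-6) by simp
  define S where "S = p * p + q * q + r * r"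
  have cm: "X b p = X a q + r" "X c p = X a r - q" "X c q = X b r + p"
    using co[of f] by (auto simp: d)
  have XS: "X a S = 2 *\<^sub>R (p * X a p + q * X a q + r * X a r)" "X b S = 2 *\<^sub>R (p * X b p + q * X b q + r * X b r)"
    by (simp_all add: S_def scaleR_2 algebra_simps)
  have "p * X a Y + q * X b Y + r * X c Y =
      (1/2) *\<^sub>R (B * X a S) - (1/2) *\<^sub>R (A * X b S) - C * (p * p + q * q) + r * (A * p + B * q)"
    unfolding Y_def X_diff X_simps(2) XA XS by (simp add: cm algebra_simps)
  also have "\<dots> = (1/2) *\<^sub>R (B * X a S) - (1/2) *\<^sub>R (A * X b S) - C * S"
    unfolding rad S_def by (simp add: algebra_simps)
  finally have "I (p * X a Y + q * X b Y + r * X c Y) = (1/2) * I (B * X a S) - (1/2) * I (A * X b S) - I (C * S)"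
    by (simp only: I_simps)
  \<comment> \<open>Since X a B = - C and X b A = C, integration by parts turns each of the first
    two terms into half of I (C * S), and the third subtracts it.\<close>
  also have "\<dots> = 0" by (simp add: I_by_parts XA)
  finally have "I (Gam f Y) = 0" unfolding Gam_frame[OF fr] d(4-6) .
  then have "I (Y * lap f) = 0" using I_lap[of Y f] Gam_commute[of Y f] by simp
  then show ?thesis unfolding Y by (simp only: mult.commute)
qed

locale mean_field =
  fixes u :: sph and lam :: real
  assumes eq: "lap u = lam *\<^sub>R (1 - ex u)" and lam: "2 < lam"
begin

lemma I_ex: "I (ex u) = I 1"
  using I_lap_0[of u] lam by (simp add: eq)

lemma Gam_ex: "Gam f (ex u) = ex u * Gam f u"
  by (simp add: Gam_def sum_distrib_left mult_ac)

lemma lap_X_u: "lap (X v u) = - (lam *\<^sub>R (ex u * X v u))"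
  by (simp add: lap_X eq)

text \<open>Two relations between the moments of u and \<open>ex u\<close>: testing the equation
  with the eigenfunction C gives 2 I (C u) = lam I (C ex u), and the conformal identity
  \<open>I_lap_Gam_lin\<close> gives 2 I (C u) = 2 I (C ex u). As lam is not 2, both moments
  vanish.\<close>

lemma kazdan_warner:
  assumes c: "norm c = 1"
  shows "I (lin c * ex u) = 0" and "I (lin c * u) = 0"
proof -
  let ?C = "lin c"
  have g: "I (Gam ?C f) = 2 * I (?C * f)" for f
    using I_lap[of f ?C] by (simp add: Gam_commute mult.commute)
  have "I (?C * lap u) = - 2 * I (?C * u)"
    unfolding I_lap_symmetric by simp
  then have 1: "2 * I (?C * u) = lam * I (?C * ex u)"
    by (simp add: eq right_diff_distrib I_lin)
  have "I (lap u * Gam ?C u) = 0" by (rule I_lap_Gam_lin[OF c])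
  then have "I (Gam ?C u) = I (Gam ?C (ex u))"
    using lam by (simp add: eq left_diff_distrib Gam_ex)
  then have "lam * I (?C * ex u) = 2 * I (?C * ex u)" using 1 g by simp
  then show e: "I (?C * ex u) = 0" using lam by (simp flip: left_diff_distrib) 
  show "I (?C * u) = 0" using 1 e by simp
qed

lemma I_lin_u: "I (lin v * u) = 0"
proof (cases "v = 0")
  case False
  then have "I (lin (v /\<^sub>R norm v) * u) = 0" by (intro kazdan_warner) simp
  then show ?thesis using False by (simp add: lin_vec)
qed (simp add: lin_vec)

end

section \<open>Diagonalisation of a quadratic form in space\<close>

lemma quadratic_max_orthogonal:
  fixes q :: "real^3 \<Rightarrow> real^3 \<Rightarrow> real"
  assumes add: "\<And>x y z. q (x + y) z = q x z + q y z" and sc: "\<And>r x z. q (r *\<^sub>R x) z = r * q x z"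
    and sym: "\<And>x y. q x y = q y x"
    and cv: "norm c = 1" "norm v = 1" "c \<bullet> v = 0"
    and max: "\<And>t. q (c + t *\<^sub>R v) (c + t *\<^sub>R v) \<le> q c c * (norm (c + t *\<^sub>R v))\<^sup>2"
  shows "q c v = 0"
proof -
  have n: "(norm (c + t *\<^sub>R v))\<^sup>2 = 1 + t * t" for t
    using cv by (simp add: power2_norm_eq_inner norm_eq_1 inner_add_left inner_add_right inner_commute)
  have e: "q (c + t *\<^sub>R v) (c + t *\<^sub>R v) = q c c + 2 * t * q c v + t * t * q v v" for t
  proof -
    have "q x (c + t *\<^sub>R v) = q c x + t * q v x" for x
      unfolding sym[of x] by (simp only: add sc)
    then show ?thesis by (simp add: add sc sym[of v c] algebra_simps)
  qed
  have ineq: "2 * t * q c v \<le> t * t * (q c c - q v v)" for t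
    using max[of t] by (simp add: n e algebra_simps)
  \<comment> \<open>K exceeds the second-order coefficient, so at t = q c v / K the first-order term
    2 t q c v is at most t q c v, which forces q c v = 0.\<close>
  define K where "K = \<bar>q c c - q v v\<bar> + 1"
  have K: "0 < K" "q c c - q v v < K" by (auto simp: K_def)
  have "2 * (q c v / K) * q c v \<le> (q c v / K) * (q c v / K) * (q c c - q v v)" by (rule ineq)
  also have "\<dots> \<le> (q c v / K) * (q c v / K) * K" using K by (intro mult_left_mono) auto
  also have "\<dots> = (q c v / K) * q c v" using K by simp
  finally have "(q c v / K) * q c v \<le> 0" by simp
  then have "q c v * q c v \<le> 0" using K by (simp add: divide_le_0_iff)
  then show ?thesis by (auto simp: mult_le_0_iff)
qed

text \<open>Maximise the form on the sphere, then on the great circle orthogonal to the maximiser;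
  the cross product completes the frame, and maximality kills the mixed terms.\<close>

lemma quadratic_eigenframe:
  fixes q :: "real^3 \<Rightarrow> real^3 \<Rightarrow> real"
  assumes add: "\<And>x y z. q (x + y) z = q x z + q y z" and sc: "\<And>r x z. q (r *\<^sub>R x) z = r * q x z"
    and sym: "\<And>x y. q x y = q y x"
  shows "\<exists>a b c. frame a b c \<and> q a b = 0 \<and> q b c = 0 \<and> q c a = 0"
proof -
  have sc2: "q (r *\<^sub>R x) (r *\<^sub>R x) = r\<^sup>2 * q x x" for r x
    using sc[of r x "r *\<^sub>R x"] sc[of r x x] sym[of x "r *\<^sub>R x"] by (simp add: power2_eq_square)
  have cont: "continuous_on S (\<lambda>x. q x x)" for S
  proof -
    have q0: "q 0 z = 0" for z using sc[of 0 0 z] by simp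
    have qs: "q (\<Sum>i\<in>A. g i) z = (\<Sum>i\<in>A. q (g i) z)" for g z and A :: "(real^3) set"
      by (induction A rule: infinite_finite_induct) (auto simp: add q0)
    have ex: "q x z = (\<Sum>i\<in>Basis. (x \<bullet> i) * q i z)" for x z
    proof -
      have "q (\<Sum>i\<in>Basis. (x \<bullet> i) *\<^sub>R i) z = (\<Sum>i\<in>Basis. (x \<bullet> i) * q i z)" by (simp only: qs sc)
      then show ?thesis by (simp only: euclidean_representation)
    qed
    have "q x x = (\<Sum>i\<in>Basis. (x \<bullet> i) * (\<Sum>j\<in>Basis. (x \<bullet> j) * q j i))" for x
      unfolding ex[of x x] by (rule sum.cong) (simp_all add: sym[of _ x] ex[of x _, symmetric])
    then show ?thesis by (simp add: continuous_intros)
  qed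
  have "\<exists>c\<in>S2. \<forall>y\<in>S2. q y y \<le> q c c"
    by (rule continuous_attains_sup) (use vector_choose_size[of 1, where 'a="real^3"] in \<open>auto simp: cont\<close>)
  then obtain c where c: "norm c = 1" "\<And>y. norm y = 1 \<Longrightarrow> q y y \<le> q c c" by auto
  have cmax: "q y y \<le> q c c * (norm y)\<^sup>2" if "y \<noteq> 0" for y
  proof -
    have "q y y = (norm y)\<^sup>2 * q (y /\<^sub>R norm y) (y /\<^sub>R norm y)"
      using sc2[of "norm y" "y /\<^sub>R norm y"] that by simp
    also have "\<dots> \<le> (norm y)\<^sup>2 * q c c" by (intro mult_left_mono c) (use that in auto)
    finally show ?thesis by (simp add: mult.commute)
  qed
  have nz: "v + t *\<^sub>R w \<noteq> 0" if "norm v = 1" "v \<bullet> w = 0" for v w :: "real^3" and t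
  proof
    assume "v + t *\<^sub>R w = 0"
    then have "v \<bullet> (v + t *\<^sub>R w) = 0" by simp
    then show False using that by (simp add: inner_add_right norm_eq_1)
  qed
  have qc: "q c v = 0" if "norm v = 1" "c \<bullet> v = 0" for v
    by (rule quadratic_max_orthogonal[of q, OF add sc sym c(1) that]) (rule cmax[OF nz[OF c(1) that(2)]])
  let ?K = "S2 \<inter> {y. c \<bullet> y = 0}"
  obtain b0 c0 where "frame c b0 c0" using frame_exists[OF c(1)] by blast
  then have "b0 \<in> ?K" by (auto simp: frame_def norm_eq_1)
  moreover have "compact ?K" by (intro compact_Int_closed closed_hyperplane) auto
  ultimately have "\<exists>a\<in>?K. \<forall>y\<in>?K. q y y \<le> q a a"
    by (intro continuous_attains_sup) (auto simp: cont)
  then obtain a where a: "norm a = 1" "c \<bullet> a = 0" "\<And>y. norm y = 1 \<Longrightarrow> c \<bullet> y = 0 \<Longrightarrow> q y y \<le> q a a" by auto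
  define b where "b = cross3 c a"
  have fr: "frame c a b" unfolding b_def by (rule frameI) (use a c in auto)
  have b: "norm b = 1" "c \<bullet> b = 0" "a \<bullet> b = 0" using fr by (auto simp: frame_def norm_eq_1 inner_commute)
  have amax: "q y y \<le> q a a * (norm y)\<^sup>2" if "y \<noteq> 0" "c \<bullet> y = 0" for y
  proof -
    have "q y y = (norm y)\<^sup>2 * q (y /\<^sub>R norm y) (y /\<^sub>R norm y)"
      using sc2[of "norm y" "y /\<^sub>R norm y"] that by simp
    also have "\<dots> \<le> (norm y)\<^sup>2 * q a a" by (intro mult_left_mono a) (use that in auto)
    finally show ?thesis by (simp add: mult.commute)
  qed
  have "q a b = 0"
    by (rule quadratic_max_orthogonal[of q, OF add sc sym a(1) b(1,3)])
      (rule amax[OF nz[OF a(1) b(3)]], use a b in \<open>simp add: inner_add_right\<close>)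
  then show ?thesis using frame_cycle[OF fr] qc[OF b(1,2)] qc[OF a(1,2)] sym by metis
qed

text \<open>The induction builds a polynomial by prefixing linear factors, so the claim has to carry
  up to two factors in front of polynomials of correspondingly lower degree.\<close>

lemma spoly_3_functional:
  fixes L :: "sph \<Rightarrow> real"
  assumes add: "\<And>f g. L (f + g) = L f + L g" and sc: "\<And>c f. L (c *\<^sub>R f) = c * L f"
    and 1: "L 1 = 0" and 2: "\<And>v. L (lin v) = 0" and 3: "\<And>v w. L (lin v * lin w) = 0"
  shows "spoly n f \<Longrightarrow> (n \<le> 3 \<longrightarrow> L f = 0) \<and> (n \<le> 2 \<longrightarrow> (\<forall>v. L (lin v * f) = 0)) \<and>
    (n \<le> 1 \<longrightarrow> (\<forall>v w. L (lin v * (lin w * f)) = 0))"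
proof (induction rule: spoly.induct)
  case (zero n)
  have "L 0 = 0" using sc[of 0 0] by simp
  then show ?case by simp
next
  case (lin n f v)
  have "L 0 = 0" using sc[of 0 0] by simp
  then show ?case using lin.IH spoly_0[OF lin.hyps] by (cases n) auto
qed (auto simp: add sc 1 2 3 distrib_left)

lemma spoly_3_orthogonal:
  fixes L :: "sph \<Rightarrow> real"
  assumes add: "\<And>f g. L (f + g) = L f + L g" and sc: "\<And>c f. L (c *\<^sub>R f) = c * L f"
    and fr: "frame a b c"
    and L: "L 1 = 0" "L (lin a) = 0" "L (lin b) = 0" "L (lin c) = 0"
      "L (lin a * lin a) = 0" "L (lin b * lin b) = 0" "L (lin c * lin c) = 0"
      "L (lin a * lin b) = 0" "L (lin b * lin c) = 0" "L (lin c * lin a) = 0"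
    and f: "spoly 3 f"
  shows "L f = 0"
proof -
  have e: "lin v = (a \<bullet> v) *\<^sub>R lin a + (b \<bullet> v) *\<^sub>R lin b + (c \<bullet> v) *\<^sub>R lin c" for v
    by (subst frame_expand[OF fr, of v]) (simp add: lin_vec)
  have L': "L (lin b * lin a) = 0" "L (lin c * lin b) = 0" "L (lin a * lin c) = 0"
    using L by (simp_all add: mult.commute)
  have "L (lin v) = 0" for v by (subst e) (simp add: add sc L)
  moreover have "L (lin v * lin w) = 0" for v w
    by (subst e[of v], subst e[of w]) (simp add: add sc L L' distrib_left distrib_right)
  ultimately show ?thesis using spoly_3_functional[of L, OF add sc L(1) _ _ f] by simp
qed

lemma sint_odd:
  assumes "adm F" "orthogonal_transformation R" "\<And>x. F (R x) = - F x"
  shows "sint F = 0"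
  using sint_orth[OF assms(1,2)] assms(3) by (simp add: sint_minus)

lemma pull_lin_mirror:
  assumes "v \<bullet> v = 1"
  shows "pull (mirror v) (lin v) = - lin v" "w \<bullet> v = 0 \<Longrightarrow> pull (mirror v) (lin w) = lin w"
    "pull (mirror v) 1 = 1"
proof -
  note R = mirror_orthogonal[OF assms]
  have n: "norm (mirror v x) = norm x" for x by (rule orthogonal_transformation_norm[OF R])
  have R0: "mirror v x \<noteq> 0" if "x \<noteq> 0" for x using n[of x] that by (metis norm_eq_zero)
  show "pull (mirror v) (lin v) = - lin v"
    by (rule sph_eqI) (simp add: ev_pull[OF R] ev_lin n, simp add: mirror_def inner_diff_right assms)
  show "pull (mirror v) (lin w) = lin w" if "w \<bullet> v = 0"
    by (rule sph_eqI) (simp add: ev_pull[OF R] ev_lin n, simp add: mirror_def inner_diff_right that)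
  show "pull (mirror v) 1 = 1"
    by (rule sph_eqI, drule S2_nonzero) (simp add: ev_pull[OF R] ev_one R0)
qed

text \<open>Squaring the weak inequality at y / 2 leaves the extra term y^2 / 4.\<close>

lemma exp_gt_add_one:
  fixes y :: real
  assumes "y \<noteq> 0"
  shows "1 + y < exp y"
proof (cases "0 \<le> 1 + y / 2")
  case True
  have "(1 + y / 2)\<^sup>2 \<le> (exp (y / 2))\<^sup>2"
    using True exp_ge_add_one_self[of "y / 2"] by (rule_tac power_mono) auto
  also have "\<dots> = exp y" by (simp add: power2_eq_square flip: exp_add)
  finally show ?thesis using assms by (simp add: power2_eq_square field_simps) (smt (verit) zero_less_mult_iff)
next
  case False
  then have "1 + y < 0" by linarith
  then show ?thesis by (meson exp_gt_zero less_trans)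
qed

lemma pull_scaleR: "pull R (c *\<^sub>R f) = c *\<^sub>R pull R f"
  by (rule sph_eqI) (simp add: pull.rep_eq)

locale bounded_mean_field = mean_field +
  assumes bound: "\<And>x. x \<noteq> 0 \<Longrightarrow> lam * exp (ev u x) \<le> 12"
begin

text \<open>By strict convexity a chord of exp has slope strictly below that at its larger endpoint,
  which is at most 12 / lam. Strictness is what settles the equality case.\<close>

lemma exp_diff_bound:
  fixes p q :: real
  assumes "lam * exp p \<le> 12" "lam * exp q \<le> 12"
  shows "lam * (exp p - exp q) * (p - q) \<le> 12 * (p - q)\<^sup>2"
    and "lam * (exp p - exp q) * (p - q) = 12 * (p - q)\<^sup>2 \<Longrightarrow> p = q"
proof -
  have less: "lam * (exp p - exp q) * (p - q) < 12 * (p - q)\<^sup>2" if "lam * exp p \<le> 12" "q < p" for p q :: real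
  proof -
    have "1 + (q - p) < exp (q - p)" using that(2) by (intro exp_gt_add_one) simp
    then have "exp p * (1 - exp (q - p)) < exp p * (p - q)" by simp
    then have "exp p - exp q < exp p * (p - q)" by (simp add: right_diff_distrib flip: exp_add)
    then have "lam * ((exp p - exp q) * (p - q)) < lam * ((exp p * (p - q)) * (p - q))"
      using lam that by (intro mult_strict_left_mono mult_strict_right_mono) auto
    also have "\<dots> = (lam * exp p) * (p - q)\<^sup>2" by (simp add: power2_eq_square)
    also have "\<dots> \<le> 12 * (p - q)\<^sup>2" using that by (intro mult_right_mono) auto
    finally show ?thesis by (simp add: mult.assoc)
  qed
  have sw: "lam * (exp p - exp q) * (p - q) = lam * (exp q - exp p) * (q - p)" "(p - q)\<^sup>2 = (q - p)\<^sup>2"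
    by (simp_all add: power2_commute algebra_simps)
  have lt: "lam * (exp p - exp q) * (p - q) < 12 * (p - q)\<^sup>2" if "p \<noteq> q"
  proof (cases "p < q")
    case True
    then show ?thesis unfolding sw by (rule less[OF assms(2)])
  next
    case False
    then show ?thesis using less[OF assms(1), of q] that by simp
  qed
  show "lam * (exp p - exp q) * (p - q) \<le> 12 * (p - q)\<^sup>2"
    using lt by (cases "p = q") auto
  show "p = q" if "lam * (exp p - exp q) * (p - q) = 12 * (p - q)\<^sup>2"
    using lt that by (cases "p = q") auto
qed

text \<open>Among the frame polynomials of degree at most two only \<open>lin c\<close>,
  \<open>lin b * lin c\<close> and \<open>lin c * lin a\<close> are odd in \<open>c\<close>.
  Kazdan--Warner handles the first, the choice of the eigenframe the other two. The gap inequality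
  for the odd difference is then opposite to \<open>exp_diff_bound\<close>.\<close>

lemma reflection_symmetric:
  assumes fr: "frame a b c" and q: "I (lin b * lin c * u) = 0" "I (lin c * lin a * u) = 0"
  shows "pull (mirror c) u = u"
proof -
  have cc: "c \<bullet> c = 1" and ac: "a \<bullet> c = 0" "b \<bullet> c = 0" using fr by (auto simp: frame_def inner_commute)
  note R = mirror_orthogonal[OF cc]
  let ?P = "pull (mirror c)"
  have Pinv: "?P (?P f) = f" for f
    by (rule sph_eqI) (simp add: ev_pull[OF R], simp add: mirror_def inner_diff_right cc algebra_simps)
  define w where "w = u - ?P u"
  have Pw: "?P w = - w" by (simp add: w_def pull_diff Pinv)
  have pl: "?P (lin a) = lin a" "?P (lin b) = lin b" "?P (lin c) = - lin c" "?P 1 = 1"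
    using pull_lin_mirror[OF cc] ac by auto
  have even: "I (w * f) = 0" if "?P f = f" for f
    using I_pull[OF R, of "w * f"] that by (simp add: pull_mult Pw)
  have odd: "I (w * f) = 0" if "?P f = - f" "I (f * u) = 0" for f
  proof -
    have "I (?P u * f) = - I (u * f)"
      using I_pull[OF R, of "u * f"] that(1) by (simp add: pull_mult)
    then show ?thesis using that(2) by (simp add: w_def left_diff_distrib mult.commute[of f])
  qed
  have orth: "I (w * f) = 0" if "spoly 3 f" for f
    by (rule spoly_3_orthogonal[of "\<lambda>f. I (w * f)", OF _ _ fr _ _ _ _ _ _ _ _ _ _ that])
      (use even[of 1] in \<open>simp_all add: distrib_left even odd pl pull_mult I_lin_u q\<close>)
  have "12 * sint (\<lambda>x. (ev w x)\<^sup>2) \<le> sint (\<lambda>x. \<Sum>i\<in>UNIV. (ev (X (axis i 1) w) x)\<^sup>2)"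
  proof (rule spectral_gap[OF ev_continuous ev_scale adm_ev])
    show "sint (\<lambda>x. ev (X (axis i 1) w) x * ev f x) = - sint (\<lambda>x. ev w x * ev (X (axis i 1) f) x)" for i f
      using I_by_parts[of w "axis i 1" f] by (simp add: I_def times_sph.rep_eq)
    show "sint (\<lambda>x. ev w x * ev f x) = 0" if "spoly 3 f" for f
      using orth[OF that] by (simp add: I_def times_sph.rep_eq)
  qed auto
  also have "sint (\<lambda>x. (ev w x)\<^sup>2) = I (w * w)" by (simp add: I_def times_sph.rep_eq power2_eq_square)
  also have "sint (\<lambda>x. \<Sum>i\<in>UNIV. (ev (X (axis i 1) w) x)\<^sup>2) = I (Gam w w)"
    unfolding I_def by (rule sint_cong) (simp add: Gam_def ev_sum power2_eq_square)
  also have "I (Gam w w) = - I (w * lap w)" by (simp add: I_lap)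
  also have lapP: "lap (?P u) = ?P (lap u)"
  proof -
    have "X a (?P f) = - ?P (X a f)" "X b (?P f) = - ?P (X b f)" "X c (?P f) = ?P (X c f)" for f
      using X_pull_mirror[OF cc] ac by auto
    then show ?thesis unfolding lap_frame[OF fr] by (simp add: pull_add pull_uminus)
  qed
  have "lap w = - (lam *\<^sub>R (ex u - ex (?P u)))"
  proof -
    have "?P (lap u) = lam *\<^sub>R (1 - ex (?P u))"
      by (simp add: eq pull_scaleR pull_diff pl pull_ex[OF R])
    then show ?thesis by (simp add: w_def lapP eq algebra_simps)
  qed
  finally have le: "12 * I (w * w) \<le> lam * I (w * (ex u - ex (?P u)))" by simp
  define D where "D = 12 *\<^sub>R (w * w) - lam *\<^sub>R (w * (ex u - ex (?P u)))"
  have Dx: "ev D x = 12 * (ev u x - ev (?P u) x)\<^sup>2 - lam * (exp (ev u x) - exp (ev (?P u) x)) * (ev u x - ev (?P u) x)"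
    if "x \<noteq> 0" for x
    using that by (simp add: D_def w_def ev_ex power2_eq_square)
  have bd: "lam * exp (ev u x) \<le> 12" "lam * exp (ev (?P u) x) \<le> 12" if "x \<noteq> 0" for x
  proof -
    have "mirror c x \<noteq> 0" using orthogonal_transformation_norm[OF R, of x] that by (metis norm_eq_zero)
    then show "lam * exp (ev u x) \<le> 12" "lam * exp (ev (?P u) x) \<le> 12"
      using bound that by (auto simp: ev_pull[OF R])
  qed
  have D0: "0 \<le> ev D x" if "x \<noteq> 0" for x
    using exp_diff_bound(1)[OF bd[OF that]] by (simp add: Dx[OF that])
  then have "0 \<le> I D" by (rule I_nonneg)
  moreover have "I D \<le> 0" using le by (simp add: D_def)
  ultimately have "D = 0" by (intro I_eq_0_imp D0) auto
  have "ev u x = ev (?P u) x" if "x \<in> S2" for x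
    using exp_diff_bound(2)[OF bd[OF S2_nonzero[OF that]]] Dx[OF S2_nonzero[OF that]] \<open>D = 0\<close> by simp
  then show ?thesis by (intro sph_eqI) simp
qed

end

section \<open>Pieces of functions cut along the nodal set\<close>

text \<open>\<open>step_on \<phi> s\<close>: \<open>s\<close> is locally constant on the nodal domains of \<open>\<phi>\<close> and vanishes on the nodal set,
  so that \<open>s \<phi>\<close> is a weakly differentiable function with gradient \<open>s \<nabla>\<phi>\<close>.\<close>

definition step_on :: "sph \<Rightarrow> (real^3 \<Rightarrow> real) \<Rightarrow> bool" where
  "step_on \<phi> s \<longleftrightarrow> (\<exists>C. \<forall>x. \<bar>s x\<bar> \<le> C) \<and> (\<forall>t x. 0 < t \<longrightarrow> s (t *\<^sub>R x) = s x) \<and>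
     (\<forall>x. ev \<phi> x = 0 \<longrightarrow> s x = 0) \<and> (\<forall>x. ev \<phi> x \<noteq> 0 \<longrightarrow> (\<forall>\<^sub>F y in nhds x. s y = s x))"

lemma ev_isCont: "x \<noteq> 0 \<Longrightarrow> isCont (ev f) x"
  using ev_continuous[of f] by (simp add: continuous_on_eq_continuous_at open_Compl)

lemma step_on_adm:
  assumes "step_on \<phi> s"
  shows "adm s"
proof -
  let ?N = "-{0} \<inter> ev \<phi> -` (-{0})"
  have N: "open ?N" by (rule continuous_open_preimage[OF ev_continuous]) auto
  have "isCont s x" if "x \<in> ?N" for x
  proof -
    have "\<forall>\<^sub>F y in nhds x. s y = s x" using assms that by (simp add: step_on_def)
    then have "isCont s x \<longleftrightarrow> isCont (\<lambda>y. s x) x" by (rule isCont_cong)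
    then show ?thesis by simp
  qed
  then have "continuous_on ?N s" by (simp add: continuous_at_imp_continuous_on)
  then have "(\<lambda>x. indicator ?N x *\<^sub>R s x) \<in> borel_measurable borel"
    by (rule borel_measurable_continuous_on_indicator[rotated]) (use N in auto)
  also have "(\<lambda>x. indicator ?N x *\<^sub>R s x) = s"
  proof
    fix x show "indicator ?N x *\<^sub>R s x = s x"
      using assms by (cases "ev \<phi> x = 0"; cases "x = 0") (auto simp: step_on_def)
  qed
  finally show ?thesis using assms by (simp add: adm_def step_on_def)
qed

lemma step_on_mult:
  assumes "step_on \<phi> s" "step_on \<phi> r"
  shows "step_on \<phi> (\<lambda>x. s x * r x)"
  unfolding step_on_def
proof (intro conjI allI impI)
  show "\<exists>C. \<forall>x. \<bar>s x * r x\<bar> \<le> C"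
    using adm_mult[OF assms[THEN step_on_adm]] by (simp add: adm_def)
  show "\<forall>\<^sub>F y in nhds x. s y * r y = s x * r x" if "ev \<phi> x \<noteq> 0" for x
  proof -
    have "\<forall>\<^sub>F y in nhds x. s y = s x" "\<forall>\<^sub>F y in nhds x. r y = r x" using assms that by (simp_all add: step_on_def)
    then show ?thesis by eventually_elim simp
  qed
qed (use assms in \<open>simp_all add: step_on_def\<close>)

lemma step_on_combine:
  assumes "step_on \<phi> s" "step_on \<phi> r"
  shows "step_on \<phi> (\<lambda>x. \<alpha> * s x + \<beta> * r x)"
  unfolding step_on_def
proof (intro conjI allI impI)
  have "adm (\<lambda>x. \<alpha> * s x + \<beta> * r x)" by (intro adm_add adm_mult adm_const assms[THEN step_on_adm])
  then show "\<exists>C. \<forall>x. \<bar>\<alpha> * s x + \<beta> * r x\<bar> \<le> C" by (simp add: adm_def)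
  show "\<forall>\<^sub>F y in nhds x. \<alpha> * s y + \<beta> * r y = \<alpha> * s x + \<beta> * r x" if "ev \<phi> x \<noteq> 0" for x
  proof -
    have "\<forall>\<^sub>F y in nhds x. s y = s x" "\<forall>\<^sub>F y in nhds x. r y = r x" using assms that by (simp_all add: step_on_def)
    then show ?thesis by eventually_elim simp
  qed
qed (use assms in \<open>simp_all add: step_on_def\<close>)

text \<open>At a nodal point boundedness of s suffices, since k tends to 0 there.\<close>

lemma step_on_continuous:
  assumes s: "step_on \<phi> s" and k: "continuous_on (-{0}) k" "\<And>x. x \<noteq> 0 \<Longrightarrow> ev \<phi> x = 0 \<Longrightarrow> k x = 0"
  shows "continuous_on (-{0}) (\<lambda>x. s x * k x)"
proof -
  have "isCont (\<lambda>x. s x * k x) x" if x: "x \<noteq> 0" for x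
  proof (cases "ev \<phi> x = 0")
    case False
    then have "\<forall>\<^sub>F y in nhds x. s y = s x" using s by (simp add: step_on_def)
    then have "\<forall>\<^sub>F y in nhds x. s y * k y = s x * k y" by eventually_elim simp
    then have "isCont (\<lambda>x. s x * k x) x \<longleftrightarrow> isCont (\<lambda>y. s x * k y) x" by (rule isCont_cong)
    moreover have "isCont k x" using k(1) x by (simp add: continuous_on_eq_continuous_at open_Compl)
    ultimately show ?thesis by (simp add: continuous_mult)
  next
    case True
    obtain C where C: "\<And>x. \<bar>s x\<bar> \<le> C" using s by (auto simp: step_on_def)
    have "isCont k x" using k(1) x by (simp add: continuous_on_eq_continuous_at open_Compl)
    then have "(k \<longlongrightarrow> 0) (at x)" using k(2)[OF x True] by (simp add: isCont_def)
    then have "((\<lambda>x. s x * k x) \<longlongrightarrow> 0) (at x)"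
      by (rule tendsto_0_le[of _ _ _ C]) (rule always_eventually, simp add: abs_mult mult.commute[of "\<bar>k _\<bar>"] C mult_right_mono)
    then show ?thesis using k(2)[OF x True] by (simp add: isCont_def)
  qed
  then show ?thesis by (simp add: continuous_at_imp_continuous_on)
qed

text \<open>A family of functions flat at \<open>0\<close> that approximates the identity: composed with it, \<open>s \<phi>\<close>
  becomes continuously differentiable across the nodal set.\<close>

definition flat :: "real \<Rightarrow> real \<Rightarrow> real" where
  "flat e t = t ^ 3 / (t\<^sup>2 + e)"

definition flat' :: "real \<Rightarrow> real \<Rightarrow> real" where
  "flat' e t = (t ^ 4 + 3 * e * t\<^sup>2) / (t\<^sup>2 + e)\<^sup>2"

lemma flat_pos: "0 < e \<Longrightarrow> 0 < (t::real)\<^sup>2 + e"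
  by (simp add: add_nonneg_pos)

lemma flat_derivative: "0 < e \<Longrightarrow> (flat e has_real_derivative flat' e t) (at t)"
  using flat_pos[of e t] unfolding flat_def[abs_def] flat'_def
  by (auto intro!: derivative_eq_intros simp: power2_eq_square power3_eq_cube power4_eq_xxxx field_simps)

lemma flat_bound:
  assumes "0 < e"
  shows "\<bar>flat e t\<bar> \<le> \<bar>t\<bar>" "\<bar>flat' e t\<bar> \<le> 3"
proof -
  have p: "0 < t\<^sup>2 + e" by (rule flat_pos[OF assms])
  have "\<bar>t\<bar> * t\<^sup>2 \<le> \<bar>t\<bar> * (t\<^sup>2 + e)" using assms by (intro mult_left_mono) auto
  moreover have "\<bar>t\<bar> ^ 3 = \<bar>t\<bar> * t\<^sup>2" by (simp add: power3_eq_cube power2_eq_square)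
  ultimately show "\<bar>flat e t\<bar> \<le> \<bar>t\<bar>"
    using p by (simp add: flat_def abs_divide power_abs pos_divide_le_eq)
  have "0 \<le> t ^ 4 + 3 * e * t\<^sup>2" using assms by simp
  moreover have "t ^ 4 + 3 * e * t\<^sup>2 \<le> 3 * (t\<^sup>2 + e)\<^sup>2"
  proof -
    have "3 * (t\<^sup>2 + e)\<^sup>2 - (t ^ 4 + 3 * e * t\<^sup>2) = 2 * (t\<^sup>2)\<^sup>2 + 3 * (e * t\<^sup>2) + 3 * e\<^sup>2"
      by (simp add: power2_eq_square power4_eq_xxxx algebra_simps)
    also have "0 \<le> \<dots>" using assms by simp
    finally show ?thesis by simp
  qed
  ultimately show "\<bar>flat' e t\<bar> \<le> 3" using p by (simp add: flat'_def pos_divide_le_eq)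
qed

lemma flat_continuous: "0 < e \<Longrightarrow> continuous_on S (flat e)" "0 < e \<Longrightarrow> continuous_on S (flat' e)"
  using flat_pos[of e] unfolding flat_def[abs_def] flat'_def[abs_def]
  by (auto intro!: continuous_intros) (metis less_irrefl)+

lemma flat_tendsto:
  assumes "t \<noteq> 0" "e \<longlonglongrightarrow> 0"
  shows "(\<lambda>n. flat (e n) t) \<longlonglongrightarrow> t" "(\<lambda>n. flat' (e n) t) \<longlonglongrightarrow> 1"
proof -
  have "(\<lambda>n. flat (e n) t) \<longlonglongrightarrow> t ^ 3 / (t\<^sup>2 + 0)"
    unfolding flat_def by (intro tendsto_intros assms) (use assms in auto)
  then show "(\<lambda>n. flat (e n) t) \<longlonglongrightarrow> t" using assms by (simp add: power3_eq_cube power2_eq_square)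
  have "(\<lambda>n. flat' (e n) t) \<longlonglongrightarrow> (t ^ 4 + 3 * 0 * t\<^sup>2) / (t\<^sup>2 + 0)\<^sup>2"
    unfolding flat'_def by (intro tendsto_intros assms) (use assms in auto)
  then show "(\<lambda>n. flat' (e n) t) \<longlonglongrightarrow> 1" using assms by (simp add: power4_eq_xxxx power2_eq_square)
qed

text \<open>Used at nodal points, where the regularised \<phi> has derivative zero and dominates the
  cut-off function although the cut-off factor jumps.\<close>

lemma DERIV_zero_comparison:
  assumes "(h has_real_derivative 0) (at (0::real))" "h 0 = 0" "\<And>t. \<bar>k t\<bar> \<le> K * \<bar>h t\<bar>"
  shows "(k has_real_derivative 0) (at 0)"
proof -
  have k0: "k 0 = 0" using assms(2) assms(3)[of 0] by simp
  have "((\<lambda>t. h t / t) \<longlongrightarrow> 0) (at 0)"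
    using assms(1,2) by (simp add: has_field_derivative_iff)
  then have "((\<lambda>t. k t / t) \<longlongrightarrow> 0) (at 0)"
    by (rule tendsto_0_le[of _ _ _ K])
      (use assms(3) in \<open>auto simp: mult.commute intro!: always_eventually divide_right_mono\<close>)
  then show ?thesis by (simp add: has_field_derivative_iff k0)
qed

text \<open>After \<open>flat\<close> is applied to \<phi>, the product with s is differentiable
  along orbits even at nodal points, so its derivative integrates to zero. As e tends to 0,
  dominated convergence removes \<open>flat\<close>; on the nodal set s = 0 makes every term vanish,
  whatever the shape and measure of that set.\<close>

lemma step_on_weak_derivative:
  assumes a: "norm a = 1" and s: "step_on \<phi> s"
  shows "sint (\<lambda>x. s x * ev (X a \<phi>) x * ev f x) = - sint (\<lambda>x. s x * ev \<phi> x * ev (X a f) x)"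
proof -
  note as = step_on_adm[OF s]
  define e where "e n = inverse (real (Suc n))" for n
  have e: "0 < e n" for n by (simp add: e_def)
  have e0: "e \<longlonglongrightarrow> 0" unfolding e_def by (rule LIMSEQ_inverse_real_of_nat)
  have adm1: "adm (\<lambda>x. flat (e n) (ev \<phi> x))" "adm (\<lambda>x. flat' (e n) (ev \<phi> x))" for n
    by (rule adm_punctured, rule continuous_on_compose2[OF flat_continuous(1)[OF e, of UNIV] ev_continuous],
        simp_all add: ev_scale)
      (rule adm_punctured, rule continuous_on_compose2[OF flat_continuous(2)[OF e, of UNIV] ev_continuous],
        simp_all add: ev_scale)
  define F where "F n x = s x * (flat (e n) (ev \<phi> x) * ev f x)" for n x
  define F' where "F' n x = s x * (flat' (e n) (ev \<phi> x) * ev (X a \<phi>) x * ev f x + flat (e n) (ev \<phi> x) * ev (X a f) x)" for n x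
  obtain C where C: "\<And>x. \<bar>s x\<bar> \<le> C" using s by (auto simp: step_on_def)
  have C0: "0 \<le> C" using C[of 0] by linarith
  obtain Cf where Cf: "\<And>x. \<bar>ev f x\<bar> \<le> Cf" using adm_ev[of f] by (auto simp: adm_def)
  obtain Cp where Cp: "\<And>x. \<bar>ev \<phi> x\<bar> \<le> Cp" using adm_ev[of \<phi>] by (auto simp: adm_def)
  obtain Cf' where Cf': "\<And>x. \<bar>ev (X a f) x\<bar> \<le> Cf'" using adm_ev[of "X a f"] by (auto simp: adm_def)
  obtain Cp' where Cp': "\<And>x. \<bar>ev (X a \<phi>) x\<bar> \<le> Cp'" using adm_ev[of "X a \<phi>"] by (auto simp: adm_def)
  have admF': "adm (F' n)" for n unfolding F'_def by (intro adm_mult adm_add adm1 as adm_ev)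
  have F'0: "sint (F' n) = 0" for n
  proof (rule sint_rotate_derivative[OF a _ admF'])
    show "adm (F n)" unfolding F_def by (intro adm_mult adm1 as adm_ev)
    fix x :: "real^3" assume x: "x \<noteq> 0"
    let ?r = "\<lambda>t. rotate_about a t x"
    have dphi: "((\<lambda>t. flat (e n) (ev \<phi> (?r t))) has_real_derivative flat' (e n) (ev \<phi> x) * ev (X a \<phi>) x) (at 0)"
    proof (rule DERIV_chain2[OF _ ev_rotate_derivative[OF x]])
      show "(flat (e n) has_real_derivative flat' (e n) (ev \<phi> x)) (at (ev \<phi> (?r 0)))"
        using flat_derivative[OF e] by simp
    qed
    show "((\<lambda>t. F n (?r t)) has_real_derivative F' n x) (at 0)"
    proof (cases "ev \<phi> x = 0")
      case True
      then have "s x = 0" using s by (simp add: step_on_def)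
      then have F'x: "F' n x = 0" by (simp add: F'_def)
      have "((\<lambda>t. flat (e n) (ev \<phi> (?r t))) has_real_derivative 0) (at 0)"
        using dphi True by (simp add: flat'_def)
      then show ?thesis unfolding F'x
      proof (rule DERIV_zero_comparison[where K = "C * Cf"])
        show "flat (e n) (ev \<phi> (?r 0)) = 0" using True by (simp add: flat_def)
        show "\<bar>F n (?r t)\<bar> \<le> C * Cf * \<bar>flat (e n) (ev \<phi> (?r t))\<bar>" for t
        proof -
          have "\<bar>F n (?r t)\<bar> = \<bar>s (?r t)\<bar> * \<bar>ev f (?r t)\<bar> * \<bar>flat (e n) (ev \<phi> (?r t))\<bar>"
            by (simp add: F_def abs_mult)
          also have "\<dots> \<le> C * Cf * \<bar>flat (e n) (ev \<phi> (?r t))\<bar>"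
            using C Cf C0 by (intro mult_right_mono mult_mono) auto
          finally show ?thesis .
        qed
      qed
    next
      case False
      have "isCont (\<lambda>t. ?r t) 0"
        using has_derivative_continuous[OF rotate_about_derivative[of a x]] by simp
      then have "filterlim ?r (nhds x) (nhds 0)"
        by (metis continuous_at rotate_about_0 tendsto_at_iff_tendsto_nhds)
      moreover have "\<forall>\<^sub>F y in nhds x. s y = s x" using s False by (simp add: step_on_def)
      ultimately have ev: "\<forall>\<^sub>F t in nhds 0. s (?r t) = s x" by (rule eventually_compose_filterlim[rotated])
      have "((\<lambda>t. flat (e n) (ev \<phi> (?r t)) * ev f (?r t)) has_real_derivative
          flat' (e n) (ev \<phi> x) * ev (X a \<phi>) x * ev f x + flat (e n) (ev \<phi> x) * ev (X a f) x) (at 0)"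
        using DERIV_mult[OF dphi ev_rotate_derivative[OF x, of f a]] by (simp add: mult.commute)
      then have "((\<lambda>t. s x * (flat (e n) (ev \<phi> (?r t)) * ev f (?r t))) has_real_derivative F' n x) (at 0)"
        unfolding F'_def by (rule DERIV_cmult)
      moreover have "\<forall>\<^sub>F t in nhds 0. F n (?r t) = s x * (flat (e n) (ev \<phi> (?r t)) * ev f (?r t))"
        using ev by eventually_elim (simp add: F_def)
      ultimately show ?thesis by (subst DERIV_cong_ev[OF refl _ refl])
    qed
  qed
  define H where "H x = s x * ev (X a \<phi>) x * ev f x + s x * ev \<phi> x * ev (X a f) x" for x
  have "(\<lambda>n. sint (F' n)) \<longlonglongrightarrow> sint H"
  proof (rule sint_dominated_convergence[OF admF'])
    show "adm H" unfolding H_def by (intro adm_add adm_mult as adm_ev)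
    fix x :: "real^3" assume x: "x \<noteq> 0"
    show "\<bar>F' n x\<bar> \<le> C * (3 * Cp' * Cf + Cp * Cf')" for n
    proof -
      let ?t = "ev \<phi> x"
      have "\<bar>flat (e n) ?t\<bar> \<le> Cp" using flat_bound(1)[OF e, of n ?t] Cp[of x] by linarith
      then have "\<bar>flat' (e n) ?t\<bar> * \<bar>ev (X a \<phi>) x\<bar> * \<bar>ev f x\<bar> + \<bar>flat (e n) ?t\<bar> * \<bar>ev (X a f) x\<bar> \<le> 3 * Cp' * Cf + Cp * Cf'"
        using flat_bound(2)[OF e] Cp' Cf Cf' by (intro add_mono mult_mono) (auto intro: order_trans[OF abs_ge_zero])
      then have "\<bar>flat' (e n) ?t * ev (X a \<phi>) x * ev f x + flat (e n) ?t * ev (X a f) x\<bar> \<le> 3 * Cp' * Cf + Cp * Cf'"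
        by (intro order_trans[OF abs_triangle_ineq]) (simp add: abs_mult)
      then show ?thesis unfolding F'_def abs_mult[of "s x"] using C C0 by (intro mult_mono) auto
    qed
    show "(\<lambda>n. F' n x) \<longlonglongrightarrow> H x"
    proof (cases "ev \<phi> x = 0")
      case True
      then have "s x = 0" using s by (simp add: step_on_def)
      then show ?thesis by (simp add: F'_def H_def)
    next
      case False
      have "(\<lambda>n. F' n x) \<longlonglongrightarrow> s x * (1 * ev (X a \<phi>) x * ev f x + ev \<phi> x * ev (X a f) x)"
        unfolding F'_def by (intro tendsto_intros flat_tendsto[OF False e0])
      then show ?thesis by (simp add: H_def algebra_simps)
    qed
  qed
  then have "sint H = 0" using F'0 by (simp add: LIMSEQ_const_iff)
  moreover have "sint H = sint (\<lambda>x. s x * ev (X a \<phi>) x * ev f x) + sint (\<lambda>x. s x * ev \<phi> x * ev (X a f) x)"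
    unfolding H_def by (intro sint_add adm_mult as adm_ev)
  ultimately show ?thesis by simp
qed

section \<open>Axial symmetry\<close>

text \<open>\<eta> is the parity of F, 1 for even and -1 for odd, and g has the opposite
  one.\<close>

lemma sint_parity:
  assumes F: "adm F" and v: "v \<bullet> v = 1"
    and "\<And>x. F (mirror v x) = \<eta> * F x" "pull (mirror v) g = - (\<eta> *\<^sub>R g)" "\<eta> * \<eta> = 1"
  shows "sint (\<lambda>x. F x * ev g x) = 0"
proof (rule sint_odd[OF adm_mult[OF F adm_ev] mirror_orthogonal[OF v]])
  fix x
  have "ev g (mirror v x) = - (\<eta> * ev g x)"
    using arg_cong[OF assms(4), of "\<lambda>f. ev f x"] by (simp add: ev_pull_mirror[OF v])
  then have "F (mirror v x) * ev g (mirror v x) = - (\<eta> * \<eta> * (F x * ev g x))"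
    using assms(3)[of x] by simp
  then show "F (mirror v x) * ev g (mirror v x) = - (F x * ev g x)" using assms(5) by simp
qed

lemma sint_spoly_3:
  assumes F: "adm F" and fr: "frame a b c"
    and L: "sint F = 0" "\<And>v. v \<in> {a, b, c} \<Longrightarrow> sint (\<lambda>x. F x * ev (lin v) x) = 0"
      "\<And>v. v \<in> {a, b, c} \<Longrightarrow> sint (\<lambda>x. F x * ev (lin v * lin v) x) = 0"
      "sint (\<lambda>x. F x * ev (lin a * lin b) x) = 0" "sint (\<lambda>x. F x * ev (lin b * lin c) x) = 0"
      "sint (\<lambda>x. F x * ev (lin c * lin a) x) = 0"
    and f: "spoly 3 f"
  shows "sint (\<lambda>x. F x * ev f x) = 0"
proof (rule spoly_3_orthogonal[of "\<lambda>f. sint (\<lambda>x. F x * ev f x)", OF _ _ fr _ _ _ _ _ _ _ _ _ _ f])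
  show "sint (\<lambda>x. F x * ev (f + g) x) = sint (\<lambda>x. F x * ev f x) + sint (\<lambda>x. F x * ev g x)" for f g
    using sint_add[OF adm_mult[OF F adm_ev] adm_mult[OF F adm_ev], of f g] by (simp add: distrib_left)
  show "sint (\<lambda>x. F x * ev (r *\<^sub>R f) x) = r * sint (\<lambda>x. F x * ev f x)" for r f
    using sint_cmult[of r "\<lambda>x. F x * ev f x"] by (simp add: mult.left_commute)
  have "sint (\<lambda>x. F x * ev 1 x) = sint F" by (rule sint_cong) (simp add: ev_one)
  then show "sint (\<lambda>x. F x * ev 1 x) = 0" using L(1) by simp
qed (use L in simp_all)

lemma ev_zero_mirror:
  assumes v: "v \<bullet> v = 1" and f: "pull (mirror v) f = - f" and x: "ev (lin v) x = 0"
  shows "ev f x = 0"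
proof (cases "x = 0")
  case False
  then have "mirror v x = x" using x by (simp add: ev_lin mirror_def)
  then have "ev f x = - ev f x" using arg_cong[OF f, of "\<lambda>f. ev f x"] by (simp add: ev_pull_mirror[OF v])
  then show ?thesis by simp
qed simp

lemma linear_combination_zero: "\<exists>\<alpha> \<beta> :: real. (\<alpha> \<noteq> 0 \<or> \<beta> \<noteq> 0) \<and> \<alpha> * k + \<beta> * l = 0"
proof (cases "k = 0")
  case False
  then show ?thesis by (intro exI[of _ l] exI[of _ "- k"]) simp
qed (auto intro: exI[of _ 1] exI[of _ 0])

context bounded_mean_field begin

lemma X_u_max:
  assumes x: "x \<noteq> 0" and eq12: "lam * exp (ev u x) = 12"
  shows "ev (X v u) x = 0"
proof (cases "v = 0")
  case False
  define a where "a = v /\<^sub>R norm v"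
  have a: "norm a = 1" using False by (simp add: a_def)
  have "ev u (rotate_about a 0 x) \<ge> ev u (rotate_about a t x)" for t
  proof -
    have "rotate_about a t x \<noteq> 0"
      using orthogonal_transformation_norm[OF rotate_about_orthogonal[OF a], of t x] x by (metis norm_eq_zero)
    from bound[OF this] eq12 have "lam * exp (ev u (rotate_about a t x)) \<le> lam * exp (ev u x)" by simp
    then show ?thesis using lam by simp
  qed
  then have "ev (X a u) x = 0"
    by (intro DERIV_local_max[OF ev_rotate_derivative[OF x], of 1]) auto
  then show ?thesis using False by (simp add: a_def X_vec)
qed (simp add: X_vec)

text \<open>The form \<open>\<integral>|\<nabla>w|\<^sup>2 - \<lambda> e\<^sup>u w\<^sup>2\<close> vanishes on every piece of \<open>X v u\<close>, while the spectral gap bounds it from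
  below by \<open>\<integral>(12 - \<lambda> e\<^sup>u) w\<^sup>2\<close>; where this weight vanishes \<open>u\<close> is maximal and \<open>X v u = 0\<close>.\<close>

lemma step_X_u_vanishes:
  assumes s: "step_on (X v u) s"
    and orth: "\<And>f. spoly 3 f \<Longrightarrow> sint (\<lambda>x. s x * ev (X v u) x * ev f x) = 0"
  shows "s x * ev (X v u) x = 0"
proof -
  define \<phi> where "\<phi> = X v u"
  note s = s[folded \<phi>_def] and orth = orth[folded \<phi>_def]
  note as = step_on_adm[OF s]
  have ss: "step_on \<phi> (\<lambda>x. s x * s x)" by (rule step_on_mult[OF s s])
  have hom: "s (t *\<^sub>R x) = s x" if "0 < t" for t x using s that by (simp add: step_on_def)
  have "12 * sint (\<lambda>x. (s x * ev \<phi> x)\<^sup>2) \<le> sint (\<lambda>x. \<Sum>i\<in>UNIV. (s x * ev (X (axis i 1) \<phi>) x)\<^sup>2)"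
  proof (rule spectral_gap)
    show "continuous_on (- {0}) (\<lambda>x. s x * ev \<phi> x)"
      by (rule step_on_continuous[OF s ev_continuous])
    show "adm (\<lambda>x. s x * ev (X (axis i 1) \<phi>) x)" for i :: 3 by (intro adm_mult as adm_ev)
    show "sint (\<lambda>x. s x * ev (X (axis i 1) \<phi>) x * ev f x) = - sint (\<lambda>x. s x * ev \<phi> x * ev (X (axis i 1) f) x)" for i f
      by (rule step_on_weak_derivative[OF _ s]) simp
  qed (use orth in \<open>auto simp: hom ev_scale\<close>)
  also have "sint (\<lambda>x. \<Sum>i\<in>UNIV. (s x * ev (X (axis i 1) \<phi>) x)\<^sup>2) = (\<Sum>i\<in>UNIV. sint (\<lambda>x. (s x * ev (X (axis i 1) \<phi>) x)\<^sup>2))"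
    by (rule sint_sum) (intro adm_power2 adm_mult as adm_ev)
  \<comment> \<open>Since \<open>s * s\<close> is again a step function for \<phi>, the weak
    derivative rule with the smooth test function \<open>X (axis i 1) \<phi>\<close> moves the
    derivative off \<phi>.\<close>
  also have "\<dots> = (\<Sum>i\<in>UNIV. - sint (\<lambda>x. s x * s x * ev \<phi> x * ev (X (axis i 1) (X (axis i 1) \<phi>)) x))"
  proof (rule sum.cong)
    fix i :: 3
    have "(\<lambda>x. (s x * ev (X (axis i 1) \<phi>) x)\<^sup>2) = (\<lambda>x. s x * s x * ev (X (axis i 1) \<phi>) x * ev (X (axis i 1) \<phi>) x)"
      by (simp add: power2_eq_square fun_eq_iff)
    then show "sint (\<lambda>x. (s x * ev (X (axis i 1) \<phi>) x)\<^sup>2) = - sint (\<lambda>x. s x * s x * ev \<phi> x * ev (X (axis i 1) (X (axis i 1) \<phi>)) x)"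
      using step_on_weak_derivative[OF _ ss, of "axis i 1" "X (axis i 1) \<phi>"] by simp
  qed simp
  also have "\<dots> = - sint (\<lambda>x. s x * s x * ev \<phi> x * ev (lap \<phi>) x)"
    unfolding lap_def ev_sum sum_distrib_left sum_negf
    by (subst sint_sum) (intro adm_mult as adm_ev, rule refl)
  finally have le: "12 * sint (\<lambda>x. (s x * ev \<phi> x)\<^sup>2) \<le> - sint (\<lambda>x. s x * s x * ev \<phi> x * ev (lap \<phi>) x)" .
  \<comment> \<open>For a solution of the linearised equation k is \<phi>^2 (12 - lam exp u), the
    density of the defect in the gap inequality.\<close>
  define k where "k = ev (\<phi> * (12 *\<^sub>R \<phi> + lap \<phi>))"
  have kx: "k x = (ev \<phi> x)\<^sup>2 * (12 - lam * exp (ev u x))" if "x \<noteq> 0" for x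
    using that by (simp add: k_def \<phi>_def lap_X_u ev_ex power2_eq_square algebra_simps)
  have k0: "0 \<le> k x" if "x \<noteq> 0" for x
    using bound[OF that] by (simp add: kx[OF that])
  have "sint (\<lambda>x. s x * s x * k x) = sint (\<lambda>x. 12 * (s x * ev \<phi> x)\<^sup>2 + s x * s x * ev \<phi> x * ev (lap \<phi>) x)"
    by (simp add: k_def power2_eq_square algebra_simps)
  also have "\<dots> = 12 * sint (\<lambda>x. (s x * ev \<phi> x)\<^sup>2) + sint (\<lambda>x. s x * s x * ev \<phi> x * ev (lap \<phi>) x)"
    by (subst sint_add) (intro adm_mult adm_power2 adm_const as adm_ev | simp add: sint_cmult)+
  finally have "sint (\<lambda>x. s x * s x * k x) \<le> 0" using le by simp
  moreover have "0 \<le> sint (\<lambda>x. s x * s x * k x)" by (rule sint_nonneg) (simp add: k0)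
  ultimately have z: "sint (\<lambda>x. s x * s x * k x) = 0" by simp
  have "s x * ev \<phi> x = 0"
  proof (cases "x = 0")
    case False
    have "s x * s x * k x = 0"
    proof (rule sint_zero_imp[of "\<lambda>x. s x * s x * k x", OF _ _ z _ _ False])
      show "adm (\<lambda>x. s x * s x * k x)" unfolding k_def by (intro adm_mult as adm_ev)
      show "continuous_on (- {0}) (\<lambda>x. s x * s x * k x)"
      proof (rule step_on_continuous[OF ss])
        show "continuous_on (- {0}) k" unfolding k_def by (rule ev_continuous)
      qed (simp add: k_def)
      show "s (t *\<^sub>R x) * s (t *\<^sub>R x) * k (t *\<^sub>R x) = s x * s x * k x" if "0 < t" for t x
        using that by (simp add: hom k_def ev_scale del: ev_simps)
    qed (simp add: k0)
    then have "s x = 0 \<or> ev \<phi> x = 0 \<or> lam * exp (ev u x) = 12" using kx[OF False] by auto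
    then show ?thesis using X_u_max[OF False] by (auto simp: \<phi>_def)
  qed simp
  then show ?thesis by (simp add: \<phi>_def)
qed

section \<open>Signs and products of the three rotation derivatives\<close>

definition symmetry_frame :: "real^3 \<Rightarrow> real^3 \<Rightarrow> real^3 \<Rightarrow> bool" where
  "symmetry_frame a b c \<longleftrightarrow> frame a b c \<and> (\<forall>v\<in>{a, b, c}. pull (mirror v) u = u)"

lemma symmetry_frame_cycle: "symmetry_frame a b c \<Longrightarrow> symmetry_frame b c a"
  by (auto simp: symmetry_frame_def frame_cycle)

lemma symmetry_frame_parity:
  assumes "symmetry_frame a b c"
  shows "pull (mirror a) (X a u) = X a u" "pull (mirror b) (X a u) = - X a u" "pull (mirror c) (X a u) = - X a u"
proof -
  have u: "pull (mirror a) u = u" "pull (mirror b) u = u" "pull (mirror c) u = u"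
    and fr: "a \<bullet> a = 1" "b \<bullet> b = 1" "c \<bullet> c = 1" "a \<bullet> b = 0" "a \<bullet> c = 0"
    using assms by (auto simp: symmetry_frame_def frame_def inner_commute)
  show "pull (mirror a) (X a u) = X a u" using X_pull_mirror(1)[OF fr(1), of u] u by simp
  show "pull (mirror b) (X a u) = - X a u" using X_pull_mirror(2)[OF fr(2,4), of u] u by (metis minus_minus)
  show "pull (mirror c) (X a u) = - X a u" using X_pull_mirror(2)[OF fr(3,5), of u] u by (metis minus_minus)
qed

lemma frame_pull_lin:
  assumes "frame a b c"
  shows "pull (mirror a) (lin a) = - lin a" "pull (mirror a) (lin b) = lin b" "pull (mirror a) (lin c) = lin c"
    "pull (mirror b) (lin a) = lin a" "pull (mirror b) (lin b) = - lin b" "pull (mirror b) (lin c) = lin c"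
    "pull (mirror c) (lin a) = lin a" "pull (mirror c) (lin b) = lin b" "pull (mirror c) (lin c) = - lin c"
  using pull_lin_mirror assms by (auto simp: frame_def inner_commute)

text \<open>The pieces are \<phi> restricted to m > 0 and to m < 0. As m is even in b and c, both
  pieces inherit from \<phi> oddness in b and in c, and \<open>lin b * lin c\<close> is the only
  frame polynomial of degree at most two with both parities. One combination is orthogonal to it and
  therefore vanishes, so m cannot take both signs.\<close>

lemma X_u_sign:
  assumes sf: "symmetry_frame a b c"
  shows "\<exists>\<sigma>\<in>{1, -1 :: real}. \<forall>x. 0 \<le> \<sigma> * ev (lin b * lin c * X a u) x"
proof -
  have fr: "frame a b c" using sf by (simp add: symmetry_frame_def)
  have n: "a \<bullet> a = 1" "b \<bullet> b = 1" "c \<bullet> c = 1" using fr by (auto simp: frame_def)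
  note par = symmetry_frame_parity[OF sf] and pl = frame_pull_lin[OF fr]
  define \<phi> where "\<phi> = X a u"
  define m where "m = lin b * lin c * \<phi>"
  have pm: "pull (mirror b) m = m" "pull (mirror c) m = m"
    by (simp_all add: m_def \<phi>_def pull_mult pl par)
  \<comment> \<open>\<phi> is odd in b and c, so it vanishes on both mirror planes; off its nodal
    set the sign of m is therefore locally constant.\<close>
  have m_nz: "ev m x \<noteq> 0" if "ev \<phi> x \<noteq> 0" for x
    using ev_zero_mirror[OF n(2) par(2), of x] ev_zero_mirror[OF n(3) par(3), of x] that
    by (auto simp: m_def \<phi>_def)
  define s1 s2 :: "real^3 \<Rightarrow> real" where "s1 x = (if 0 < ev m x then 1 else 0)" and "s2 x = (if ev m x < 0 then 1 else 0)" for x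
  have m_ev: "\<forall>\<^sub>F y in nhds x. 0 < \<eta> * ev m y" if "0 < \<eta> * ev m x" for x \<eta>
  proof -
    have "x \<noteq> 0" using that by auto
    then have "isCont (\<lambda>y. \<eta> * ev m y) x" by (intro continuous_intros ev_isCont)
    then have "((\<lambda>y. \<eta> * ev m y) \<longlongrightarrow> \<eta> * ev m x) (nhds x)"
      using tendsto_at_iff_tendsto_nhds[of "\<lambda>y. \<eta> * ev m y" x] by (simp add: isCont_def)
    then show ?thesis using that by (rule order_tendstoD)
  qed
  have st: "step_on \<phi> s1" "step_on \<phi> s2"
  proof -
    have b: "\<exists>C. \<forall>x. \<bar>s1 x\<bar> \<le> C" "\<exists>C. \<forall>x. \<bar>s2 x\<bar> \<le> C"
      by (auto simp: s1_def s2_def intro!: exI[of _ 1])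
    have e: "\<forall>\<^sub>F y in nhds x. s1 y = s1 x" "\<forall>\<^sub>F y in nhds x. s2 y = s2 x" if "ev \<phi> x \<noteq> 0" for x
    proof -
      have "0 < 1 * ev m x \<or> 0 < (-1) * ev m x" using m_nz[OF that] by linarith
      then have "(\<forall>\<^sub>F y in nhds x. 0 < 1 * ev m y \<and> 0 < ev m x) \<or> (\<forall>\<^sub>F y in nhds x. 0 < (-1) * ev m y \<and> ev m x < 0)"
        using m_ev[of 1 x] m_ev[of "-1" x] by (auto elim: eventually_mono)
      then show "\<forall>\<^sub>F y in nhds x. s1 y = s1 x" "\<forall>\<^sub>F y in nhds x. s2 y = s2 x"
        by (auto simp: s1_def s2_def elim: eventually_mono)
    qed
    show "step_on \<phi> s1" "step_on \<phi> s2"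
      unfolding step_on_def using b e by (auto simp: s1_def s2_def ev_scale m_def simp del: ev_simps(2)) (auto simp: m_def)
  qed
  obtain \<alpha> \<beta> where ab: "\<alpha> \<noteq> 0 \<or> \<beta> \<noteq> 0"
    "\<alpha> * sint (\<lambda>x. s1 x * ev \<phi> x * ev (lin b * lin c) x) + \<beta> * sint (\<lambda>x. s2 x * ev \<phi> x * ev (lin b * lin c) x) = 0"
    using linear_combination_zero by blast
  define s where "s x = \<alpha> * s1 x + \<beta> * s2 x" for x
  have step: "step_on \<phi> s" unfolding s_def[abs_def] by (rule step_on_combine[OF st])
  define F where "F x = s x * ev \<phi> x" for x
  have aF: "adm F" unfolding F_def by (intro adm_mult adm_ev step_on_adm[OF step])
  have evm: "ev m (mirror b x) = ev m x" "ev m (mirror c x) = ev m x" for x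
    using pm ev_pull_mirror n by metis+
  have evphi: "ev \<phi> (mirror b x) = - ev \<phi> x" "ev \<phi> (mirror c x) = - ev \<phi> x" for x
    using par(2,3) ev_pull_mirror n ev_simps(3) unfolding \<phi>_def by metis+
  have F: "F (mirror b x) = - 1 * F x" "F (mirror c x) = - 1 * F x" for x
    by (simp_all add: F_def s_def s1_def s2_def evm evphi)
  have even: "sint (\<lambda>x. F x * ev g x) = 0" if "pull (mirror b) g = g \<or> pull (mirror c) g = g" for g
    using sint_parity[OF aF n(2) F(1)] sint_parity[OF aF n(3) F(2)] that by auto
  have "sint F = 0"
  proof -
    have "sint F = sint (\<lambda>x. F x * ev 1 x)" by (rule sint_cong) (simp add: ev_one)
    then show ?thesis using even[of 1] pull_lin_mirror(3)[OF n(2)] by simp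
  qed
  moreover have "sint (\<lambda>x. F x * ev (lin b * lin c) x) = 0"
  proof -
    have "sint (\<lambda>x. F x * ev (lin b * lin c) x) =
        sint (\<lambda>x. \<alpha> * (s1 x * ev \<phi> x * ev (lin b * lin c) x) + \<beta> * (s2 x * ev \<phi> x * ev (lin b * lin c) x))"
      by (simp add: F_def s_def algebra_simps)
    also have "\<dots> = \<alpha> * sint (\<lambda>x. s1 x * ev \<phi> x * ev (lin b * lin c) x) + \<beta> * sint (\<lambda>x. s2 x * ev \<phi> x * ev (lin b * lin c) x)"
      unfolding sint_cmult[symmetric] by (intro sint_add adm_mult adm_const adm_ev step_on_adm[OF st(1)] step_on_adm[OF st(2)])
    finally show ?thesis using ab(2) by simp
  qed
  ultimately have "sint (\<lambda>x. F x * ev f x) = 0" if "spoly 3 f" for f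
    by (intro sint_spoly_3[OF aF fr _ _ _ _ _ _ that]) (auto intro!: even simp: pl pull_mult simp del: ev_simps)
  then have van: "s x * ev \<phi> x = 0" for x
    using step_X_u_vanishes[of a s] step unfolding F_def \<phi>_def by blast
  have z: "s x = 0" if "ev m x \<noteq> 0" for x
    using van[of x] that by (auto simp: m_def)
  show ?thesis
  proof (cases "\<alpha> = 0")
    case True
    then have "\<beta> \<noteq> 0" using ab(1) by simp
    have "0 \<le> ev m x" for x
    proof (rule ccontr)
      assume "\<not> 0 \<le> ev m x"
      then show False using z[of x] True \<open>\<beta> \<noteq> 0\<close> by (simp add: s_def s2_def)
    qed
    then show ?thesis unfolding m_def \<phi>_def by (intro bexI[of _ 1]) auto
  next
    case False
    have "ev m x \<le> 0" for x
    proof (rule ccontr)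
      assume "\<not> ev m x \<le> 0"
      then show False using z[of x] False by (simp add: s_def s1_def s2_def)
    qed
    then show ?thesis unfolding m_def \<phi>_def by (intro bexI[of _ "-1"]) auto
  qed
qed

text \<open>\<open>\<phi> = X b u\<close> lies in the kernel of \<open>\<Delta> + \<lambda> e\<^sup>u\<close>, hence is orthogonal to its range, and the
  operator maps \<open>X a (X c u)\<close> to \<open>- \<lambda> e\<^sup>u (X a u) (X c u)\<close>.\<close>

lemma I_triple: "I (ex u * (X a u * X b u * X c u)) = 0"
proof -
  define \<psi> where "\<psi> = X a (X c u)"
  have "lap \<psi> = - (lam *\<^sub>R (ex u * (X a u * X c u) + ex u * \<psi>))"
    by (simp add: \<psi>_def lap_X eq algebra_simps)
  then have "X b u * lap \<psi> = - (lam *\<^sub>R (ex u * (X a u * X b u * X c u))) - lam *\<^sub>R (ex u * (X b u * \<psi>))"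
    by (simp add: distrib_left right_diff_distrib scaleR_add_right mult_ac)
  then have 1: "I (X b u * lap \<psi>) = - lam * I (ex u * (X a u * X b u * X c u)) - lam * I (ex u * (X b u * \<psi>))"
    by (simp only: I_simps)
  have "I (X b u * lap \<psi>) = - lam * I (ex u * (X b u * \<psi>))"
    unfolding I_lap_symmetric by (simp add: lap_X_u mult.assoc)
  then show ?thesis using 1 lam by simp
qed

text \<open>Multiplying the three sign conditions gives the product of the derivatives a fixed sign,
  up to the square of the product of the coordinates; then \<open>I_triple\<close> applies.\<close>

lemma triple_product_zero:
  assumes sf: "symmetry_frame a b c"
  shows "X a u * X b u * X c u = 0"
proof -
  note sb = symmetry_frame_cycle[OF sf]
  note sc = symmetry_frame_cycle[OF sb]
  have n: "a \<bullet> a = 1" "b \<bullet> b = 1" "c \<bullet> c = 1" using sf by (auto simp: symmetry_frame_def frame_def)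
  obtain r1 r2 r3 :: real where r: "r1 \<noteq> 0" "r2 \<noteq> 0" "r3 \<noteq> 0"
    "\<And>x. 0 \<le> r1 * ev (lin b * lin c * X a u) x" "\<And>x. 0 \<le> r2 * ev (lin c * lin a * X b u) x"
    "\<And>x. 0 \<le> r3 * ev (lin a * lin b * X c u) x"
    using X_u_sign[OF sf] X_u_sign[OF sb] X_u_sign[OF sc] by (metis insertE singletonD zero_neq_one neg_equal_0_iff_equal)
  define P where "P = X a u * X b u * X c u"
  have P: "0 \<le> r1 * r2 * r3 * ev P x" for x
  \<comment> \<open>On the coordinate planes the square cannot be divided out, but there some
    rotation derivative vanishes by oddness.\<close>
  proof (cases "ev (lin a) x = 0 \<or> ev (lin b) x = 0 \<or> ev (lin c) x = 0")
    case True
    then have "ev (X b u) x = 0 \<or> ev (X a u) x = 0"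
      using ev_zero_mirror[OF n(1) symmetry_frame_parity(3)[OF sb]]
        ev_zero_mirror[OF n(2) symmetry_frame_parity(2)[OF sf]]
        ev_zero_mirror[OF n(3) symmetry_frame_parity(3)[OF sf]] by blast
    then show ?thesis by (auto simp: P_def)
  next
    case False
    let ?k = "(ev (lin a) x * ev (lin b) x * ev (lin c) x)\<^sup>2"
    have "0 \<le> (r1 * ev (lin b * lin c * X a u) x) * (r2 * ev (lin c * lin a * X b u) x) * (r3 * ev (lin a * lin b * X c u) x)"
      by (intro mult_nonneg_nonneg r)
    also have "\<dots> = ?k * (r1 * r2 * r3 * ev P x)"
      by (simp add: P_def power2_eq_square)
    finally show ?thesis using False by (simp add: zero_le_mult_iff)
  qed
  define D where "D = (r1 * r2 * r3) *\<^sub>R (ex u * P)"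
  have "D = 0"
  proof (rule I_eq_0_imp)
    show "I D = 0" by (simp add: D_def P_def I_triple)
    show "0 \<le> ev D x" if "x \<noteq> 0" for x
      using P[of x] that by (simp add: D_def ev_ex mult.left_commute[of _ "exp _"])
  qed
  then have z: "r1 * r2 * r3 * (exp (ev u x) * ev P x) = 0" if "x \<noteq> 0" for x
    using that arg_cong[of D 0 "\<lambda>f. ev f x"] by (simp add: D_def ev_ex)
  then show ?thesis unfolding P_def[symmetric]
  proof (intro sph_eqI)
    fix x assume "x \<in> S2"
    from z[OF S2_nonzero[OF this]] show "ev P x = ev 0 x" using r(1-3) by simp
  qed
qed

text \<open>Where both derivatives are nonzero the third one vanishes, and \<open>X_radial\<close>
  reduces to A X a u + C X c u = 0. Multiplied by r A B C this becomes a sum of a positive and a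
  nonnegative term.\<close>

lemma equal_signs_product_zero:
  assumes sf: "symmetry_frame a b c"
    and r: "\<And>x. 0 \<le> r * ev (lin b * lin c * X a u) x" "\<And>x. 0 \<le> r * ev (lin a * lin b * X c u) x" "r \<noteq> 0"
  shows "X a u * X c u = 0"
proof (rule sph_eqI, rule ccontr)
  fix x assume x: "ev (X a u * X c u) x \<noteq> ev 0 x"
  note sc = symmetry_frame_cycle[OF symmetry_frame_cycle[OF sf]]
  have n: "a \<bullet> a = 1" "b \<bullet> b = 1" "c \<bullet> c = 1" and fr: "frame a b c"
    using sf by (auto simp: symmetry_frame_def frame_def)
  define A B C where d: "A = ev (lin a) x" "B = ev (lin b) x" "C = ev (lin c) x"
  have ac: "ev (X a u) x \<noteq> 0" "ev (X c u) x \<noteq> 0" using x by auto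
  then have ABC: "A \<noteq> 0" "B \<noteq> 0" "C \<noteq> 0"
    using ev_zero_mirror[OF n(1) symmetry_frame_parity(2)[OF sc], of x]
      ev_zero_mirror[OF n(2) symmetry_frame_parity(2)[OF sf], of x]
      ev_zero_mirror[OF n(3) symmetry_frame_parity(3)[OF sf], of x] by (auto simp: d)
  have "ev (X b u) x = 0"
    using arg_cong[OF triple_product_zero[OF sf], of "\<lambda>f. ev f x"] ac by simp
  then have "A * ev (X a u) x + C * ev (X c u) x = 0"
    using arg_cong[OF X_radial[OF fr, of u], of "\<lambda>f. ev f x"] by (simp add: d)
  then have "r * B * A * C * (A * ev (X a u) x + C * ev (X c u) x) = 0" by simp
  then have "A\<^sup>2 * (r * (B * C * ev (X a u) x)) + C\<^sup>2 * (r * (A * B * ev (X c u) x)) = 0"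
    by (simp add: power2_eq_square algebra_simps)
  moreover have "0 < A\<^sup>2 * (r * (B * C * ev (X a u) x))"
  proof -
    have "r * (B * C * ev (X a u) x) \<noteq> 0" using ABC ac r(3) by simp
    moreover have "0 \<le> r * (B * C * ev (X a u) x)" using r(1)[of x] by (simp add: d)
    ultimately have "0 < r * (B * C * ev (X a u) x)" by linarith
    then show ?thesis by (rule mult_pos_pos[rotated]) (use ABC in simp)
  qed
  moreover have "0 \<le> C\<^sup>2 * (r * (A * B * ev (X c u) x))"
    using r(2)[of x] by (simp add: d)
  ultimately show False by linarith
qed

end

lemma sgn_locally_constant:
  assumes "ev f x \<noteq> 0"
  shows "\<forall>\<^sub>F y in nhds x. sgn (ev f y) = sgn (ev f x)"
proof -
  have "x \<noteq> 0" using assms by auto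
  then have t: "(ev f \<longlongrightarrow> ev f x) (nhds x)"
    using ev_isCont tendsto_at_iff_tendsto_nhds[of "ev f" x] by (simp add: isCont_def)
  show ?thesis
  proof (cases "0 < ev f x")
    case True
    have "\<forall>\<^sub>F y in nhds x. 0 < ev f y" by (rule order_tendstoD(1)[OF t True])
    then show ?thesis by eventually_elim (use True in simp)
  next
    case False
    then have "ev f x < 0" using assms by simp
    have "\<forall>\<^sub>F y in nhds x. ev f y < 0" by (rule order_tendstoD(2)[OF t \<open>ev f x < 0\<close>])
    then show ?thesis by eventually_elim (use \<open>ev f x < 0\<close> in simp)
  qed
qed

context bounded_mean_field begin

text \<open>Disjoint supports make both derivatives pieces of the single function X (a + c) u, so
  \<open>step_X_u_vanishes\<close> can treat them jointly. The factors sgn C and sgn A adjust their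
  parities: both pieces become even in a and c and odd in b, which leaves \<open>lin b\<close> as
  the only moment to remove.\<close>

lemma disjoint_supports_imp_zero:
  assumes sf: "symmetry_frame a b c" and z: "X a u * X c u = 0"
  shows "X a u = 0 \<or> X c u = 0"
proof -
  note sc = symmetry_frame_cycle[OF symmetry_frame_cycle[OF sf]]
  have fr: "frame a b c" using sf by (simp add: symmetry_frame_def)
  have n: "a \<bullet> a = 1" "b \<bullet> b = 1" "c \<bullet> c = 1" using fr by (auto simp: frame_def)
  note para = symmetry_frame_parity[OF sf] and parc = symmetry_frame_parity[OF sc] and pl = frame_pull_lin[OF fr]
  define p r where "p = ev (X a u)" and "r = ev (X c u)"
  define A C where "A = ev (lin a)" and "C = ev (lin c)"
  have pr: "p x = 0 \<or> r x = 0" for x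
    using arg_cong[OF z, of "\<lambda>f. ev f x"] by (simp add: p_def r_def)
  have C0: "C x \<noteq> 0" if "p x \<noteq> 0" for x
    using ev_zero_mirror[OF n(3) para(3), of x] that by (auto simp: C_def p_def)
  have A0: "A x \<noteq> 0" if "r x \<noteq> 0" for x
    using ev_zero_mirror[OF n(1) parc(2), of x] that by (auto simp: A_def r_def)
  define \<phi> where "\<phi> = X (a + c) u"
  have phi: "ev \<phi> x = p x + r x" for x by (simp add: \<phi>_def X_vec p_def r_def)
  define s1 where "s1 x = (if p x \<noteq> 0 then sgn (C x) else 0)" for x
  define s2 where "s2 x = (if r x \<noteq> 0 then sgn (A x) else 0)" for x
  have nz: "\<forall>\<^sub>F y in nhds x. p y \<noteq> 0" if "p x \<noteq> 0" for x
    using sgn_locally_constant[of "X a u" x] that by (auto simp: p_def sgn_zero_iff elim!: eventually_mono)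
  have nz': "\<forall>\<^sub>F y in nhds x. r y \<noteq> 0" if "r x \<noteq> 0" for x
    using sgn_locally_constant[of "X c u" x] that by (auto simp: r_def sgn_zero_iff elim!: eventually_mono)
  have e1: "\<forall>\<^sub>F y in nhds x. s1 y = s1 x \<and> s2 y = s2 x" if x: "ev \<phi> x \<noteq> 0" for x
  proof (cases "p x = 0")
    case False
    have "\<forall>\<^sub>F y in nhds x. sgn (C y) = sgn (C x)"
      using sgn_locally_constant[of "lin c" x] C0[OF False] by (simp add: C_def)
    with nz[OF False] show ?thesis
      by eventually_elim (use False pr in \<open>metis s1_def s2_def\<close>)
  next
    case True
    then have r: "r x \<noteq> 0" using x by (simp add: phi)
    have "\<forall>\<^sub>F y in nhds x. sgn (A y) = sgn (A x)"
      using sgn_locally_constant[of "lin a" x] A0[OF r] by (simp add: A_def)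
    with nz'[OF r] show ?thesis
      by eventually_elim (use r pr in \<open>metis s1_def s2_def\<close>)
  qed
  have st: "step_on \<phi> s1" "step_on \<phi> s2"
  proof -
    have "\<bar>s1 x\<bar> \<le> 1" "\<bar>s2 x\<bar> \<le> 1" for x by (simp_all add: s1_def s2_def abs_sgn_eq)
    then have "\<exists>K. \<forall>x. \<bar>s1 x\<bar> \<le> K" "\<exists>K. \<forall>x. \<bar>s2 x\<bar> \<le> K" by blast+
    moreover have "s1 (t *\<^sub>R x) = s1 x" "s2 (t *\<^sub>R x) = s2 x" if "0 < t" for t x
      using that by (simp_all add: s1_def s2_def p_def r_def A_def C_def ev_scale)
    moreover have "s1 x = 0" "s2 x = 0" if "ev \<phi> x = 0" for x
      using that pr[of x] by (auto simp: s1_def s2_def phi)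
    moreover have "\<forall>\<^sub>F y in nhds x. s1 y = s1 x" "\<forall>\<^sub>F y in nhds x. s2 y = s2 x" if "ev \<phi> x \<noteq> 0" for x
      using e1[OF that] by (auto elim: eventually_mono)
    ultimately show "step_on \<phi> s1" "step_on \<phi> s2" unfolding step_on_def by blast+
  qed
  obtain \<alpha> \<beta> where ab: "\<alpha> \<noteq> 0 \<or> \<beta> \<noteq> 0"
    "\<alpha> * sint (\<lambda>x. s1 x * ev \<phi> x * ev (lin b) x) + \<beta> * sint (\<lambda>x. s2 x * ev \<phi> x * ev (lin b) x) = 0"
    using linear_combination_zero by blast
  define s where "s x = \<alpha> * s1 x + \<beta> * s2 x" for x
  have step: "step_on \<phi> s" unfolding s_def[abs_def] by (rule step_on_combine[OF st])
  define F where "F x = s x * ev \<phi> x" for x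
  have aF: "adm F" unfolding F_def by (intro adm_mult adm_ev step_on_adm[OF step])
  have Fx: "F x = \<alpha> * (s1 x * p x) + \<beta> * (s2 x * r x)" for x
    using pr[of x] by (auto simp: F_def s_def s1_def s2_def phi)
  have pm: "p (mirror a x) = p x" "p (mirror b x) = - p x" "p (mirror c x) = - p x"
    "r (mirror a x) = - r x" "r (mirror b x) = - r x" "r (mirror c x) = r x"
    "C (mirror a x) = C x" "C (mirror b x) = C x" "C (mirror c x) = - C x"
    "A (mirror a x) = - A x" "A (mirror b x) = A x" "A (mirror c x) = A x" for x
    unfolding p_def r_def A_def C_def ev_pull_mirror[OF n(1), symmetric] ev_pull_mirror[OF n(2), symmetric]
      ev_pull_mirror[OF n(3), symmetric] para parc pl by simp_all
  have F: "F (mirror a x) = 1 * F x" "F (mirror b x) = - 1 * F x" "F (mirror c x) = 1 * F x" for x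
    unfolding Fx s1_def s2_def pm by (simp_all add: sgn_minus)
  have even: "sint (\<lambda>x. F x * ev g x) = 0"
    if "pull (mirror b) g = g \<or> pull (mirror a) g = - g \<or> pull (mirror c) g = - g" for g
    using sint_parity[OF aF n(1) F(1)] sint_parity[OF aF n(2) F(2)] sint_parity[OF aF n(3) F(3)] that by auto
  have "sint F = 0"
  proof -
    have "sint F = sint (\<lambda>x. F x * ev 1 x)" by (rule sint_cong) (simp add: ev_one)
    then show ?thesis using even[of 1] pull_lin_mirror(3)[OF n(2)] by simp
  qed
  moreover have l: "sint (\<lambda>x. F x * ev (lin b) x) = 0"
  proof -
    have "sint (\<lambda>x. F x * ev (lin b) x) =
        sint (\<lambda>x. \<alpha> * (s1 x * ev \<phi> x * ev (lin b) x) + \<beta> * (s2 x * ev \<phi> x * ev (lin b) x))"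
      by (simp add: F_def s_def algebra_simps)
    also have "\<dots> = \<alpha> * sint (\<lambda>x. s1 x * ev \<phi> x * ev (lin b) x) + \<beta> * sint (\<lambda>x. s2 x * ev \<phi> x * ev (lin b) x)"
      unfolding sint_cmult[symmetric] by (intro sint_add adm_mult adm_const adm_ev step_on_adm[OF st(1)] step_on_adm[OF st(2)])
    finally show ?thesis using ab(2) by simp
  qed
  moreover have "sint (\<lambda>x. F x * ev (lin v) x) = 0" if "v \<in> {a, b, c}" for v
    using that l even[of "lin a"] even[of "lin c"] pl by auto
  ultimately have "sint (\<lambda>x. F x * ev f x) = 0" if "spoly 3 f" for f
    by (intro sint_spoly_3[OF aF fr _ _ _ _ _ _ that]) (auto intro!: even simp: pl pull_mult simp del: ev_simps)
  then have van: "F x = 0" for x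
    using step_X_u_vanishes[of "a + c" s] step unfolding F_def \<phi>_def by blast
  show ?thesis
  proof (cases "\<alpha> = 0")
    case True
    then have "\<beta> \<noteq> 0" using ab(1) by simp
    have "r x = 0" for x
      using van[of x] A0[of x] True \<open>\<beta> \<noteq> 0\<close> by (auto simp: Fx s2_def sgn_zero_iff split: if_splits)
    then have "X c u = 0" by (intro sph_eqI) (simp add: r_def)
    then show ?thesis ..
  next
    case False
    have "p x = 0" for x
      using van[of x] C0[of x] False pr[of x] by (auto simp: Fx s1_def sgn_zero_iff split: if_splits)
    then have "X a u = 0" by (intro sph_eqI) (simp add: p_def)
    then show ?thesis ..
  qed
qed

lemma rotation_field_vanishes: "\<exists>v. norm v = 1 \<and> X v u = 0"
proof -
  define q where "q v w = I (lin v * lin w * u)" for v w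
  have "\<exists>a b c. frame a b c \<and> q a b = 0 \<and> q b c = 0 \<and> q c a = 0"
    by (rule quadratic_eigenframe) (simp_all add: q_def lin_vec distrib_right distrib_left mult.commute)
  then obtain a b c where fr: "frame a b c" and q: "q a b = 0" "q b c = 0" "q c a = 0" by blast
  note fr' = frame_cycle[OF fr] frame_cycle[OF frame_cycle[OF fr]]
  have sf: "symmetry_frame a b c"
    using fr reflection_symmetric[OF fr] reflection_symmetric[OF fr'(1)] reflection_symmetric[OF fr'(2)] q
    by (simp add: symmetry_frame_def q_def)
  have n: "norm a = 1" "norm b = 1" "norm c = 1" using fr by (auto simp: frame_def norm_eq_1)
  note sb = symmetry_frame_cycle[OF sf]
  note sc = symmetry_frame_cycle[OF sb]
  have pair: "X a u = 0 \<or> X c u = 0"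
    if "symmetry_frame a b c" "r \<noteq> 0" "\<forall>x. 0 \<le> r * ev (lin b * lin c * X a u) x" "\<forall>x. 0 \<le> r * ev (lin a * lin b * X c u) x"
    for a b c r
    using disjoint_supports_imp_zero[OF that(1) equal_signs_product_zero[OF that(1)]] that(2-4) by blast
  obtain r1 r2 r3 :: real where r: "r1 \<in> {1, -1}" "r2 \<in> {1, -1}" "r3 \<in> {1, -1}"
    "\<forall>x. 0 \<le> r1 * ev (lin b * lin c * X a u) x" "\<forall>x. 0 \<le> r2 * ev (lin c * lin a * X b u) x"
    "\<forall>x. 0 \<le> r3 * ev (lin a * lin b * X c u) x"
    using X_u_sign[OF sf] X_u_sign[OF sb] X_u_sign[OF sc] by blast
  \<comment> \<open>Three signs with two possible values: two agree, and a cyclic permutation puts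
    these two in the position required by \<open>pair\<close>.\<close>
  then have "r1 \<noteq> 0" "r2 \<noteq> 0" "r3 \<noteq> 0" "r1 = r3 \<or> r2 = r1 \<or> r3 = r2" by auto
  then have "X a u = 0 \<or> X b u = 0 \<or> X c u = 0"
    using pair[OF sf, of r1] pair[OF sb, of r2] pair[OF sc, of r3] r(4-6) by metis
  then show ?thesis using n by blast
qed

end

section \<open>From a vanishing rotation derivative to axial symmetry\<close>

lemma invariant_imp_equal:
  assumes c: "norm c = 1" and X: "X c f = 0" and x: "norm x = 1" and y: "norm y = 1" and xy: "c \<bullet> x = c \<bullet> y"
  shows "ev f x = ev f y"
proof -
  have x0: "x \<noteq> 0" using x by auto
  have "((\<lambda>t. ev f (rotate_about c t x)) has_real_derivative 0) (at t)" for t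
    using rotate_derivative_everywhere[OF c x0 ev_rotate_derivative[of _ f c]] X by simp
  then have const: "ev f (rotate_about c t x) = ev f x" for t
    using DERIV_isconst_all[of "\<lambda>t. ev f (rotate_about c t x)" t 0] by simp
  have cc: "c \<bullet> c = 1" using c by (simp add: norm_eq_1)
  define w w' where "w = x - (c \<bullet> x) *\<^sub>R c" and "w' = y - (c \<bullet> x) *\<^sub>R c"
  have cw: "c \<bullet> w = 0" "c \<bullet> w' = 0" using cc xy by (simp_all add: w_def w'_def inner_diff_right)
  have nw: "norm w = norm w'"
  proof -
    have "w \<bullet> w = 1 - (c \<bullet> x)\<^sup>2" "w' \<bullet> w' = 1 - (c \<bullet> x)\<^sup>2"
      using x y xy cc by (simp_all add: w_def w'_def norm_eq_1 inner_diff_left inner_diff_right inner_commute power2_eq_square)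
    then show ?thesis by (simp add: norm_eq)
  qed
  show ?thesis
  proof (cases "w = 0")
    case True
    then have "x = y" using nw by (simp add: w_def w'_def)
    then show ?thesis by simp
  next
    case False
    define b where "b = w /\<^sub>R norm w"
    have wb: "w = norm w *\<^sub>R b" using False by (simp add: b_def)
    have fr: "frame c b (cross3 c b)"
      by (rule frameI) (use False c cw in \<open>simp_all add: b_def\<close>)
    define p q where "p = (b \<bullet> w') / norm w" and "q = (cross3 c b \<bullet> w') / norm w"
    have "(b \<bullet> w')\<^sup>2 + (cross3 c b \<bullet> w')\<^sup>2 = (norm w)\<^sup>2"
      using frame_norm_sq[OF fr, of w'] cw nw by simp
    \<comment> \<open>p and q are the coordinates of w' relative to w and its quarter turn about c,
      so they are the cosine and sine of the angle that carries x to y.\<close>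
    then have "p\<^sup>2 + q\<^sup>2 = 1"
      unfolding p_def q_def power_divide add_divide_distrib[symmetric] using False by simp
    then obtain t where t: "p = cos t" "q = sin t" using sincos_total_2pi by metis
    have "w' = (b \<bullet> w') *\<^sub>R b + (cross3 c b \<bullet> w') *\<^sub>R cross3 c b"
      using frame_expand[OF fr, of w'] cw by simp
    also have "\<dots> = cos t *\<^sub>R w + sin t *\<^sub>R cross3 c w"
    proof -
      have "p *\<^sub>R w = (b \<bullet> w') *\<^sub>R b"
        by (subst wb) (use False in \<open>simp add: p_def\<close>)
      moreover have "q *\<^sub>R cross3 c w = (cross3 c b \<bullet> w') *\<^sub>R cross3 c b"
        by (subst wb) (use False in \<open>simp add: q_def cross_mult_right\<close>)
      ultimately show ?thesis by (simp add: t)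
    qed
    also have "cross3 c w = cross3 c x" by (simp add: w_def Cross3.right_diff_distrib cross_mult_right)
    finally have "rotate_about c t x = y" by (simp add: rotate_about_def w_def[symmetric]) (simp add: w'_def algebra_simps)
    then show ?thesis using const[of t] by simp
  qed
qed

text \<open>A rotation fixing c preserves c \<bullet> x, and f is constant on each circle of
  latitude; R need not be written as a rotation by an angle.\<close>

lemma axially_symmetric_S2I:
  assumes f: "\<forall>x\<in>S2. ev f x = u x" and c: "norm c = 1" and X: "X c f = 0"
  shows "axially_symmetric_S2 u"
  unfolding axially_symmetric_S2_def
proof (intro exI[of _ c] conjI allI impI ballI)
  show "c \<noteq> 0" using c by auto
  fix R :: "real^3^3" and x :: "real^3"
  assume R: "rotation_matrix R \<and> R *v c = c" and x: "x \<in> S2"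
  then have o: "orthogonal_transformation ((*v) R)"
    by (simp add: rotation_matrix_def orthogonal_transformation_matrix)
  have "norm (R *v x) = 1" using orthogonal_transformation_norm[OF o, of x] x by simp
  moreover have "c \<bullet> (R *v x) = c \<bullet> x"
    using o R unfolding orthogonal_transformation_def by metis
  ultimately show "u (R *v x) = u x"
    using invariant_imp_equal[OF c X, of "R *v x" x] f x by simp
qed

section \<open>Triviality of axially symmetric solutions for lam = 6\<close>

context mean_field begin

text \<open>With \<open>C = c \<bullet> x\<close> the function \<open>G = \<Gamma>(C, u)\<close> satisfies \<open>\<Gamma>(u, G) = G \<Delta>u\<close> by axial symmetry, hence
  \<open>2 \<integral>C G \<Delta>u = - \<integral>G\<^sup>2\<close>. By the equation the left-hand side is a multiple of \<open>\<lambda> - 6\<close>.\<close>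

lemma axially_symmetric_trivial:
  assumes c: "norm c = 1" and X0: "X c u = 0" and l6: "lam = 6"
  shows "u = 0"
proof -
  obtain a b where "frame c a b" using frame_exists[OF c] by blast
  then have fr: "frame a b c" by (rule frame_cycle)
  define A B C p q where d: "A = lin a" "B = lin b" "C = lin c" "p = X a u" "q = X b u"
  have XA: "X a A = 0" "X b A = C" "X c A = - B" "X a B = - C" "X b B = 0" "X c B = A" "X a C = B" "X b C = - A" "X c C = 0"
    unfolding d X_simps frame_cross[OF fr] cross_refl lin_vec by simp_all
  have rad: "A * p + B * q = 0" using X_radial[OF fr, of u] X0 by (simp add: d)
  have one: "A * A + B * B + C * C = 1" using lin_frame[OF fr] by (simp add: d)
  define G where "G = B * p - A * q"
  have G: "Gam C f = B * X a f - A * X b f" for f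
    unfolding Gam_frame[OF fr] XA by simp
  have ha: "A * X a p - C * q + B * X a q = 0"
    using arg_cong[OF rad, of "X a"] by (simp add: XA algebra_simps)
  have hb: "C * p + A * X b p + B * X b q = 0"
    using arg_cong[OF rad, of "X b"] by (simp add: XA algebra_simps)
  have lapu: "lap u = X a p + X b q" unfolding lap_frame[OF fr] by (simp add: d X0)
  have "Gam u G = p * X a G + q * X b G" unfolding Gam_frame[OF fr] by (simp add: d X0)
  \<comment> \<open>The added terms are multiples of the radial relation \<open>rad\<close> and of
    its derivatives \<open>ha\<close> and \<open>hb\<close>, all of which are zero.\<close>
  also have "\<dots> = G * lap u + q * (A * X a p - C * q + B * X a q) - p * (C * p + A * X b p + B * X b q)
      + (X b p - X a q) * (A * p + B * q)"
    unfolding lapu G_def X_diff X_simps(2) XA by (simp add: algebra_simps)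
  finally have GG: "Gam u G = G * lap u" by (simp add: rad ha hb)
  have "I (C * G * lap u) = - I (Gam u (C * G))" using I_lap[of "C * G" u] by (simp add: Gam_commute)
  also have "Gam u (C * G) = G * G + C * G * lap u"
  proof -
    have "Gam u C = G" unfolding Gam_commute[of u C] G G_def d(4,5) ..
    then show ?thesis by (simp only: Gam_simps(5) GG mult.assoc)
  qed
  finally have 1: "2 * I (C * G * lap u) = - I (G * G)" by simp
  have lapC: "lap (C * C) = 2 *\<^sub>R 1 - 6 *\<^sub>R (C * C)" unfolding d by (rule lap_lin_square[OF c])
  have gC: "2 * I (C * Gam C f) = - 2 * I f + 6 * I (C * C * f)" for f
  proof -
    have "I (Gam f (C * C)) = - I (f * lap (C * C))" using I_lap[of f "C * C"] by simp
    moreover have "Gam f (C * C) = 2 *\<^sub>R (C * Gam C f)"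
      by (simp add: Gam_commute[of f C] scaleR_2 algebra_simps)
    moreover have "f * lap (C * C) = 2 *\<^sub>R f - 6 *\<^sub>R (C * C * f)"
      by (simp add: lapC right_diff_distrib mult_ac)
    ultimately show ?thesis by simp
  qed
  have CG: "C * G * lap u = 6 *\<^sub>R (C * Gam C u) - 6 *\<^sub>R (C * Gam C (ex u))"
    by (simp add: eq l6 Gam_ex G G_def d(4,5)[symmetric] algebra_simps)
  have CC: "6 * I (C * C) = 2 * I 1" using I_lap_0[of "C * C"] by (simp add: lapC)
  have "I (C * C * lap u) = 6 * I (C * C) - 6 * I (C * C * ex u)"
    by (simp add: eq l6 right_diff_distrib)
  moreover have "I (C * C * lap u) = 2 * I u - 6 * I (C * C * u)"
    unfolding I_lap_symmetric lapC by (simp add: left_diff_distrib)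
  \<comment> \<open>Here 6 is the eigenvalue of 3 C * C - 1: testing the equation with this function
    shows that u and \<open>ex u\<close> have equal moments against it, and by \<open>gC\<close> the
    integral is 6 times the difference of these moments.\<close>
  ultimately have "I (C * G * lap u) = 0"
    using gC[of u] gC[of "ex u"] CC I_ex by (simp add: CG)
  then have "G = 0" using 1 by (intro I_square_0) simp
  \<comment> \<open>The factor A * A + B * B vanishes exactly at the poles. There, differentiating
    the hypothesis twice along X b leaves 2 C * C * f = 0 with C * C = 1.\<close>
  have pol: "f = 0" if f: "(A * A + B * B) * f = 0" for f
  proof -
    have f1: "2 *\<^sub>R (A * C * f) + (A * A + B * B) * X b f = 0"
      using arg_cong[OF f, of "X b"] by (simp add: XA scaleR_2 algebra_simps)
    have f2: "2 *\<^sub>R (C * C * f) - 2 *\<^sub>R (A * A * f) + 4 *\<^sub>R (A * C * X b f) + (A * A + B * B) * X b (X b f) = 0"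
    proof -
      have "4 *\<^sub>R g = (1 + 1 + 1 + 1) *\<^sub>R g" for g :: sph by simp
      then have "4 *\<^sub>R g = g + g + g + g" for g :: sph by (simp only: scaleR_add_left scaleR_one)
      then show ?thesis using arg_cong[OF f1, of "X b"] by (simp add: XA scaleR_2 algebra_simps)
    qed
    show ?thesis
    proof (rule sph_eqI)
      fix x assume "x \<in> S2"
      then have x: "x \<noteq> 0" by (rule S2_nonzero)
      have s: "ev A x * ev A x + ev B x * ev B x + ev C x * ev C x = 1"
        using arg_cong[OF one, of "\<lambda>f. ev f x"] x by (simp add: ev_one)
      show "ev f x = ev 0 x"
      proof (cases "ev A x * ev A x + ev B x * ev B x = 0")
        case True
        then have "ev A x = 0" "ev B x = 0" "ev C x * ev C x = 1" using s by (simp_all add: sum_squares_eq_zero_iff)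
        then show ?thesis using arg_cong[OF f2, of "\<lambda>f. ev f x"] by simp
      next
        case False
        then show ?thesis using arg_cong[OF f, of "\<lambda>f. ev f x"] by auto
      qed
    qed
  qed
  have "(A * A + B * B) * p = A * (A * p + B * q) + B * G" "(A * A + B * B) * q = B * (A * p + B * q) - A * G"
    by (simp_all add: G_def algebra_simps)
  then have "p = 0" "q = 0" using pol rad \<open>G = 0\<close> by simp_all
  then have "lap u = 0" by (simp add: lapu)
  then have "ex u = 1" using eq l6 by simp
  show ?thesis
  proof (rule sph_eqI)
    fix x assume "x \<in> S2"
    then have "exp (ev u x) = 1"
      using arg_cong[OF \<open>ex u = 1\<close>, of "\<lambda>f. ev f x"] S2_nonzero by (simp add: ev_ex ev_one)
    then show "ev u x = ev 0 x" by simp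
  qed
qed

end

theorem lemma10:
  fixes \<alpha> :: real and u :: "real^3 \<Rightarrow> real"
  assumes "1 / 4 \<le> \<alpha>" and "\<alpha> < 1"
    and "is_solution_S2 \<alpha> u"
  shows "((\<forall>x\<in>S2. exp (u x) \<le> 6 * \<alpha>) \<longrightarrow> axially_symmetric_S2 u) \<and>
         (\<alpha> = 1 / 3 \<and> (\<forall>x\<in>S2. exp (u x) \<le> 2) \<longrightarrow> (\<forall>x\<in>S2. u x = 0))"
proof -
  obtain f where f: "\<forall>x\<in>S2. ev f x = u x"
    using assms(3) smooth_on_S2_sph unfolding is_solution_S2_def by blast
  have \<alpha>: "0 < \<alpha>" using assms(1) by simp
  interpret mean_field f "2 / \<alpha>"
  proof
    show "2 < 2 / \<alpha>" using \<alpha> assms(2) by (simp add: field_simps)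
    show "lap f = (2 / \<alpha>) *\<^sub>R (1 - ex f)"
    proof (rule sph_eqI)
      fix x assume x: "x \<in> S2"
      have "\<alpha> / 2 * ev (lap f) x + exp (u x) - 1 = 0"
        using assms(3) x unfolding is_solution_S2_def laplace_beltrami_eq_lap[OF f x, symmetric] by blast
      then have "ev (lap f) x = (2 / \<alpha>) * (1 - exp (u x))" using \<alpha> by (simp add: field_simps)
      then show "ev (lap f) x = ev ((2 / \<alpha>) *\<^sub>R (1 - ex f)) x"
        using S2_nonzero[OF x] f x by (simp add: ev_one ev_ex)
    qed
  qed
  have main: "\<exists>v. norm v = 1 \<and> X v f = 0" if "\<forall>x\<in>S2. exp (u x) \<le> 6 * \<alpha>"
  proof -
    interpret bounded_mean_field f "2 / \<alpha>"
    proof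
      fix x :: "real^3" assume x: "x \<noteq> 0"
      then have S: "x /\<^sub>R norm x \<in> S2" by simp
      have "ev f x = u (x /\<^sub>R norm x)"
        using f S ev_scale[of "inverse (norm x)" f x] x by simp
      then have "exp (ev f x) \<le> 6 * \<alpha>" using that S by simp
      then show "2 / \<alpha> * exp (ev f x) \<le> 12" using \<alpha> by (simp add: field_simps)
    qed
    show ?thesis by (rule rotation_field_vanishes)
  qed
  have "axially_symmetric_S2 u" if "\<forall>x\<in>S2. exp (u x) \<le> 6 * \<alpha>"
    using main[OF that] axially_symmetric_S2I[OF f] by blast
  moreover have "\<forall>x\<in>S2. u x = 0" if "\<alpha> = 1 / 3" "\<forall>x\<in>S2. exp (u x) \<le> 2"
  proof -
    \<comment> \<open>For \<alpha> = 1/3 the general bound 6 \<alpha> is 2, and 2 / \<alpha> is the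
      value 6 required for triviality.\<close>
    have "\<forall>x\<in>S2. exp (u x) \<le> 6 * \<alpha>" unfolding that(1) using that(2) by simp
    then obtain v where "norm v = 1" "X v f = 0" using main by blast
    then have "f = 0" using axially_symmetric_trivial that(1) by simp
    then show ?thesis using f by simp
  qed
  ultimately show ?thesis by blast
qed

end
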